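(* Let $1<\lambda<2$. A $2\pi$-periodic solution $\psi$ of $$-\lambda\psi\psi''+(\lambda-1)(\psi')^2-\lambda^2\psi^2+2(\lambda-1)P=0\qquad (P \text{ a constant})$$ can be obtained by gluing (for a suitable common value of $P\le 0$) any of the following combinations of maximal local solutions, in any order, with alternating signs: (i) $2k$ copies of $\psi_-$, for $k\ge 2$; (ii) one copy of $\psi_+$ and $2k-1$ copies of $\psi_-$, for $k\geq 2$; (iii) two copies of $\psi_+$; (iv) two copies of $\psi_+$ and two copies of $\psi_-$. In particular, for $1<\lambda\le\frac32$, the possibilities (i)–(iv) together with (v) two copies of $\psi_+$ and $2k$ copies of $\psi_-$, for $k\ge2$, constitute the complete list of possible gluing combinations.
   Context: On an interval where a solution $\psi$ of the displayed ODE is positive, the quantity $B=(2P+(\psi')^2+\lambda^2\psi^2)\psi^{\frac2\lambda-2}$ is constant and $\psi''=\frac{(\lambda-1)B}{\lambda}\psi^{1-\frac2\lambda}-\lambda^2\psi$. By scaling ($(\psi,P)\mapsto(a\psi,a^2P)$, $a>0$), local solutions are normalized to $B=1$ or $B=-1$. For $P<0$, $\psi_+$ and $\psi_-$ denote the maximal positive local solutions (unique up to translation) with $B=1$ and $B=-1$ respectively, so $(\psi_\pm')^2=-2P\pm\psi_\pm^{2-\frac2\lambda}-\lambda^2\psi_\pm^2$. Each is defined on an interval of finite length, the lifespan $T_\pm=T_\pm(P)$, vanishes at the two endpoints, and has $\psi'=\pm\sqrt{-2P}$ at the left/right endpoint. For $P=0$, $\psi_+(\theta)=\lambda^{-\lambda}\sin^\lambda\theta$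 on $[0,\pi]$, so its lifespan is $\pi$, and there is no (nontrivial) $\psi_-$. Gluing means: take an even number of local solutions $\phi_1,\dots,\phi_{2m}$, each a copy of $\psi_+$ or $\psi_-$ and all with the same value of $P$, and concatenate $\phi_1,-\phi_2,\phi_3,-\phi_4,\dots,-\phi_{2m}$ on consecutive intervals. The result is a $C^1$ function which extends periodically, solves the ODE with constant $P$ (classically where $\psi\neq0$ and weakly across the zeros), and is considered as a $2\pi$-periodic solution when the lifespans of the pieces sum to $2\pi$. A combination is possible if there is a value of $P\le0$ for which the lifespans of its pieces sum to $2\pi$. *)

theory Defs
  imports "HOL-Analysis.Analysis"
begin

definition solves_ode_at :: "real \<Rightarrow> real \<Rightarrow> (real \<Rightarrow> real) \<Rightarrow> real \<Rightarrow> bool" where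
  "solves_ode_at lam P \<psi> \<theta> \<longleftrightarrow>
     \<psi> differentiable (at \<theta>) \<and> deriv \<psi> differentiable (at \<theta>) \<and>
     - lam * \<psi> \<theta> * deriv (deriv \<psi>) \<theta> + (lam - 1) * (deriv \<psi> \<theta>)\<^sup>2
       - lam\<^sup>2 * (\<psi> \<theta>)\<^sup>2 + 2 * (lam - 1) * P = 0"

definition positive_solution_on :: "real \<Rightarrow> real \<Rightarrow> (real \<Rightarrow> real) \<Rightarrow> real set \<Rightarrow> bool" where
  "positive_solution_on lam P \<psi> I \<longleftrightarrow>
     open I \<and> is_interval I \<and> I \<noteq> {} \<and> (\<forall>\<theta>\<in>I. 0 < \<psi> \<theta> \<and> solves_ode_at lam P \<psi> \<theta>)"

definition maximal_positive_solution_on ::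
    "real \<Rightarrow> real \<Rightarrow> (real \<Rightarrow> real) \<Rightarrow> real set \<Rightarrow> bool" where
  "maximal_positive_solution_on lam P \<psi> I \<longleftrightarrow>
     positive_solution_on lam P \<psi> I \<and>
     (\<forall>\<phi> J. positive_solution_on lam P \<phi> J \<and> I \<subseteq> J \<and> (\<forall>\<theta>\<in>I. \<phi> \<theta> = \<psi> \<theta>) \<longrightarrow> J = I)"

definition B_quantity :: "real \<Rightarrow> real \<Rightarrow> (real \<Rightarrow> real) \<Rightarrow> real \<Rightarrow> real" where
  "B_quantity lam P \<psi> \<theta> =
     (2 * P + (deriv \<psi> \<theta>)\<^sup>2 + lam\<^sup>2 * (\<psi> \<theta>)\<^sup>2) * \<psi> \<theta> powr (2 / lam - 2)"

datatype piece = Plus | Minus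

fun B_value :: "piece \<Rightarrow> real" where
  "B_value Plus = 1"
| "B_value Minus = -1"

(* \<phi> restricted to the open interval (a, b) is a translate of \<psi>\<^sub>+ (s = Plus) or of \<psi>\<^sub>- (s = Minus);
   the values of \<phi> outside (a, b) are irrelevant. *)
definition local_solution ::
    "real \<Rightarrow> real \<Rightarrow> piece \<Rightarrow> (real \<Rightarrow> real) \<Rightarrow> real \<Rightarrow> real \<Rightarrow> bool" where
  "local_solution lam P s \<phi> a b \<longleftrightarrow>
     a < b \<and> maximal_positive_solution_on lam P \<phi> {a<..<b} \<and>
     (\<forall>\<theta>\<in>{a<..<b}. B_quantity lam P \<phi> \<theta> = B_value s)"

(* A relation rather than a function of P, since \<psi>\<^sub>- does not exist for P = 0. *)
definition lifespan :: "real \<Rightarrow> real \<Rightarrow> piece \<Rightarrow> real \<Rightarrow> bool" where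
  "lifespan lam P s T \<longleftrightarrow> (\<exists>\<phi> a b. local_solution lam P s \<phi> a b \<and> T = b - a)"

(* The combination of p copies of \<psi>\<^sub>+ and q copies of \<psi>\<^sub>-.  A piece that is not used need not exist. *)
definition combination_possible :: "real \<Rightarrow> nat \<Rightarrow> nat \<Rightarrow> bool" where
  "combination_possible lam p q \<longleftrightarrow>
     even (p + q) \<and>
     (\<exists>P\<le>0. \<exists>Tp Tm. (0 < p \<longrightarrow> lifespan lam P Plus Tp) \<and> (0 < q \<longrightarrow> lifespan lam P Minus Tm) \<and>
        real p * Tp + real q * Tm = 2 * pi)"

(* One period of \<psi>: the i-th piece (counted from 0) lives on (t i, t (i + 1)) and carries the
   sign (-1)^i. *)
definition glued :: "real \<Rightarrow> real \<Rightarrow> piece list \<Rightarrow> (real \<Rightarrow> real) \<Rightarrow> bool" where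
  "glued lam P ss \<psi> \<longleftrightarrow>
     even (length ss) \<and>
     (\<exists>t. t 0 = 0 \<and> t (length ss) = 2 * pi \<and>
        (\<forall>i<length ss. \<exists>\<phi>. local_solution lam P (ss ! i) \<phi> (t i) (t (Suc i)) \<and>
           (\<forall>\<theta>\<in>{t i<..<t (Suc i)}. \<psi> \<theta> = (-1) ^ i * \<phi> \<theta>)))"

(* Obtained by testing the ODE with \<eta> and writing
   - lam \<psi> \<psi>'' \<eta> = - lam (\<psi> \<psi>' \<eta>)' + lam (\<psi>')^2 \<eta> + lam \<psi> \<psi>' \<eta>'. *)
definition weak_solution :: "real \<Rightarrow> real \<Rightarrow> (real \<Rightarrow> real) \<Rightarrow> bool" where
  "weak_solution lam P \<psi> \<longleftrightarrow>
     (\<forall>\<eta>. (\<forall>\<theta>. \<eta> differentiable (at \<theta>)) \<and> continuous_on UNIV (deriv \<eta>) \<and>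
          (\<exists>a b. \<forall>\<theta>. \<theta> \<notin> {a..b} \<longrightarrow> \<eta> \<theta> = 0) \<longrightarrow>
        ((\<lambda>\<theta>. lam * \<psi> \<theta> * deriv \<psi> \<theta> * deriv \<eta> \<theta> +
              ((2 * lam - 1) * (deriv \<psi> \<theta>)\<^sup>2 - lam\<^sup>2 * (\<psi> \<theta>)\<^sup>2 + 2 * (lam - 1) * P) * \<eta> \<theta>)
           has_integral 0) UNIV)"

definition periodic_solution :: "real \<Rightarrow> real \<Rightarrow> (real \<Rightarrow> real) \<Rightarrow> bool" where
  "periodic_solution lam P \<psi> \<longleftrightarrow>
     (\<forall>\<theta>. \<psi> (\<theta> + 2 * pi) = \<psi> \<theta>) \<and>
     (\<forall>\<theta>. \<psi> differentiable (at \<theta>)) \<and> continuous_on UNIV (deriv \<psi>) \<and>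
     (\<forall>\<theta>. \<psi> \<theta> \<noteq> 0 \<longrightarrow> solves_ode_at lam P \<psi> \<theta>) \<and>
     weak_solution lam P \<psi>"

definition solution_by_gluing_in_any_order :: "real \<Rightarrow> nat \<Rightarrow> nat \<Rightarrow> bool" where
  "solution_by_gluing_in_any_order lam p q \<longleftrightarrow>
     (\<exists>P\<le>0. \<forall>ss. count_list ss Plus = p \<and> count_list ss Minus = q \<longrightarrow>
        (\<exists>\<psi>. glued lam P ss \<psi> \<and> periodic_solution lam P \<psi>))"

end

theory Submission
  imports Defs "HOL-Real_Asymp.Real_Asymp"
begin

text \<open>Put \<open>\<mu> = lam - 1\<close>. Along a local solution with \<open>B = \<plusminus>1\<close> the first-order law
\<open>(\<psi>')\<^sup>2 = - 2 P \<plusminus> \<psi> powr (2 - 2 / lam) - lam\<^sup>2 \<psi>\<^sup>2\<close> holds. Writing \<open>\<psi> = \<kappa> y powr lam\<close> with \<open>y = sin t\<close> and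
\<open>\<kappa>\<close> the maximum of \<open>\<psi>\<close>, it becomes an equation for the phase \<open>t\<close> alone,
\<open>t' = 1 / kernel e (sin t)\<close>, in which both signs of \<open>B\<close> are described by one parameter \<open>e \<ge> 0\<close>:
\<open>e < 1\<close> is \<open>\<psi>\<^sub>+\<close> (with \<open>e = 0\<close> for \<open>P = 0\<close>) and \<open>e > 1\<close> is \<open>\<psi>\<^sub>-\<close>. The phase runs from \<open>0\<close> to \<open>pi\<close>, so
the lifespan is \<open>duration e\<close>, the integral of \<open>kernel e \<circ> sin\<close> over that interval. Inverting the travel time
constructs the solutions (\<open>arc.arch_exists\<close>), and the time at which a given local solution has phase \<open>t\<close> must
be the travel time up to a translation, which gives uniqueness (\<open>arc.lifespan_iff\<close>).

The kernel decreases in \<open>e\<close>, and \<open>duration 0 = pi\<close>, \<open>duration 1 = pi / lam\<close>. Hence lifespans of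
\<open>\<psi>\<^sub>+\<close> lie in \<open>{pi / lam<..pi}\<close> and those of \<open>\<psi>\<^sub>-\<close> in \<open>{0<..<pi / lam}\<close>, which excludes the combinations
missing from the list when \<open>lam \<le> 3 / 2\<close>. Two parameters \<open>u < 1 < x\<close> belong to the same pressure
iff \<open>ratio u = ratio x\<close>. As \<open>u\<close> and \<open>x\<close> tend to \<open>1\<close> (\<open>P \<longrightarrow> -\<infinity>\<close>) the total lifespan of \<open>p\<close> copies of \<open>\<psi>\<^sub>+\<close>
and \<open>q\<close> copies of \<open>\<psi>\<^sub>-\<close> tends to \<open>(p + q) pi / lam\<close>, more than \<open>2 pi\<close> when \<open>p + q \<ge> 4\<close>, so the
intermediate value theorem (\<open>balance\<close>) only asks for one pressure with total below \<open>2 pi\<close>.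

For \<open>p \<le> 1\<close> such a pressure exists because the lifespan of \<open>\<psi>\<^sub>-\<close> tends to \<open>0\<close> with \<open>P\<close>. For \<open>p = 2\<close> the total
tends to \<open>2 pi\<close> itself, and the question is whether \<open>pi\<close> minus the lifespan of \<open>\<psi>\<^sub>+\<close> exceeds
\<open>q / 2\<close> times the lifespan of \<open>\<psi>\<^sub>-\<close>. Substitutions bound the
lifespan of \<open>\<psi>\<^sub>-\<close> from above and the defect of \<open>\<psi>\<^sub>+\<close> from below by multiples of the same power of the pressure. Up
to a common factor the coefficients are the integral of \<open>(1 - v\<^sup>2) powr (\<nu> / 2)\<close> over \<open>{0..1}\<close> and, with an
arbitrarily small loss, the integral of \<open>((1 - v\<^sup>2) / (2 v)) powr \<nu>\<close> over \<open>{v1..1}\<close> for any \<open>v1 > 0\<close>, where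
\<open>\<nu> = 1 / \<mu> - 1 > 0\<close> (\<open>duration_above_bound\<close>, \<open>duration_below_bound\<close>).
For small \<open>v1\<close> the second integral exceeds the first (\<open>slope_integral_gain\<close>), which settles \<open>q = 2\<close>; for
\<open>lam \<le> 3 / 2\<close>, that is \<open>\<nu> \<ge> 1\<close>, it even tends to infinity with \<open>v1 \<longrightarrow> 0\<close> (\<open>slope_integral_unbounded\<close>), which settles every \<open>q\<close>.

Finally, solutions with the same \<open>P\<close> have the same slopes \<open>\<plusminus> sqrt (- 2 P)\<close> at their zeros, so copies with
alternating signs fit together in any order to a \<open>C\<^sup>1\<close> function (\<open>arches.glue\<close>), and a \<open>C\<^sup>1\<close> function whose slope
at its zeros satisfies \<open>(\<psi>')\<^sup>2 = - 2 P\<close> is automatically a weak solution (\<open>weak_solution_if_C1\<close>).\<close>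

section \<open>Derivatives at exceptional points\<close>

text \<open>A derivative formula known off one point extends to that point by continuity, by the mean value
theorem. It is used at the ends of an arch, at the joints of glued functions, and at the maximum of a
solution, where the formulas derived from \<open>(\<psi>')\<^sup>2\<close> degenerate.\<close>

lemma has_real_derivative_isolated:
  fixes F h :: "real \<Rightarrow> real"
  assumes "0 < e" and F: "isCont F x" and h: "isCont h x"
    and der: "\<And>y. y \<noteq> x \<Longrightarrow> \<bar>y - x\<bar> < e \<Longrightarrow> (F has_real_derivative h y) (at y)"
  shows "(F has_real_derivative h x) (at x)"
proof -
  have cont: "isCont F y" if "\<bar>y - x\<bar> < e" for y
    using F DERIV_isCont[OF der[of y]] that by (cases "y = x") simp_all
  have mean: "\<exists>z. \<bar>z - x\<bar> < \<bar>y - x\<bar> \<and> (F y - F x) / (y - x) = h z" if y: "y \<noteq> x" "\<bar>y - x\<bar> < e" for y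
  proof (cases "x < y")
    case True
    have "\<exists>l z. x < z \<and> z < y \<and> DERIV F z :> l \<and> F y - F x = (y - x) * l"
    proof (rule MVT[OF True])
      show "continuous_on {x..y} F"
        using cont y True by (intro continuous_at_imp_continuous_on) auto
      show "F differentiable (at z)" if "x < z" "z < y" for z
      proof -
        have "DERIV F z :> h z" using der[of z] that y by auto
        then show ?thesis using real_differentiable_def by blast
      qed
    qed
    then obtain l z where z: "x < z" "z < y" "DERIV F z :> l" "F y - F x = (y - x) * l" by blast
    then have "DERIV F z :> h z" using der[of z] y by auto
    then have "l = h z" using z(3) DERIV_unique by blast
    moreover have "F y - F x = (y - x) * l" using z(4) by (simp add: algebra_simps)
    ultimately show ?thesis using z(1,2) y by (intro exI[of _ z]) simp
  next
    case False
    then have yx: "y < x" using y by auto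
    have "\<exists>l z. y < z \<and> z < x \<and> DERIV F z :> l \<and> F x - F y = (x - y) * l"
    proof (rule MVT[OF yx])
      show "continuous_on {y..x} F"
        using cont y yx by (intro continuous_at_imp_continuous_on) auto
      show "F differentiable (at z)" if "y < z" "z < x" for z
      proof -
        have "DERIV F z :> h z" using der[of z] that y by auto
        then show ?thesis using real_differentiable_def by blast
      qed
    qed
    then obtain l z where z: "y < z" "z < x" "DERIV F z :> l" "F x - F y = (x - y) * l" by blast
    then have "DERIV F z :> h z" using der[of z] y by auto
    then have "l = h z" using z(3) DERIV_unique by blast
    moreover have "F y - F x = (y - x) * l" using z(4) by (simp add: algebra_simps)
    ultimately show ?thesis using z(1,2) y by (intro exI[of _ z]) simp
  qed
  have "((\<lambda>y. (F y - F x) / (y - x)) \<longlongrightarrow> h x) (at x)"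
  proof (rule LIM_I)
    fix r :: real assume "0 < r"
    then obtain d where "d > 0" "\<forall>z. dist z x < d \<longrightarrow> dist (h z) (h x) < r"
      using h unfolding continuous_at_eps_delta by blast
    then have d: "d > 0" "\<And>z. \<bar>z - x\<bar> < d \<Longrightarrow> \<bar>h z - h x\<bar> < r" by (auto simp: dist_real_def)
    show "\<exists>s>0. \<forall>y. y \<noteq> x \<and> norm (y - x) < s \<longrightarrow> norm ((F y - F x) / (y - x) - h x) < r"
    proof (intro exI[of _ "min d e"] conjI allI impI)
      fix y assume y: "y \<noteq> x \<and> norm (y - x) < min d e"
      then obtain z where "\<bar>z - x\<bar> < \<bar>y - x\<bar>" "(F y - F x) / (y - x) = h z" using mean[of y] by auto
      then show "norm ((F y - F x) / (y - x) - h x) < r" using d(2)[of z] y by auto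
    qed (use d \<open>0 < e\<close> in auto)
  qed
  then show ?thesis by (simp add: has_field_derivative_iff)
qed

lemma has_real_derivative_translate:
  fixes f :: "real \<Rightarrow> real"
  assumes "(f has_real_derivative d) (at (x - c))"
  shows "((\<lambda>x. f (x - c)) has_real_derivative d) (at x)"
  using assms DERIV_shift[of f d x "- c"] by simp

lemma continuous_on_switch:
  fixes f g :: "real \<Rightarrow> real"
  assumes "continuous_on UNIV f" "continuous_on UNIV g" "f c = g c"
  shows "continuous_on UNIV (\<lambda>x. if x < c then f x else g x)"
proof -
  have "continuous_on ({..c} \<union> {c..}) (\<lambda>x. if x < c then f x else g x)"
    using assms by (intro continuous_on_cases) (auto intro: continuous_on_subset)
  moreover have "{..c} \<union> {c..} = (UNIV :: real set)" by auto
  ultimately show ?thesis by simp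
qed

lemma has_real_derivative_switch:
  fixes f g f' g' :: "real \<Rightarrow> real"
  assumes f: "\<And>x. (f has_real_derivative f' x) (at x)" "continuous_on UNIV f'"
    and g: "\<And>x. (g has_real_derivative g' x) (at x)" "continuous_on UNIV g'"
    and eq: "f c = g c" "f' c = g' c"
  shows "((\<lambda>x. if x < c then f x else g x) has_real_derivative (if x < c then f' x else g' x)) (at x)"
proof -
  let ?F = "\<lambda>x. if x < c then f x else g x" and ?h = "\<lambda>x. if x < c then f' x else g' x"
  have off: "(?F has_real_derivative ?h y) (at y)" if "y \<noteq> c" for y
  proof (cases "y < c")
    case True
    then show ?thesis
      using has_field_derivative_transform_within_open[OF f(1)[of y], of "{..<c}" ?F] by auto
  next
    case False
    then show ?thesis
      using has_field_derivative_transform_within_open[OF g(1)[of y], of "{c<..}" ?F] that by auto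
  qed
  have "continuous_on UNIV f" "continuous_on UNIV g"
    using DERIV_isCont[OF f(1)] DERIV_isCont[OF g(1)] by (auto intro: continuous_at_imp_continuous_on)
  then have cF: "continuous_on UNIV ?F" using eq(1) by (rule continuous_on_switch)
  have ch: "continuous_on UNIV ?h" using assms by (intro continuous_on_switch)
  have "(?F has_real_derivative ?h c) (at c)"
  proof (rule has_real_derivative_isolated[where e = 1 and F = ?F and x = c and h = ?h])
    show "isCont ?F c" by (rule continuous_on_interior[OF cF]) simp
    show "isCont ?h c" by (rule continuous_on_interior[OF ch]) simp
  qed (use off in auto)
  then show ?thesis using off by (cases "x = c") simp_all
qed

section \<open>Locality and symmetries of the equation\<close>

lemma solves_ode_at_intro:
  assumes "\<forall>\<^sub>F x in nhds \<theta>. (f has_real_derivative f' x) (at x)"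
    and "(f' has_real_derivative f'') (at \<theta>)"
    and "- lam * f \<theta> * f'' + (lam - 1) * (f' \<theta>)\<^sup>2 - lam\<^sup>2 * (f \<theta>)\<^sup>2 + 2 * (lam - 1) * P = 0"
  shows "solves_ode_at lam P f \<theta>"
proof -
  have ev: "\<forall>\<^sub>F x in nhds \<theta>. f' x = deriv f x"
    using assms(1) by (rule eventually_mono) (auto dest: DERIV_imp_deriv)
  have 1: "(f has_real_derivative f' \<theta>) (at \<theta>)" using assms(1) by (rule eventually_nhds_x_imp_x)
  have 2: "(deriv f has_real_derivative f'') (at \<theta>)"
    using assms(2) DERIV_cong_ev[OF refl ev refl] by auto
  show ?thesis
    unfolding solves_ode_at_def using assms(3) 1 2
    by (auto simp: DERIV_imp_deriv[OF 1] DERIV_imp_deriv[OF 2] real_differentiable_def)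
qed

lemma solves_ode_at_cong:
  assumes ev: "\<forall>\<^sub>F x in nhds \<theta>. f x = g x"
  shows "solves_ode_at lam P f \<theta> \<longleftrightarrow> solves_ode_at lam P g \<theta>"
proof -
  have "\<forall>\<^sub>F x in nhds \<theta>. \<forall>\<^sub>F z in nhds x. f z = g z" using ev by (simp add: eventually_eventually)
  then have ev': "\<forall>\<^sub>F x in nhds \<theta>. deriv f x = deriv g x"
    by (rule eventually_mono) (auto intro: deriv_cong_ev)
  have "f differentiable (at \<theta>) \<longleftrightarrow> g differentiable (at \<theta>)"
    unfolding real_differentiable_def using DERIV_cong_ev[OF refl ev refl] by auto
  moreover have "deriv f differentiable (at \<theta>) \<longleftrightarrow> deriv g differentiable (at \<theta>)"
    unfolding real_differentiable_def using DERIV_cong_ev[OF refl ev' refl] by auto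
  moreover have "deriv (deriv f) \<theta> = deriv (deriv g) \<theta>" using ev' by (auto intro: deriv_cong_ev)
  ultimately show ?thesis
    unfolding solves_ode_at_def using eventually_nhds_x_imp_x[OF ev] eventually_nhds_x_imp_x[OF ev'] by simp
qed

text \<open>The equation is autonomous and, apart from the constant term, homogeneous quadratic, so translations
and the sign change \<open>s = -1\<close> preserve it.\<close>

lemma solves_ode_at_affine:
  assumes f: "solves_ode_at lam P f (\<theta> - c)" and "open I" "\<theta> - c \<in> I"
    and diff: "\<And>x. x \<in> I \<Longrightarrow> f differentiable (at x)" and s: "s\<^sup>2 = 1"
  shows "solves_ode_at lam P (\<lambda>x. s * f (x - c)) \<theta>"
proof (rule solves_ode_at_intro)
  have "((\<lambda>x. x - c) \<longlongrightarrow> \<theta> - c) (nhds \<theta>)"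
    by (intro tendsto_intros filterlim_ident)
  then have "\<forall>\<^sub>F x in nhds \<theta>. x - c \<in> I" using \<open>open I\<close> \<open>\<theta> - c \<in> I\<close> by (rule topological_tendstoD)
  then show "\<forall>\<^sub>F x in nhds \<theta>. ((\<lambda>x. s * f (x - c)) has_real_derivative s * deriv f (x - c)) (at x)"
  proof (rule eventually_mono)
    fix x assume "x - c \<in> I"
    then have "(f has_real_derivative deriv f (x - c)) (at (x - c))"
      using diff by (meson DERIV_deriv_iff_real_differentiable)
    then show "((\<lambda>x. s * f (x - c)) has_real_derivative s * deriv f (x - c)) (at x)"
      by (intro DERIV_cmult has_real_derivative_translate)
  qed
  have "(deriv f has_real_derivative deriv (deriv f) (\<theta> - c)) (at (\<theta> - c))"
    using f unfolding solves_ode_at_def by (meson DERIV_deriv_iff_real_differentiable)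
  then show "((\<lambda>x. s * deriv f (x - c)) has_real_derivative s * deriv (deriv f) (\<theta> - c)) (at \<theta>)"
    by (intro DERIV_cmult has_real_derivative_translate)
  have "- lam * (s * f (\<theta> - c)) * (s * deriv (deriv f) (\<theta> - c)) + (lam - 1) * (s * deriv f (\<theta> - c))\<^sup>2 -
    lam\<^sup>2 * (s * f (\<theta> - c))\<^sup>2 + 2 * (lam - 1) * P
    = s\<^sup>2 * (- lam * f (\<theta> - c) * deriv (deriv f) (\<theta> - c) + (lam - 1) * (deriv f (\<theta> - c))\<^sup>2 -
    lam\<^sup>2 * (f (\<theta> - c))\<^sup>2) + 2 * (lam - 1) * P"
    by (simp add: power_mult_distrib algebra_simps power2_eq_square)
  also have "\<dots> = 0" using f s unfolding solves_ode_at_def by simp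
  finally show "- lam * (s * f (\<theta> - c)) * (s * deriv (deriv f) (\<theta> - c)) + (lam - 1) * (s * deriv f (\<theta> - c))\<^sup>2 -
    lam\<^sup>2 * (s * f (\<theta> - c))\<^sup>2 + 2 * (lam - 1) * P = 0" .
qed

lemma positive_solution_on_translate:
  assumes "positive_solution_on lam P f I"
  shows "positive_solution_on lam P (\<lambda>x. f (x - c)) ((\<lambda>x. x + c) ` I)"
  unfolding positive_solution_on_def
proof (intro conjI ballI)
  have I: "open I" "is_interval I" "I \<noteq> {}" and sol: "\<And>x. x \<in> I \<Longrightarrow> 0 < f x \<and> solves_ode_at lam P f x"
    using assms unfolding positive_solution_on_def by auto
  show "open ((\<lambda>x. x + c) ` I)" using I(1) open_translation[of I c] by (simp add: add.commute)
  show "is_interval ((\<lambda>x. x + c) ` I)" using I(2) is_interval_translation[of c I] by (simp add: add.commute)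
  show "(\<lambda>x. x + c) ` I \<noteq> {}" using I by simp
  fix \<theta> assume "\<theta> \<in> (\<lambda>x. x + c) ` I"
  then have th: "\<theta> - c \<in> I" by auto
  then show "0 < f (\<theta> - c)" using sol by auto
  show "solves_ode_at lam P (\<lambda>x. f (x - c)) \<theta>"
    using solves_ode_at_affine[of lam P f \<theta> c I 1] sol th I unfolding solves_ode_at_def by simp
qed

lemma local_solution_translate:
  assumes "local_solution lam P s f a b"
  shows "local_solution lam P s (\<lambda>x. f (x - c)) (a + c) (b + c)"
proof -
  have ab: "a < b" and pos: "positive_solution_on lam P f {a<..<b}"
    and max: "\<And>\<phi> J. positive_solution_on lam P \<phi> J \<Longrightarrow> {a<..<b} \<subseteq> J \<Longrightarrow> (\<forall>\<theta>\<in>{a<..<b}. \<phi> \<theta> = f \<theta>) \<Longrightarrow> J = {a<..<b}"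
    and B: "\<And>\<theta>. \<theta> \<in> {a<..<b} \<Longrightarrow> B_quantity lam P f \<theta> = B_value s"
    using assms unfolding local_solution_def maximal_positive_solution_on_def by auto
  have im: "(\<lambda>x. x + c) ` {a<..<b} = {a + c<..<b + c}" 
  proof (intro equalityI subsetI)
    fix x assume "x \<in> {a + c<..<b + c}"
    then show "x \<in> (\<lambda>x. x + c) ` {a<..<b}" by (intro image_eqI[of _ _ "x - c"]) auto
  qed auto
  have "positive_solution_on lam P (\<lambda>x. f (x - c)) {a + c<..<b + c}"
    using positive_solution_on_translate[OF pos, of c] im by simp
  moreover have "J = {a + c<..<b + c}" if J: "positive_solution_on lam P \<phi> J" "{a + c<..<b + c} \<subseteq> J"
     "\<forall>\<theta>\<in>{a + c<..<b + c}. \<phi> \<theta> = f (\<theta> - c)" for \<phi> J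
  proof -
    have "(\<lambda>x. x + - c) ` J = {a<..<b}"
    proof (rule max[of "\<lambda>x. \<phi> (x + c)"])
      show "positive_solution_on lam P (\<lambda>x. \<phi> (x + c)) ((\<lambda>x. x + - c) ` J)"
        using positive_solution_on_translate[OF J(1), of "- c"] by simp
      show "{a<..<b} \<subseteq> (\<lambda>x. x + - c) ` J"
      proof
        fix x assume "x \<in> {a<..<b}"
        then have "x + c \<in> J" using J(2) by auto
        then show "x \<in> (\<lambda>x. x + - c) ` J" by (intro image_eqI[of _ _ "x + c"]) auto
      qed
      show "\<forall>\<theta>\<in>{a<..<b}. \<phi> (\<theta> + c) = f \<theta>" using J(3) by auto
    qed
    then have "(\<lambda>x. x + c) ` (\<lambda>x. x + - c) ` J = {a + c<..<b + c}" using im by simp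
    then show ?thesis by (simp add: image_image)
  qed
  moreover have "B_quantity lam P (\<lambda>x. f (x - c)) \<theta> = B_value s" if th: "\<theta> \<in> {a + c<..<b + c}" for \<theta>
  proof -
    have "f differentiable (at (\<theta> - c))" using pos th unfolding positive_solution_on_def solves_ode_at_def by auto
    then have "(f has_real_derivative deriv f (\<theta> - c)) (at (\<theta> - c))"
      by (meson DERIV_deriv_iff_real_differentiable)
    then have "((\<lambda>x. f (x - c)) has_real_derivative deriv f (\<theta> - c)) (at \<theta>)"
      by (rule has_real_derivative_translate)
    then show ?thesis using B[of "\<theta> - c"] th by (simp add: B_quantity_def DERIV_imp_deriv)
  qed
  ultimately show ?thesis
    unfolding local_solution_def maximal_positive_solution_on_def using ab
    by (intro conjI allI impI ballI; (elim conjE)?; simp?)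
qed

section \<open>Periodic solutions glued from arches\<close>

text \<open>The weak form is the integral of the derivative of \<open>W = lam f f' \<eta>\<close>, and \<open>W\<close> has compact support. Where
\<open>f \<noteq> 0\<close> the derivative is computed from the equation. At a zero of \<open>f\<close> the second derivative may
fail to exist, yet \<open>W\<close> is differentiable with derivative \<open>lam (f')\<^sup>2 \<eta>\<close>, and the value of \<open>(f')\<^sup>2\<close> there
makes this agree with the integrand.\<close>

lemma weak_solution_if_C1:
  assumes der: "\<And>\<theta>. (f has_real_derivative f' \<theta>) (at \<theta>)" and cont: "continuous_on UNIV f'"
    and ode: "\<And>\<theta>. f \<theta> \<noteq> 0 \<Longrightarrow> solves_ode_at lam P f \<theta>"
    and zero: "\<And>\<theta>. f \<theta> = 0 \<Longrightarrow> (f' \<theta>)\<^sup>2 = - 2 * P"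
  shows "weak_solution lam P f"
  unfolding weak_solution_def
proof (intro allI impI)
  fix \<eta> :: "real \<Rightarrow> real"
  assume "(\<forall>\<theta>. \<eta> differentiable (at \<theta>)) \<and> continuous_on UNIV (deriv \<eta>) \<and> (\<exists>a b. \<forall>\<theta>. \<theta> \<notin> {a..b} \<longrightarrow> \<eta> \<theta> = 0)"
  then obtain a b where eta: "\<And>\<theta>. (\<eta> has_real_derivative deriv \<eta> \<theta>) (at \<theta>)"
    and supp: "\<And>\<theta>. \<theta> \<notin> {a..b} \<Longrightarrow> \<eta> \<theta> = 0"
    by (meson DERIV_deriv_iff_real_differentiable)
  have df: "deriv f = f'" using der by (auto dest: DERIV_imp_deriv)
  let ?W = "\<lambda>\<theta>. lam * f \<theta> * (f' \<theta> * \<eta> \<theta>)"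
  let ?i = "\<lambda>\<theta>. lam * f \<theta> * deriv f \<theta> * deriv \<eta> \<theta> +
     ((2 * lam - 1) * (deriv f \<theta>)\<^sup>2 - lam\<^sup>2 * (f \<theta>)\<^sup>2 + 2 * (lam - 1) * P) * \<eta> \<theta>"
  have W: "(?W has_real_derivative ?i \<theta>) (at \<theta>)" for \<theta>
  proof (cases "f \<theta> = 0")
    case True
    \<comment> \<open>At a zero \<open>f'\<close> need not be differentiable, but \<open>f\<close> times a continuous function is.\<close>
    have "isCont (\<lambda>\<theta>. f' \<theta> * \<eta> \<theta>) \<theta>"
      using cont eta[THEN DERIV_isCont] by (intro isCont_mult) (auto simp: continuous_on_eq_continuous_at)
    then have lim: "((\<lambda>y. f' y * \<eta> y) \<longlongrightarrow> f' \<theta> * \<eta> \<theta>) (at \<theta>)" by (simp add: isCont_def)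
    have "((\<lambda>y. (f y - f \<theta>) / (y - \<theta>)) \<longlongrightarrow> f' \<theta>) (at \<theta>)"
      using der by (simp add: has_field_derivative_iff)
    then have "((\<lambda>y. lam * ((f y - f \<theta>) / (y - \<theta>)) * (f' y * \<eta> y)) \<longlongrightarrow> lam * f' \<theta> * (f' \<theta> * \<eta> \<theta>)) (at \<theta>)"
      by (intro tendsto_intros lim)
    then have "((\<lambda>y. (?W y - ?W \<theta>) / (y - \<theta>)) \<longlongrightarrow> lam * f' \<theta> * (f' \<theta> * \<eta> \<theta>)) (at \<theta>)"
      using True by simp
    moreover have "?i \<theta> = lam * f' \<theta> * (f' \<theta> * \<eta> \<theta>)"
      using True zero[OF True] unfolding df by (simp add: power2_eq_square[symmetric] mult.assoc[symmetric]) (simp add: power2_eq_square algebra_simps)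
    ultimately show ?thesis by (simp add: has_field_derivative_iff)
  next
    case False
    then have sol: "solves_ode_at lam P f \<theta>" using ode by blast
    then have "(f' has_real_derivative deriv f' \<theta>) (at \<theta>)"
      unfolding solves_ode_at_def df by (meson DERIV_deriv_iff_real_differentiable)
    then have "(?W has_real_derivative
        (lam * f' \<theta> * (f' \<theta> * \<eta> \<theta>) + lam * f \<theta> * (deriv f' \<theta> * \<eta> \<theta> + f' \<theta> * deriv \<eta> \<theta>))) (at \<theta>)"
      by (auto intro!: derivative_eq_intros der eta simp: algebra_simps)
    moreover have "lam * f \<theta> * deriv f' \<theta> = (lam - 1) * (f' \<theta>)\<^sup>2 - lam\<^sup>2 * (f \<theta>)\<^sup>2 + 2 * (lam - 1) * P"
      using sol unfolding solves_ode_at_def df by simp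
    then have "lam * f' \<theta> * (f' \<theta> * \<eta> \<theta>) + lam * f \<theta> * (deriv f' \<theta> * \<eta> \<theta> + f' \<theta> * deriv \<eta> \<theta>) = ?i \<theta>"
    proof -
      assume E: "lam * f \<theta> * deriv f' \<theta> = (lam - 1) * (f' \<theta>)\<^sup>2 - lam\<^sup>2 * (f \<theta>)\<^sup>2 + 2 * (lam - 1) * P"
      have "lam * f' \<theta> * (f' \<theta> * \<eta> \<theta>) + lam * f \<theta> * (deriv f' \<theta> * \<eta> \<theta> + f' \<theta> * deriv \<eta> \<theta>)
        = (lam * (f' \<theta>)\<^sup>2 + lam * f \<theta> * deriv f' \<theta>) * \<eta> \<theta> + lam * f \<theta> * f' \<theta> * deriv \<eta> \<theta>"
        by (simp add: power2_eq_square algebra_simps)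
      also have "\<dots> = ?i \<theta>" unfolding E df by (simp add: algebra_simps)
      finally show ?thesis .
    qed
    ultimately show ?thesis by simp
  qed
  define c where "c = min a b - 1"
  define d where "d = max a b + 1"
  have cd: "c \<le> d" unfolding c_def d_def by linarith
  have "(?i has_integral (?W d - ?W c)) {c..d}"
    using W cd by (intro fundamental_theorem_of_calculus)
      (auto simp flip: has_real_derivative_iff_has_vector_derivative intro: has_field_derivative_at_within)
  moreover have "\<eta> c = 0" "\<eta> d = 0"
    by (rule supp; auto simp: c_def d_def min_def max_def)+
  ultimately have int: "(?i has_integral 0) {c..d}" by simp
  have "?i \<theta> = 0" if "\<theta> \<notin> {c..d}" for \<theta>
  proof -
    have z: "\<eta> x = 0" if "x \<in> - {min a b..max a b}" for x
      using that by (intro supp) (auto simp: min_def max_def split: if_splits)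
    have th: "\<theta> \<in> - {min a b..max a b}" using that unfolding c_def d_def by auto
    have "((\<lambda>_. 0) has_real_derivative deriv \<eta> \<theta>) (at \<theta>)"
      using has_field_derivative_transform_within_open[OF eta[of \<theta>] _ th, of "\<lambda>_. 0"] z by auto
    then have "deriv \<eta> \<theta> = 0" using DERIV_const DERIV_unique by blast
    then show ?thesis using z[OF th] by simp
  qed
  then show "(?i has_integral 0) UNIV" by (intro has_integral_on_superset[OF int]) auto
qed

text \<open>A local solution on \<open>{0<..<T}\<close> continued to a \<open>C\<^sup>1\<close> function on the whole line, so that the derivatives at
the two ends exist in the full sense and arches can be joined there.\<close>

definition arch :: "real \<Rightarrow> real \<Rightarrow> piece \<Rightarrow> (real \<Rightarrow> real) \<Rightarrow> (real \<Rightarrow> real) \<Rightarrow> real \<Rightarrow> bool" where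
  "arch lam P s f f' T \<longleftrightarrow> (\<forall>\<theta>. (f has_real_derivative f' \<theta>) (at \<theta>)) \<and> continuous_on UNIV f' \<and>
     f 0 = 0 \<and> f T = 0 \<and> f' 0 = sqrt (- 2 * P) \<and> f' T = - sqrt (- 2 * P) \<and>
     local_solution lam P s f 0 T"

text \<open>Concatenation with alternating signs. The empty chain is a line of slope \<open>v\<close>, so that every chain,
also the empty one, starts with value \<open>0\<close> and slope \<open>v\<close> and can be attached to a preceding arch.\<close>

fun chain :: "real \<Rightarrow> (piece \<Rightarrow> real \<Rightarrow> real) \<Rightarrow> (piece \<Rightarrow> real) \<Rightarrow> piece list \<Rightarrow> real \<Rightarrow> real" where
  "chain v f T [] \<theta> = v * \<theta>"
| "chain v f T (s # ss) \<theta> = (if \<theta> < T s then f s \<theta> else - chain v f T ss (\<theta> - T s))"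

fun chain_deriv :: "real \<Rightarrow> (piece \<Rightarrow> real \<Rightarrow> real) \<Rightarrow> (piece \<Rightarrow> real) \<Rightarrow> piece list \<Rightarrow> real \<Rightarrow> real" where
  "chain_deriv v f' T [] \<theta> = v"
| "chain_deriv v f' T (s # ss) \<theta> = (if \<theta> < T s then f' s \<theta> else - chain_deriv v f' T ss (\<theta> - T s))"

locale arches =
  fixes lam P :: real and f f' :: "piece \<Rightarrow> real \<Rightarrow> real" and T :: "piece \<Rightarrow> real" and ss :: "piece list"
  assumes P: "P \<le> 0" and arch: "s \<in> set ss \<Longrightarrow> arch lam P s (f s) (f' s) (T s)"
begin

definition "v = sqrt (- 2 * P)"

lemma T_pos: "s \<in> set ss \<Longrightarrow> 0 < T s"
  using arch unfolding arch_def local_solution_def by blast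

lemma v_sq: "v\<^sup>2 = - 2 * P"
  using P by (simp add: v_def)

lemma arch_ode:
  assumes "s \<in> set ss" "0 < \<theta>" "\<theta> < T s"
  shows "0 < f s \<theta>" "solves_ode_at lam P (f s) \<theta>"
  using arch[OF assms(1)] assms(2-)
  unfolding arch_def local_solution_def maximal_positive_solution_on_def positive_solution_on_def by auto

lemma arch_deriv: "s \<in> set ss \<Longrightarrow> (f s has_real_derivative f' s \<theta>) (at \<theta>)"
  using arch unfolding arch_def by blast

lemma arch_ends:
  assumes "s \<in> set ss"
  shows "f s 0 = 0" "f s (T s) = 0" "f' s 0 = v" "f' s (T s) = - v"
  using arch[OF assms] unfolding arch_def v_def by blast+

lemma chain_start:
  assumes "set us \<subseteq> set ss"
  shows "chain v f T us 0 = 0" "chain_deriv v f' T us 0 = v"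
  using assms T_pos arch_ends by (cases us; simp)+

lemma chain_C1:
  assumes "set us \<subseteq> set ss"
  shows "continuous_on UNIV (chain_deriv v f' T us) \<and>
    (\<forall>\<theta>. (chain v f T us has_real_derivative chain_deriv v f' T us \<theta>) (at \<theta>))"
  using assms
proof (induction us)
  case Nil
  have "chain v f T [] = (\<lambda>\<theta>. v * \<theta>)" "chain_deriv v f' T [] = (\<lambda>\<theta>. v)" by auto
  then show ?case by (auto intro!: derivative_eq_intros)
next
  case (Cons s us)
  then have s: "s \<in> set ss" and us: "set us \<subseteq> set ss" by auto
  let ?g = "\<lambda>\<theta>. - chain v f T us (\<theta> - T s)" and ?g' = "\<lambda>\<theta>. - chain_deriv v f' T us (\<theta> - T s)"
  have e1: "chain v f T (s # us) = (\<lambda>\<theta>. if \<theta> < T s then f s \<theta> else ?g \<theta>)"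
    and e2: "chain_deriv v f' T (s # us) = (\<lambda>\<theta>. if \<theta> < T s then f' s \<theta> else ?g' \<theta>)" by auto
  have c: "continuous_on UNIV (f' s)" using arch[OF s] unfolding arch_def by blast
  have IH: "continuous_on UNIV (chain_deriv v f' T us)"
    "\<And>\<theta>. (chain v f T us has_real_derivative chain_deriv v f' T us \<theta>) (at \<theta>)"
    using Cons.IH[OF us] by blast+
  have c': "continuous_on UNIV ?g'"
    by (intro continuous_intros continuous_on_compose2[OF IH(1)]) auto
  have d': "(?g has_real_derivative ?g' \<theta>) (at \<theta>)" for \<theta>
    by (intro DERIV_minus has_real_derivative_translate IH(2))
  have eq: "f s (T s) = ?g (T s)" "f' s (T s) = ?g' (T s)"
    using arch_ends[OF s] chain_start[OF us] by auto
  show ?case unfolding e1 e2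
    using continuous_on_switch[OF c c' eq(2)] has_real_derivative_switch[OF arch_deriv[OF s] c d' c' eq] by blast
qed

lemma chain_end:
  assumes "set us \<subseteq> set ss"
  shows "chain v f T us (\<Sum>s\<leftarrow>us. T s) = 0 \<and> chain_deriv v f' T us (\<Sum>s\<leftarrow>us. T s) = (-1) ^ length us * v"
  using assms
proof (induction us)
  case (Cons s us)
  have "0 \<le> (\<Sum>s\<leftarrow>us. T s)" using Cons.prems T_pos by (intro sum_list_nonneg) (auto intro: less_imp_le)
  then show ?case using Cons by auto
qed simp

text \<open>Zeros of a chain occur only at joints, where the slope is \<open>\<plusminus> v\<close>; elsewhere a chain is locally plus or
minus a translated arch.\<close>

lemma chain_ode:
  assumes "set us \<subseteq> set ss" "0 \<le> \<theta>" "\<theta> \<le> (\<Sum>s\<leftarrow>us. T s)"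
  shows "(chain v f T us \<theta> = 0 \<longrightarrow> (chain_deriv v f' T us \<theta>)\<^sup>2 = - 2 * P) \<and>
    (chain v f T us \<theta> \<noteq> 0 \<longrightarrow> solves_ode_at lam P (chain v f T us) \<theta>)"
  using assms
proof (induction us arbitrary: \<theta>)
  case Nil
  then show ?case using v_sq by simp
next
  case (Cons s us)
  then have s: "s \<in> set ss" and us: "set us \<subseteq> set ss" by auto
  note Ts = T_pos[OF s]
  have C1: "\<And>\<theta>. (chain v f T us has_real_derivative chain_deriv v f' T us \<theta>) (at \<theta>)"
    using chain_C1[OF us] by blast
  consider "\<theta> = 0" | "0 < \<theta>" "\<theta> < T s" | "\<theta> = T s" | "T s < \<theta>" using Cons.prems by linarith
  then show ?case
  proof cases
    case 1
    then show ?thesis using arch_ends[OF s] Ts v_sq by simp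
  next
    case 2
    have "\<forall>\<^sub>F x in nhds \<theta>. x < T s" using 2 by (intro eventually_nhds_in_open[of "{..<T s}", simplified])
    then have "\<forall>\<^sub>F x in nhds \<theta>. f s x = chain v f T (s # us) x" by (rule eventually_mono) simp
    from solves_ode_at_cong[OF this] show ?thesis using arch_ode[OF s 2] 2 by simp
  next
    case 3
    then show ?thesis using chain_start[OF us] v_sq by simp
  next
    case 4
    have IH: "(chain v f T us (\<theta> - T s) = 0 \<longrightarrow> (chain_deriv v f' T us (\<theta> - T s))\<^sup>2 = - 2 * P) \<and>
      (chain v f T us (\<theta> - T s) \<noteq> 0 \<longrightarrow> solves_ode_at lam P (chain v f T us) (\<theta> - T s))"
      using Cons.prems 4 by (intro Cons.IH us) auto
    have "\<forall>\<^sub>F x in nhds \<theta>. T s < x" using 4 by (intro eventually_nhds_in_open[of "{T s<..}", simplified])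
    then have "\<forall>\<^sub>F x in nhds \<theta>. - 1 * chain v f T us (x - T s) = chain v f T (s # us) x" by (rule eventually_mono) simp
    note cong = solves_ode_at_cong[OF this]
    have "solves_ode_at lam P (chain v f T (s # us)) \<theta>" if nz: "chain v f T us (\<theta> - T s) \<noteq> 0"
    proof -
      have "solves_ode_at lam P (\<lambda>x. - 1 * chain v f T us (x - T s)) \<theta>"
        using IH nz C1 by (intro solves_ode_at_affine[of _ _ _ _ _ UNIV]) (auto simp: real_differentiable_def)
      then show ?thesis using cong by blast
    qed
    moreover have v: "chain v f T (s # us) \<theta> = - chain v f T us (\<theta> - T s)"
      "chain_deriv v f' T (s # us) \<theta> = - chain_deriv v f' T us (\<theta> - T s)" using 4 by auto
    ultimately show ?thesis unfolding v using IH by (simp del: chain.simps)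
  qed
qed

lemma chain_nth:
  assumes "set us \<subseteq> set ss" "i < length us"
    "(\<Sum>s\<leftarrow>take i us. T s) < \<theta>" "\<theta> < (\<Sum>s\<leftarrow>take (Suc i) us. T s)"
  shows "chain v f T us \<theta> = (-1) ^ i * f (us ! i) (\<theta> - (\<Sum>s\<leftarrow>take i us. T s))"
  using assms
proof (induction us arbitrary: i \<theta>)
  case (Cons s us)
  show ?case
  proof (cases i)
    case (Suc j)
    have "0 \<le> (\<Sum>s\<leftarrow>take j us. T s)" using Cons.prems(1) T_pos
      by (intro sum_list_nonneg) (auto intro!: less_imp_le dest!: in_set_takeD)
    moreover have "chain v f T us (\<theta> - T s) = (-1) ^ j * f (us ! j) (\<theta> - T s - (\<Sum>s\<leftarrow>take j us. T s))"
      using Cons.prems Suc by (intro Cons.IH) auto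
    ultimately show ?thesis using Cons.prems Suc by (auto simp: diff_diff_eq)
  qed (use Cons.prems in auto)
qed simp

text \<open>With an even number of pieces the chain ends with the slope \<open>v\<close> with which it starts, so its periodic
extension is \<open>C\<^sup>1\<close>. Near any point this extension is a switch between two neighbouring translates
of the chain, which treats interior points and period boundaries alike.\<close>

lemma glue:
  assumes even: "even (length ss)" and total: "(\<Sum>s\<leftarrow>ss. T s) = 2 * pi"
  shows "\<exists>\<psi>. glued lam P ss \<psi> \<and> periodic_solution lam P \<psi>"
proof -
  define L where "L = 2 * pi"
  have L: "0 < L" by (simp add: L_def)
  let ?F = "chain v f T ss" and ?F' = "chain_deriv v f' T ss"
  define k where "k \<theta> = \<lfloor>\<theta> / L\<rfloor>" for \<theta> :: real
  define \<psi> where "\<psi> \<theta> = ?F (\<theta> - L * k \<theta>)" for \<theta>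
  define \<psi>' where "\<psi>' \<theta> = ?F' (\<theta> - L * k \<theta>)" for \<theta>
  have ends: "?F 0 = 0" "?F L = 0" "?F' 0 = v" "?F' L = v"
    using chain_start[of ss] chain_end[of ss] even total L_def by auto
  have F: "continuous_on UNIV ?F'" "\<And>\<theta>. (?F has_real_derivative ?F' \<theta>) (at \<theta>)"
    using chain_C1[of ss] by blast+
  have k_eq: "k \<theta> = j" if "L * j \<le> \<theta>" "\<theta> < L * (j + 1)" for \<theta> and j :: int
    unfolding k_def using that L by (intro floor_unique) (auto simp: field_simps)
  have k_bound: "L * k \<theta> \<le> \<theta>" "\<theta> < L * (k \<theta> + 1)" for \<theta>
    using L mult_left_mono[OF of_int_floor_le[of "\<theta> / L"], of L] floor_correct[of "\<theta> / L"]
    unfolding k_def by (auto simp: field_simps)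
  have C1: "(\<psi> has_real_derivative \<psi>' \<theta>) (at \<theta>)" "isCont \<psi>' \<theta>" for \<theta>
  proof -
    define j where "j = k \<theta>"
    define G where "G i x = ?F (x - L * real_of_int i)" for i x
    define G' where "G' i x = ?F' (x - L * real_of_int i)" for i x
    let ?U = "{L * (j - 1)<..<L * (j + 1)}"
    have U: "open ?U" "\<theta> \<in> ?U" using k_bound[of \<theta>] L unfolding j_def by (auto simp: algebra_simps)
    have k_U: "k x = (if x < L * j then j - 1 else j)" if "x \<in> ?U" for x
      using k_eq[of "j - 1" x] k_eq[of j x] that by (auto simp: algebra_simps)
    have psi_U: "(if x < L * j then G (j - 1) x else G j x) = \<psi> x" if "x \<in> ?U" for x
      using k_U[OF that] by (simp add: \<psi>_def G_def)
    have psi'_U: "(if x < L * j then G' (j - 1) x else G' j x) = \<psi>' x" if "x \<in> ?U" for x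
      using k_U[OF that] by (simp add: \<psi>'_def G'_def)
    have der: "(G i has_real_derivative G' i x) (at x)" for i x
      unfolding G_def G'_def by (intro has_real_derivative_translate F(2))
    have cont: "continuous_on UNIV (G' i)" for i
      unfolding G'_def by (intro continuous_on_compose2[OF F(1)] continuous_intros) auto
    have eq: "G (j - 1) (L * j) = G j (L * j)" "G' (j - 1) (L * j) = G' j (L * j)"
      using ends unfolding G_def G'_def by (auto simp: algebra_simps)
    have "((\<lambda>x. if x < L * j then G (j - 1) x else G j x) has_real_derivative
        (if \<theta> < L * j then G' (j - 1) \<theta> else G' j \<theta>)) (at \<theta>)"
      by (rule has_real_derivative_switch[OF der cont der cont eq])
    note der_switch = this[unfolded psi'_U[OF U(2)]]
    show "(\<psi> has_real_derivative \<psi>' \<theta>) (at \<theta>)"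
      by (rule has_field_derivative_transform_within_open[OF der_switch U]) (rule psi_U)
    have "continuous_on UNIV (\<lambda>x. if x < L * j then G' (j - 1) x else G' j x)"
      by (rule continuous_on_switch[OF cont cont eq(2)])
    then have "continuous_on ?U (\<lambda>x. if x < L * j then G' (j - 1) x else G' j x)"
      by (rule continuous_on_subset) simp
    then have "continuous_on ?U \<psi>'" by (rule continuous_on_eq) (rule psi'_U)
    then show "isCont \<psi>' \<theta>" using U continuous_on_eq_continuous_at by blast
  qed
  have ode: "(\<psi> \<theta> = 0 \<longrightarrow> (\<psi>' \<theta>)\<^sup>2 = - 2 * P) \<and> (\<psi> \<theta> \<noteq> 0 \<longrightarrow> solves_ode_at lam P \<psi> \<theta>)" for \<theta>
  proof -
    define j where "j = k \<theta>"
    have x: "0 \<le> \<theta> - L * j" "\<theta> - L * j < L" using k_bound[of \<theta>] unfolding j_def by (auto simp: algebra_simps)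
    have sol: "(?F (\<theta> - L * j) = 0 \<longrightarrow> (?F' (\<theta> - L * j))\<^sup>2 = - 2 * P) \<and>
        (?F (\<theta> - L * j) \<noteq> 0 \<longrightarrow> solves_ode_at lam P ?F (\<theta> - L * j))"
      using x total L_def by (intro chain_ode) auto
    have "solves_ode_at lam P \<psi> \<theta>" if nz: "?F (\<theta> - L * j) \<noteq> 0"
    proof -
      have "\<theta> - L * j \<noteq> 0" using nz ends(1) by metis
      then have "\<theta> \<in> {L * j<..<L * (j + 1)}" using x by (auto simp: algebra_simps)
      then have "\<forall>\<^sub>F x in nhds \<theta>. x \<in> {L * j<..<L * (j + 1)}" by (intro eventually_nhds_in_open) auto
      then have "\<forall>\<^sub>F x in nhds \<theta>. 1 * ?F (x - L * j) = \<psi> x"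
        by (rule eventually_mono) (auto simp: \<psi>_def k_eq[of j])
      note cong = solves_ode_at_cong[OF this]
      have "solves_ode_at lam P (\<lambda>x. 1 * ?F (x - L * j)) \<theta>"
        using sol nz F(2) by (intro solves_ode_at_affine[of _ _ _ _ _ UNIV]) (auto simp: real_differentiable_def)
      then show ?thesis using cong by blast
    qed
    then show ?thesis using sol by (auto simp: \<psi>_def \<psi>'_def j_def)
  qed
  have dpsi: "deriv \<psi> = \<psi>'" using C1(1) by (auto dest: DERIV_imp_deriv)
  have "continuous_on UNIV \<psi>'" using C1(2) by (intro continuous_at_imp_continuous_on) auto
  moreover from this have "weak_solution lam P \<psi>" using C1(1) ode by (intro weak_solution_if_C1) auto
  moreover have "\<psi> (\<theta> + 2 * pi) = \<psi> \<theta>" for \<theta>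
  proof -
    have "k (\<theta> + L) = k \<theta> + 1" using k_bound[of \<theta>] by (intro k_eq) (auto simp: algebra_simps)
    then show ?thesis by (simp add: \<psi>_def L_def algebra_simps)
  qed
  ultimately have "periodic_solution lam P \<psi>"
    unfolding periodic_solution_def dpsi using C1(1) ode real_differentiable_def by blast
  moreover have "glued lam P ss \<psi>"
    unfolding glued_def
  proof (intro conjI exI[of _ "\<lambda>i. \<Sum>s\<leftarrow>take i ss. T s"] allI impI)
    fix i assume i: "i < length ss"
    let ?t = "\<lambda>i. \<Sum>s\<leftarrow>take i ss. T s"
    have nth: "ss ! i \<in> set ss" using i by simp
    have Suc: "?t (Suc i) = T (ss ! i) + ?t i" using i by (simp add: take_Suc_conv_app_nth)
    have nonneg: "0 \<le> ?t i" using T_pos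
      by (intro sum_list_nonneg) (auto intro!: less_imp_le dest!: in_set_takeD)
    have "0 \<le> (\<Sum>s\<leftarrow>drop (Suc i) ss. T s)" using T_pos
      by (intro sum_list_nonneg) (auto intro!: less_imp_le dest!: in_set_dropD)
    moreover have "(\<Sum>s\<leftarrow>take (Suc i) ss @ drop (Suc i) ss. T s) = L" using total by (simp add: L_def del: take_Suc)
    ultimately have le: "?t (Suc i) \<le> L" by (simp del: append_take_drop_id)
    show "\<exists>\<phi>. local_solution lam P (ss ! i) \<phi> (?t i) (?t (Suc i)) \<and>
        (\<forall>\<theta>\<in>{?t i<..<?t (Suc i)}. \<psi> \<theta> = (- 1) ^ i * \<phi> \<theta>)"
    proof (intro exI[of _ "\<lambda>\<theta>. f (ss ! i) (\<theta> - ?t i)"] conjI ballI)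
      have "local_solution lam P (ss ! i) (f (ss ! i)) 0 (T (ss ! i))"
        using arch[OF nth] unfolding arch_def by blast
      from local_solution_translate[OF this, of "?t i"]
      show "local_solution lam P (ss ! i) (\<lambda>\<theta>. f (ss ! i) (\<theta> - ?t i)) (?t i) (?t (Suc i))"
        unfolding Suc by simp
      fix \<theta> assume th: "\<theta> \<in> {?t i<..<?t (Suc i)}"
      have "k \<theta> = 0" using th le nonneg by (intro k_eq) auto
      then show "\<psi> \<theta> = (- 1) ^ i * f (ss ! i) (\<theta> - ?t i)"
        using chain_nth[of ss i \<theta>] i th by (simp add: \<psi>_def)
    qed
  qed (use even total in auto)
  ultimately show ?thesis by blast
qed

end

section \<open>The phase along an arch and its travel time\<close>

locale exponent =
  fixes lam :: real
  assumes lam_gt: "1 < lam" and lam_lt: "lam < 2"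
begin

definition mu :: real where "mu = lam - 1"

lemma mu: "0 < mu" "mu < 1" "lam = mu + 1"
  using lam_gt lam_lt by (auto simp: mu_def)

text \<open>With \<open>Y = y\<^sup>2\<close> this is the slope of the chord of \<open>Y powr mu\<close> between \<open>Y\<close> and \<open>1\<close>, continued by the
tangent slope \<open>mu\<close> at \<open>y = 1\<close>. It removes the common factor \<open>1 - y\<^sup>2\<close> from the first-order law.\<close>

definition chord :: "real \<Rightarrow> real" where
  "chord y = (if y = 1 then mu else (1 - y powr (2 * mu)) / (1 - y\<^sup>2))"

lemma chord_mult: "0 \<le> y \<Longrightarrow> (1 - y\<^sup>2) * chord y = 1 - y powr (2 * mu)"
  by (auto simp: chord_def power2_eq_1_iff)

lemma chord_pos: assumes "0 \<le> y" shows "0 < chord y"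
proof -
  consider "y = 1" | "y < 1" | "1 < y" by linarith
  then show ?thesis
  proof cases
    case 2
    then have "y powr (2 * mu) < 1" using assms mu(1) powr_less_mono2[of "2 * mu" y 1] by simp
    moreover have "y\<^sup>2 < 1" using 2 assms by (simp add: abs_square_less_1)
    ultimately show ?thesis using 2 by (simp add: chord_def)
  next
    case 3
    then have "1 < y powr (2 * mu)" using mu(1) powr_less_mono2[of "2 * mu" 1 y] by simp
    moreover have "1 < y\<^sup>2" using 3 by (simp add: one_less_power)
    ultimately show ?thesis using 3 by (simp add: chord_def divide_neg_neg)
  qed (use mu(1) in \<open>simp add: chord_def\<close>)
qed

lemma continuous_on_chord: "continuous_on {0..} chord"
  unfolding continuous_on_eq_continuous_within
proof
  have off: "continuous (at y within {0..}) (\<lambda>y. (1 - y powr (2 * mu)) / (1 - y\<^sup>2))" if "0 \<le> y" "y \<noteq> 1" for y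
    using that mu(1) unfolding continuous_within
    by (intro tendsto_intros) (auto simp: power2_eq_1_iff eventually_at_filter)
    fix y :: real assume "y \<in> {0..}"
    then have y: "0 \<le> y" by simp
    show "continuous (at y within {0..}) chord"
    proof (cases "y = 1")
      case False
      have "\<forall>\<^sub>F z in at y within {0..}. (1 - z powr (2 * mu)) / (1 - z\<^sup>2) = chord z"
        using eventually_at_topological[of _ y "{0..}"] False
        by (auto intro!: exI[of _ "- {1}"] simp: chord_def)
      then show ?thesis
        using off[OF y False] False unfolding continuous_within
        by (auto simp: chord_def[of y] intro: Lim_transform_eventually)
    next
      case True
      have "((\<lambda>z. (z powr (2 * mu) - 1 powr (2 * mu)) / (z - 1)) \<longlongrightarrow> 2 * mu) (at (1::real))"
        using has_field_derivative_iff[of "\<lambda>z::real. z powr (2 * mu)" "2 * mu" 1 UNIV]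
        by (auto intro!: derivative_eq_intros)
      moreover have "((\<lambda>z. z + 1) \<longlongrightarrow> 1 + 1) (at (1::real))" by (intro tendsto_intros)
      ultimately have "((\<lambda>z. ((z powr (2 * mu) - 1 powr (2 * mu)) / (z - 1)) / (z + 1)) \<longlongrightarrow> 2 * mu / (1 + 1)) (at (1::real))"
        by (rule tendsto_divide) simp
      moreover have "\<forall>\<^sub>F z in at 1. ((z powr (2 * mu) - 1 powr (2 * mu)) / (z - 1)) / (z + 1) = chord z"
        unfolding eventually_at_filter
      proof (rule always_eventually, intro allI impI)
        fix z :: real assume "z \<noteq> 1"
        have "(z powr (2 * mu) - 1) / ((z - 1) * (z + 1)) = (- (z powr (2 * mu) - 1)) / (- ((z - 1) * (z + 1)))"
          by (simp only: minus_divide_left[symmetric] minus_divide_right[symmetric] minus_minus)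
        also have "- (z powr (2 * mu) - 1) = 1 - z powr (2 * mu)" by simp
        also have "- ((z - 1) * (z + 1)) = 1 - z\<^sup>2" by (simp add: power2_eq_square algebra_simps)
        finally show "((z powr (2 * mu) - 1 powr (2 * mu)) / (z - 1)) / (z + 1) = chord z"
          using \<open>z \<noteq> 1\<close> by (simp add: chord_def)
      qed
      ultimately have "(chord \<longlongrightarrow> mu) (at 1)" using Lim_transform_eventually by fastforce
      then show ?thesis using True
        by (simp add: continuous_within chord_def[of 1]) (meson tendsto_within_subset subset_UNIV)
    qed
qed

definition speed :: "real \<Rightarrow> real \<Rightarrow> real" where
  "speed e y = sqrt (y powr (2 * mu) + e * chord y)"

text \<open>The time per unit of phase. For \<open>e = 0\<close> the quotient is \<open>1\<close> except at \<open>y = 0\<close>, where it would be \<open>0 / 0\<close>;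
the case distinction keeps the kernel continuous.\<close>

definition kernel :: "real \<Rightarrow> real \<Rightarrow> real" where
  "kernel e y = (if e = 0 then 1 else y powr mu / speed e y)"

lemma speed_sq: "0 \<le> e \<Longrightarrow> 0 \<le> y \<Longrightarrow> (speed e y)\<^sup>2 = y powr (2 * mu) + e * chord y"
  using chord_pos[of y] by (simp add: speed_def)

lemma powr_mu_sq: "(y powr mu)\<^sup>2 = y powr (2 * mu)"
  by (metis mult_2 power2_eq_square powr_add)

lemma speed_pos: "0 \<le> e \<Longrightarrow> 0 \<le> y \<Longrightarrow> 0 < e \<or> 0 < y \<Longrightarrow> 0 < speed e y"
  using chord_pos[of y] by (auto simp: speed_def add_nonneg_pos add_pos_nonneg)

lemma kernel_eq: "0 < y \<Longrightarrow> kernel e y = y powr mu / speed e y"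
  by (auto simp: kernel_def speed_def powr_mu_sq[symmetric])

lemma kernel_pos: "0 \<le> e \<Longrightarrow> 0 < y \<Longrightarrow> 0 < kernel e y"
  using speed_pos[of e y] by (simp add: kernel_eq)

lemma continuous_on_chord_compose:
  "continuous_on A f \<Longrightarrow> (\<And>x. x \<in> A \<Longrightarrow> 0 \<le> f x) \<Longrightarrow> continuous_on A (\<lambda>x. chord (f x))"
  by (rule continuous_on_compose2[OF continuous_on_chord]) auto

text \<open>At \<open>y = 0\<close> the kernel vanishes for every \<open>e > 0\<close> but equals \<open>1\<close> for \<open>e = 0\<close>, so joint continuity
stops at \<open>e = 0\<close>; small pressures need the separate estimates further below.\<close>

lemma continuous_on_kernel_param: "continuous_on ({0<..} \<times> {0..pi}) (\<lambda>(e, t). kernel e (sin t))"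
proof -
  have nz: "sin t powr (2 * mu) + e * chord (sin t) \<noteq> 0" if "0 < e" "0 \<le> t" "t \<le> pi" for e t
    using chord_pos[of "sin t"] sin_ge_zero[of t] that
    by (metis add_nonneg_pos less_numeral_extra(3) mult_pos_pos powr_ge_zero)
  have "continuous_on ({0<..} \<times> {0..pi})
      (\<lambda>x. sin (snd x) powr mu / sqrt (sin (snd x) powr (2 * mu) + fst x * chord (sin (snd x))))"
    using mu(1) nz
    by (intro continuous_intros continuous_on_chord_compose continuous_on_powr') (auto simp: sin_ge_zero)
  then show ?thesis
    by (rule continuous_on_eq) (auto simp: kernel_def speed_def)
qed

lemma continuous_on_kernel:
  assumes "0 \<le> e" shows "continuous_on {0..pi} (\<lambda>t. kernel e (sin t))"
proof (cases "e = 0")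
  case False
  then have "continuous_on {0..pi} (\<lambda>t. (\<lambda>(e, t). kernel e (sin t)) (e, t))"
    using assms by (intro continuous_on_compose2[OF continuous_on_kernel_param] continuous_intros) auto
  then show ?thesis by simp
qed (simp add: kernel_def)

definition travel :: "real \<Rightarrow> real \<Rightarrow> real" where
  "travel e t = integral {0..t} (\<lambda>s. kernel e (sin s))"

definition duration :: "real \<Rightarrow> real" where
  "duration e = travel e pi"

lemma continuous_on_duration: "continuous_on {0<..} duration"
  using integral_continuous_on_param[of "{0<..}" 0 pi "\<lambda>e t. kernel e (sin t)"] continuous_on_kernel_param
  by (simp add: duration_def[abs_def] travel_def)

end

locale arc = exponent +
  fixes e :: real
  assumes e: "0 \<le> e" "e \<noteq> 1"
begin

lemma continuous_on_travel: "continuous_on {0..pi} (travel e)"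
  unfolding travel_def by (intro indefinite_integral_continuous_1 integrable_continuous_real continuous_on_kernel e)

lemma travel_deriv:
  assumes "0 < t" "t < pi"
  shows "(travel e has_real_derivative kernel e (sin t)) (at t)"
proof -
  have "(travel e has_real_derivative kernel e (sin t)) (at t within {0..pi})"
    unfolding travel_def using integral_has_real_derivative[OF continuous_on_kernel[OF e(1)], of t] assms by simp
  then show ?thesis using assms by (simp add: at_within_Icc_at)
qed

lemma travel_strict: 
  assumes "0 \<le> s" "s < t" "t \<le> pi"
  shows "travel e s < travel e t"
proof (rule DERIV_pos_imp_increasing_open[OF assms(2)])
  fix x :: real assume "s < x" "x < t"
  then have x: "0 < x" "x < pi" using assms by auto
  then show "\<exists>y. (travel e has_real_derivative y) (at x) \<and> y > 0"
    using travel_deriv kernel_pos[OF e(1), of "sin x"] sin_gt_zero by blast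
next
  show "continuous_on {s..t} (travel e)" using continuous_on_travel by (rule continuous_on_subset) (use assms in auto)
qed

lemma travel_0: "travel e 0 = 0" by (simp add: travel_def)

lemma duration_pos: "0 < duration e"
  using travel_strict[of 0 pi] travel_0 by (simp add: duration_def)

lemma travel_inj: "inj_on (travel e) {0..pi}"
  by (intro inj_onI) (metis atLeastAtMost_iff less_irrefl linorder_less_linear travel_strict)

lemma travel_image: "travel e ` {0..pi} = {0..duration e}"
proof
  show "travel e ` {0..pi} \<subseteq> {0..duration e}"
    using travel_strict travel_0 unfolding duration_def
    by auto (metis order_le_less)+
  show "{0..duration e} \<subseteq> travel e ` {0..pi}"
    using IVT'[of "travel e" 0 _ pi] continuous_on_travel travel_0 unfolding duration_def by fastforce
qed

text \<open>The phase as a function of time. Clamping the time to \<open>[0, duration e]\<close> makes it continuous on the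
whole line.\<close>

definition tau :: "real \<Rightarrow> real" where
  "tau \<theta> = inv_into {0..pi} (travel e) (max 0 (min (duration e) \<theta>))"

lemma clamp_range: "max 0 (min (duration e) \<theta>) \<in> travel e ` {0..pi}"
  using duration_pos by (auto simp: travel_image)

lemma tau_range: "0 \<le> tau \<theta>" "tau \<theta> \<le> pi"
  using inv_into_into[OF clamp_range[of \<theta>]] by (auto simp: tau_def)

lemma travel_tau: "travel e (tau \<theta>) = max 0 (min (duration e) \<theta>)"
  unfolding tau_def by (rule f_inv_into_f[OF clamp_range])

lemma tau_travel: "0 \<le> t \<Longrightarrow> t \<le> pi \<Longrightarrow> tau (travel e t) = t"
  using travel_tau[of "travel e t"] travel_image travel_inj tau_range[of "travel e t"]
  by (smt (verit, best) atLeastAtMost_iff image_eqI inj_onD)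

lemma isCont_tau: "isCont tau \<theta>"
proof -
  have "continuous_on (travel e ` {0..pi}) (inv_into {0..pi} (travel e))"
    by (rule continuous_on_inv[OF continuous_on_travel]) (use travel_inj in auto)
  then have "continuous_on UNIV tau"
    unfolding tau_def by (rule continuous_on_compose2) (auto intro!: continuous_intros clamp_range[simplified])
  then show ?thesis by (simp add: continuous_on_eq_continuous_at)
qed

lemma tau_ends: "\<theta> \<le> 0 \<Longrightarrow> tau \<theta> = 0" "duration e \<le> \<theta> \<Longrightarrow> tau \<theta> = pi"
  using tau_travel[of 0] tau_travel[of pi] duration_pos travel_0 unfolding duration_def[symmetric]
  by (auto simp: tau_def)

lemma tau_interior:
  assumes "0 < \<theta>" "\<theta> < duration e"
  shows "0 < tau \<theta>" "tau \<theta> < pi"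
proof -
  have "travel e (tau \<theta>) = \<theta>" using assms by (simp add: travel_tau)
  then have "tau \<theta> \<noteq> 0" "tau \<theta> \<noteq> pi" using assms travel_0 by (auto simp: duration_def)
  then show "0 < tau \<theta>" "tau \<theta> < pi" using tau_range[of \<theta>] by auto
qed

lemma tau_deriv:
  assumes "0 < \<theta>" "\<theta> < duration e"
  shows "(tau has_real_derivative inverse (kernel e (sin (tau \<theta>)))) (at \<theta>)"
proof (rule DERIV_inverse_function[where f = "travel e" and a = 0 and b = "duration e"])
  note t = tau_interior[OF assms]
  show "(travel e has_real_derivative kernel e (sin (tau \<theta>))) (at (tau \<theta>))" by (rule travel_deriv[OF t])
  show "kernel e (sin (tau \<theta>)) \<noteq> 0" using kernel_pos[OF e(1)] sin_gt_zero[OF t] by force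
qed (use assms isCont_tau in \<open>auto simp: travel_tau\<close>)

end

section \<open>Arches exist\<close>

context exponent
begin

text \<open>The maximum of the solution with parameter \<open>e\<close>, determined by the normalization \<open>B = \<plusminus>1\<close>.\<close>

definition kappa :: "real \<Rightarrow> real" where
  "kappa e = (lam\<^sup>2 * \<bar>1 - e\<bar>) powr (- lam / 2)"

text \<open>At \<open>y = 0\<close> the first-order law reads \<open>(\<psi>')\<^sup>2 = lam\<^sup>2 \<kappa>\<^sup>2 e\<close>, and this must be \<open>- 2 P\<close>.\<close>

definition pressure :: "real \<Rightarrow> real" where
  "pressure e = - (lam\<^sup>2 * (kappa e)\<^sup>2 * e) / 2"

definition kind :: "real \<Rightarrow> piece" where
  "kind e = (if e < 1 then Plus else Minus)"

definition alpha :: real where "alpha = 2 - 2 / lam"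

lemma alpha: "alpha * lam = 2 * mu" "lam * (alpha / 2) = mu"
  using lam_gt by (auto simp: alpha_def mu_def field_simps)

end

context arc
begin

abbreviation kap :: real where "kap \<equiv> kappa e"
abbreviation P :: real where "P \<equiv> pressure e"
abbreviation beta :: real where "beta \<equiv> B_value (kind e)"

text \<open>The right-hand side of the first-order law, as a function of the value of the solution.\<close>

definition energy :: "real \<Rightarrow> real" where
  "energy x = - 2 * P + beta * x powr alpha - lam\<^sup>2 * x\<^sup>2"

definition acceleration :: "real \<Rightarrow> real" where
  "acceleration x = beta * (alpha / 2) * x powr (alpha - 1) - lam\<^sup>2 * x"

lemma kap_pos: "0 < kap"
  using lam_gt e by (simp add: kappa_def)

lemma P_le: "P \<le> 0"
  using e by (simp add: pressure_def)

text \<open>This equation characterizes \<open>kap\<close>: it says that the term \<open>beta \<psi> powr alpha\<close> has the coefficient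
\<open>1 - e\<close> in the normalized variable \<open>y\<close>.\<close>

lemma kap_alpha: "beta * kap powr alpha = lam\<^sup>2 * kap\<^sup>2 * (1 - e)"
proof -
  \<comment> \<open>\<open>kap\<close> is a power of \<open>C\<close>, and \<open>beta\<close> is the sign of \<open>1 - e\<close>.\<close>
  define C where "C = lam\<^sup>2 * \<bar>1 - e\<bar>"
  have C: "0 < C" using lam_gt e by (simp add: C_def)
  have "- lam / 2 * alpha = 1 + - lam" "- lam / 2 * 2 = - lam" using lam_gt by (auto simp: alpha_def field_simps)
  then have "kap powr alpha = C * C powr - lam" "kap\<^sup>2 = C powr - lam"
    using C powr_powr[of C "- lam / 2" alpha] powr_powr[of C "- lam / 2" 2] powr_add[of C 1 "- lam"]
    unfolding kappa_def C_def[symmetric] by (simp_all add: powr_numeral)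
  then have "beta * kap powr alpha = (beta * C) * kap\<^sup>2" by simp
  also have "beta * C = lam\<^sup>2 * (1 - e)" by (auto simp: kind_def C_def)
  finally show ?thesis by (simp only: mult_ac)
qed

text \<open>The factor \<open>1 - y\<^sup>2 = (cos t)\<^sup>2\<close> splits off, which is why the phase \<open>t\<close> with \<open>y = sin t\<close> passes through
the maximum of the solution at nonzero rate.\<close>

lemma energy_param:
  assumes "0 \<le> y"
  shows "energy (kap * y powr lam) = lam\<^sup>2 * kap\<^sup>2 * ((1 - y\<^sup>2) * (speed e y)\<^sup>2)"
proof -
  have a: "(kap * y powr lam) powr alpha = kap powr alpha * y powr (2 * mu)"
    using kap_pos by (simp add: powr_mult powr_powr alpha(1) mult.commute[of lam alpha])
  have "(y powr lam)\<^sup>2 = y powr (lam + lam)" by (simp only: power2_eq_square powr_add)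
  also have "lam + lam = 2 * mu + 2" by (simp add: mu_def)
  also have "y powr (2 * mu + 2) = y powr (2 * mu) * y\<^sup>2"
    using assms by (cases "y = 0") (simp_all add: powr_add powr_numeral)
  finally have b: "(y powr lam)\<^sup>2 = y powr (2 * mu) * y\<^sup>2" .
  have "energy (kap * y powr lam) = lam\<^sup>2 * kap\<^sup>2 * (e + (1 - e) * y powr (2 * mu) - y powr (2 * mu) * y\<^sup>2)"
    unfolding energy_def a power_mult_distrib b mult.assoc[symmetric] kap_alpha
    by (simp add: pressure_def algebra_simps)
  also have "e + (1 - e) * y powr (2 * mu) - y powr (2 * mu) * y\<^sup>2 = (1 - y\<^sup>2) * y powr (2 * mu) + e * (1 - y powr (2 * mu))"
    by (simp add: algebra_simps)
  also have "\<dots> = (1 - y\<^sup>2) * (y powr (2 * mu) + e * chord y)"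
    unfolding chord_mult[OF assms, symmetric] by (simp add: algebra_simps)
  also have "y powr (2 * mu) + e * chord y = (speed e y)\<^sup>2"
    using speed_sq[OF e(1) assms] by simp
  finally show ?thesis .
qed

lemma energy_deriv: "0 < x \<Longrightarrow> (energy has_real_derivative 2 * acceleration x) (at x)"
  unfolding energy_def[abs_def] acceleration_def
  by (auto intro!: derivative_eq_intros simp: algebra_simps)

text \<open>Differentiating the first-order law gives \<open>\<psi>'' = acceleration \<psi>\<close>, and eliminating \<open>B\<close> between the two
gives back the original equation.\<close>

lemma energy_ode:
  assumes "0 < x" "d\<^sup>2 = energy x"
  shows "- lam * x * acceleration x + (lam - 1) * d\<^sup>2 - lam\<^sup>2 * x\<^sup>2 + 2 * (lam - 1) * P = 0"
proof -
  have "x * x powr (alpha - 1) = x powr alpha" using assms(1) powr_add[of x 1 "alpha - 1"] by simp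
  then have "lam * x * acceleration x = lam * (alpha / 2) * beta * x powr alpha - lam * lam\<^sup>2 * x\<^sup>2"
    by (simp add: acceleration_def power2_eq_square algebra_simps)
  then have a: "lam * x * acceleration x = mu * beta * x powr alpha - lam * lam\<^sup>2 * x\<^sup>2"
    unfolding alpha .
  have "- lam * x * acceleration x + (lam - 1) * d\<^sup>2 - lam\<^sup>2 * x\<^sup>2 + 2 * (lam - 1) * P
    = - (lam * x * acceleration x) + mu * energy x - lam\<^sup>2 * x\<^sup>2 + 2 * mu * P"
    unfolding assms(2) mu_def by simp
  also have "\<dots> = (lam - mu - 1) * (lam\<^sup>2 * x\<^sup>2)"
    unfolding a energy_def by (simp add: algebra_simps)
  also have "\<dots> = 0" by (simp add: mu_def)
  finally show ?thesis .
qed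

definition vel :: "real \<Rightarrow> real" where
  "vel \<theta> = lam * kap * (cos (tau \<theta>) * speed e (sin (tau \<theta>)))"

text \<open>The two linear terms vanish on \<open>[0, duration e]\<close> and continue the solution beyond its zeros by its
tangents, so that it is differentiable on the whole line.\<close>

definition pos :: "real \<Rightarrow> real" where
  "pos \<theta> = kap * sin (tau \<theta>) powr lam + vel 0 * min \<theta> 0 + vel (duration e) * max (\<theta> - duration e) 0"

lemma pos_inside: "0 \<le> \<theta> \<Longrightarrow> \<theta> \<le> duration e \<Longrightarrow> pos \<theta> = kap * sin (tau \<theta>) powr lam"
  by (simp add: pos_def)

lemma pos_positive: "0 < \<theta> \<Longrightarrow> \<theta> < duration e \<Longrightarrow> 0 < pos \<theta>"
  using tau_interior[of \<theta>] sin_gt_zero[of "tau \<theta>"] kap_pos by (simp add: pos_inside)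

lemma sin_tau_nonneg: "0 \<le> sin (tau \<theta>)"
  using tau_range[of \<theta>] by (simp add: sin_ge_zero)

lemma continuous_on_tau: "continuous_on UNIV tau"
  using isCont_tau by (simp add: continuous_at_imp_continuous_on)

lemma continuous_on_vel: "continuous_on UNIV vel"
proof -
  have "sin (tau \<theta>) powr (2 * mu) + e * chord (sin (tau \<theta>)) \<ge> 0" for \<theta>
    using chord_pos[OF sin_tau_nonneg[of \<theta>]] e by simp
  then show ?thesis
    unfolding vel_def[abs_def] speed_def using sin_tau_nonneg mu(1)
    by (intro continuous_intros continuous_on_tau continuous_on_chord_compose continuous_on_powr') auto
qed

lemma continuous_on_pos: "continuous_on UNIV pos"
  unfolding pos_def[abs_def] using sin_tau_nonneg lam_gt
  by (intro continuous_intros continuous_on_tau continuous_on_powr') auto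

lemma vel_sq: "0 \<le> \<theta> \<Longrightarrow> \<theta> \<le> duration e \<Longrightarrow> (vel \<theta>)\<^sup>2 = energy (pos \<theta>)"
  unfolding pos_inside energy_param[OF sin_tau_nonneg] vel_def power_mult_distrib
  by (simp add: cos_squared_eq)

lemma pos_deriv_inside:
  assumes "0 < \<theta>" "\<theta> < duration e"
  shows "(pos has_real_derivative vel \<theta>) (at \<theta>)"
proof -
  let ?y = "sin (tau \<theta>)"
  have y: "0 < ?y" using tau_interior[OF assms] by (simp add: sin_gt_zero)
  have "?y powr (lam - 1) * inverse (kernel e ?y) = speed e ?y"
    using y by (simp add: kernel_eq mu_def[symmetric])
  then have "((\<lambda>x. kap * sin (tau x) powr lam) has_real_derivative vel \<theta>) (at \<theta>)"
    using tau_deriv[OF assms] y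
    by (auto intro!: derivative_eq_intros simp: vel_def algebra_simps)
  then show ?thesis
    by (rule has_field_derivative_transform_within_open[of _ _ _ "{0<..<duration e}"])
      (use assms in \<open>auto simp: pos_inside\<close>)
qed

lemma vel_ends: "\<theta> \<le> 0 \<Longrightarrow> vel \<theta> = sqrt (- 2 * P)" "duration e \<le> \<theta> \<Longrightarrow> vel \<theta> = - sqrt (- 2 * P)"
proof -
  have "sqrt (- 2 * P) = lam * kap * sqrt e"
    using lam_gt kap_pos by (simp add: pressure_def real_sqrt_mult real_sqrt_abs[symmetric] del: real_sqrt_abs) (simp add: abs_of_pos)
  moreover have "speed e 0 = sqrt e" by (simp add: speed_def chord_def)
  ultimately show "\<theta> \<le> 0 \<Longrightarrow> vel \<theta> = sqrt (- 2 * P)" "duration e \<le> \<theta> \<Longrightarrow> vel \<theta> = - sqrt (- 2 * P)"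
    by (auto simp: vel_def tau_ends)
qed

lemma pos_outside: "\<theta> \<le> 0 \<Longrightarrow> pos \<theta> = vel 0 * \<theta>" "duration e \<le> \<theta> \<Longrightarrow> pos \<theta> = vel (duration e) * (\<theta> - duration e)"
  using duration_pos by (auto simp: pos_def tau_ends)

lemma pos_deriv: "(pos has_real_derivative vel \<theta>) (at \<theta>)"
proof -
  have off: "(pos has_real_derivative vel y) (at y)" if "y \<noteq> 0" "y \<noteq> duration e" for y
  proof -
    have "(0 < y \<and> y < duration e) \<or> y < 0 \<or> duration e < y" using that by auto
    then consider "0 < y" "y < duration e" | "y < 0" | "duration e < y" by blast
    then show ?thesis
    proof cases
      case 2
      have "((\<lambda>x. vel 0 * x) has_real_derivative vel y) (at y)"
        using 2 vel_ends by (auto intro!: derivative_eq_intros)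
      then show ?thesis
        by (rule has_field_derivative_transform_within_open[of _ _ _ "{..<0}"]) (use 2 in \<open>auto simp: pos_outside\<close>)
    next
      case 3
      have "((\<lambda>x. vel (duration e) * (x - duration e)) has_real_derivative vel y) (at y)"
        using 3 vel_ends by (auto intro!: derivative_eq_intros)
      then show ?thesis
        by (rule has_field_derivative_transform_within_open[of _ _ _ "{duration e<..}"]) (use 3 in \<open>auto simp: pos_outside\<close>)
    qed (rule pos_deriv_inside)
  qed
  show ?thesis
  proof (cases "\<theta> = 0 \<or> \<theta> = duration e")
    case True
    show ?thesis
    proof (rule has_real_derivative_isolated[where e = "duration e"])
      show "isCont pos \<theta>" "isCont vel \<theta>"
        using continuous_on_interior[OF continuous_on_pos] continuous_on_interior[OF continuous_on_vel] by simp_all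
    qed (use off True duration_pos in auto)
  qed (use off in auto)
qed

text \<open>On either side of the maximum \<open>vel = \<plusminus> sqrt (energy pos)\<close> can be differentiated directly. At the
maximum the square root is singular, but the resulting formula for the derivative is continuous there.\<close>

lemma vel_deriv:
  assumes "0 < \<theta>" "\<theta> < duration e"
  shows "(vel has_real_derivative acceleration (pos \<theta>)) (at \<theta>)"
proof -
  \<comment> \<open>The time of the maximum.\<close>
  let ?mid = "travel e (pi / 2)"
  have mid: "0 < ?mid" "?mid < duration e"
    using travel_strict[of 0 "pi / 2"] travel_strict[of "pi / 2" pi] travel_0 pi_gt_zero by (auto simp: duration_def)
  have sq: "vel x = sqrt (energy (pos x))" if "0 < x" "x < ?mid" for x
  proof -
    have "tau x < pi / 2"
      using travel_strict[of "pi / 2" "tau x"] tau_range[of x] travel_tau[of x] that mid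
      by (cases "tau x = pi / 2") force+
    then have "0 \<le> cos (tau x)" using tau_range[of x] by (intro cos_ge_zero) auto
    then have "0 \<le> vel x" using lam_gt kap_pos speed_pos[OF e(1) sin_tau_nonneg[of x]] chord_pos[OF sin_tau_nonneg[of x]] e(1)
      by (simp add: vel_def speed_def)
    then show ?thesis using vel_sq[of x] that mid by (simp add: real_sqrt_unique)
  qed
  have sq': "vel x = - sqrt (energy (pos x))" if "?mid < x" "x < duration e" for x
  proof -
    have "pi / 2 < tau x"
      using travel_strict[of "tau x" "pi / 2"] tau_range[of x] travel_tau[of x] that mid
      by (cases "tau x = pi / 2") force+
    then have "0 \<le> cos (pi - tau x)" using tau_range[of x] by (intro cos_ge_zero) auto
    then have "0 \<le> - vel x" using lam_gt kap_pos chord_pos[OF sin_tau_nonneg[of x]] e(1)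
      by (simp add: vel_def speed_def mult_nonneg_nonpos mult_nonpos_nonneg)
    then show ?thesis using vel_sq[of x] that mid real_sqrt_unique[of "- vel x" "energy (pos x)"] by simp
  qed
  have en: "((\<lambda>x. sqrt (energy (pos x))) has_real_derivative acceleration (pos y) * vel y / sqrt (energy (pos y))) (at y)"
    if "0 < y" "y < duration e" "vel y \<noteq> 0" for y
  proof -
    have "0 < energy (pos y)" using vel_sq[of y] that by (metis less_imp_le zero_less_power2)
    moreover have "((\<lambda>x. energy (pos x)) has_real_derivative 2 * acceleration (pos y) * vel y) (at y)"
      using DERIV_chain2[OF energy_deriv pos_deriv] pos_positive[OF that(1,2)] by blast
    ultimately show ?thesis by (auto intro!: derivative_eq_intros simp: field_simps)
  qed
  have nz: "vel y \<noteq> 0" if y: "0 < y" "y < duration e" "y \<noteq> ?mid" for y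
  proof -
    have "travel e (tau y) = y" using y travel_tau[of y] by simp
    then have "tau y \<noteq> pi / 2" using y(3) by metis
    then have "cos (tau y) \<noteq> 0" using tau_range[of y] cos_inj_pi[of "tau y" "pi / 2"] by auto
    moreover have "0 < sin (tau y)" using tau_interior[OF y(1,2)] by (simp add: sin_gt_zero)
    ultimately show ?thesis using lam_gt kap_pos speed_pos[OF e(1), of "sin (tau y)"] by (simp add: vel_def)
  qed
  have off: "(vel has_real_derivative acceleration (pos y)) (at y)" if y: "0 < y" "y < duration e" "y \<noteq> ?mid" for y
  proof (cases "y < ?mid")
    case True
    have "((\<lambda>x. sqrt (energy (pos x))) has_real_derivative acceleration (pos y)) (at y)"
      using en[OF y(1,2) nz[OF y]] sq[OF y(1) True] nz[OF y] by simp
    then show ?thesis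
      by (rule has_field_derivative_transform_within_open[of _ _ _ "{0<..<?mid}"]) (use True y sq in auto)
  next
    case False
    have "((\<lambda>x. sqrt (energy (pos x))) has_real_derivative - acceleration (pos y)) (at y)"
      using en[OF y(1,2) nz[OF y]] sq'[of y] False y nz[OF y] by simp
    then have "((\<lambda>x. - sqrt (energy (pos x))) has_real_derivative acceleration (pos y)) (at y)"
      using DERIV_minus by fastforce
    then show ?thesis
      by (rule has_field_derivative_transform_within_open[of _ _ _ "{?mid<..<duration e}"]) (use False y sq' in auto)
  qed
  show ?thesis
  proof (cases "\<theta> = ?mid")
    case True
    show ?thesis
    proof (rule has_real_derivative_isolated[where e = "min ?mid (duration e - ?mid)" and h = "\<lambda>x. acceleration (pos x)"])
      show "isCont vel \<theta>" using continuous_on_interior[OF continuous_on_vel] by simp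
      have "isCont pos \<theta>" using continuous_on_interior[OF continuous_on_pos] by simp
      then show "isCont (\<lambda>x. acceleration (pos x)) \<theta>"
        unfolding acceleration_def using pos_positive[OF assms] by (intro continuous_intros) auto
    qed (use True mid off in auto)
  qed (use off assms in auto)
qed

lemma arch_exists: "arch lam P (kind e) pos vel (duration e)"
proof -
  have pos0: "pos 0 = 0" "pos (duration e) = 0" by (simp_all add: pos_outside)
  have dpos: "deriv pos = vel" using pos_deriv by (auto dest: DERIV_imp_deriv)
  have "positive_solution_on lam P pos {0<..<duration e}"
    unfolding positive_solution_on_def
  proof (intro conjI ballI)
    fix \<theta> assume th: "\<theta> \<in> {0<..<duration e}"
    then show "0 < pos \<theta>" by (simp add: pos_positive)
    show "solves_ode_at lam P pos \<theta>"
      using th vel_deriv[of \<theta>] pos_deriv energy_ode[of "pos \<theta>" "vel \<theta>"] pos_positive[of \<theta>] vel_sq[of \<theta>]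
      by (intro solves_ode_at_intro[where f' = vel and f'' = "acceleration (pos \<theta>)"]) auto
  qed (use duration_pos in \<open>auto simp: is_interval_io is_interval_oo\<close>)
  moreover have "J = {0<..<duration e}" if J: "positive_solution_on lam P \<phi> J" "{0<..<duration e} \<subseteq> J"
    "\<forall>\<theta>\<in>{0<..<duration e}. \<phi> \<theta> = pos \<theta>" for \<phi> J
  proof -
    have Jcont: "isCont \<phi> x \<and> 0 < \<phi> x" if "x \<in> J" for x
      using J(1) that unfolding positive_solution_on_def solves_ode_at_def
      by (auto intro: differentiable_imp_continuous_within)
    have zero: "\<phi> x = 0" if "x \<in> J" "x = 0 \<or> x = duration e" for x
    proof -
      have nb: "at x within {0<..<duration e} \<noteq> bot"
        using that duration_pos by (auto simp: trivial_limit_within islimpt_greaterThanLessThan1 islimpt_greaterThanLessThan2)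
      have "(\<phi> \<longlongrightarrow> \<phi> x) (at x within {0<..<duration e})"
        using Jcont[OF that(1)] by (meson continuous_within continuous_at_imp_continuous_within)
      moreover have "(pos \<longlongrightarrow> pos x) (at x within {0<..<duration e})"
        using DERIV_isCont[OF pos_deriv] by (meson continuous_within continuous_at_imp_continuous_within)
      then have "(\<phi> \<longlongrightarrow> pos x) (at x within {0<..<duration e})"
        by (rule Lim_transform_eventually) (use J(3) in \<open>auto simp: eventually_at_filter\<close>)
      ultimately have "\<phi> x = pos x" using tendsto_unique[OF nb] by blast
      then show ?thesis using that pos0 by auto
    qed
    have "0 \<notin> J" "duration e \<notin> J" using zero Jcont by force+
    moreover have "is_interval J" using J(1) by (simp add: positive_solution_on_def)
    moreover have "duration e / 2 \<in> J" using J(2) duration_pos by auto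
    ultimately have "x \<in> {0<..<duration e}" if "x \<in> J" for x
      using that duration_pos unfolding is_interval_1
      by (smt (verit, best) field_sum_of_halves greaterThanLessThan_iff)
    then show ?thesis using J(2) by auto
  qed
  moreover have "B_quantity lam P pos \<theta> = beta" if "\<theta> \<in> {0<..<duration e}" for \<theta>
  proof -
    have x: "0 < pos \<theta>" "(vel \<theta>)\<^sup>2 = energy (pos \<theta>)" using that pos_positive vel_sq by auto
    have "2 * P + (vel \<theta>)\<^sup>2 + lam\<^sup>2 * (pos \<theta>)\<^sup>2 = beta * pos \<theta> powr alpha"
      unfolding x(2) energy_def by simp
    then have "B_quantity lam P pos \<theta> = beta * (pos \<theta> powr alpha * pos \<theta> powr (2 / lam - 2))"
      by (simp add: B_quantity_def dpos)
    also have "\<dots> = beta" using x(1) by (simp add: powr_add[symmetric] alpha_def)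
    finally show ?thesis .
  qed
  ultimately have "local_solution lam P (kind e) pos 0 (duration e)"
    unfolding local_solution_def maximal_positive_solution_on_def using duration_pos
    by (intro conjI allI impI ballI; (elim conjE)?; simp?)
  then show ?thesis
    unfolding arch_def using pos_deriv continuous_on_vel pos0 vel_ends by simp
qed

end

section \<open>Local solutions are translates of arches\<close>

text \<open>A minimum between two strict local maxima would be a critical point at which the second derivative is
not negative.\<close>

lemma two_maxima_impossible:
  fixes f f' :: "real \<Rightarrow> real"
  assumes "u < v"
    and der: "\<And>x. u \<le> x \<Longrightarrow> x \<le> v \<Longrightarrow> (f has_real_derivative f' x) (at x)"
    and conc: "\<And>x. u \<le> x \<Longrightarrow> x \<le> v \<Longrightarrow> f' x = 0 \<Longrightarrow> \<exists>l<0. (f' has_real_derivative l) (at x)"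
    and crit: "f' u = 0" "f' v = 0"
  shows False
proof -
  have "continuous_on {u..v} f"
    using der by (intro continuous_at_imp_continuous_on ballI DERIV_isCont) auto
  then obtain w where w: "w \<in> {u..v}" "\<And>x. x \<in> {u..v} \<Longrightarrow> f w \<le> f x"
    using continuous_attains_inf[of "{u..v}" f] \<open>u < v\<close> by auto
  have "f' w = 0"
  proof (cases "w = u \<or> w = v")
    case False
    have "f' w = 0"
    proof (rule DERIV_local_min[OF der])
      show "0 < min (w - u) (v - w)" using w False by auto
      show "\<forall>y. \<bar>w - y\<bar> < min (w - u) (v - w) \<longrightarrow> f w \<le> f y"
        by (intro allI impI w(2)) (auto simp: abs_if split: if_splits)
    qed (use w in auto)
    then show ?thesis .
  qed (use crit in auto)
  then obtain l where l: "l < 0" "(f' has_real_derivative l) (at w)" using conc w by auto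
  show False
  proof (cases "w = v")
    case False
    obtain d where d: "d > 0" "\<And>h. h > 0 \<Longrightarrow> h < d \<Longrightarrow> f' (w + h) < f' w"
      using DERIV_neg_dec_right[OF l(2,1)] by auto
    define x where "x = min (w + d / 2) v"
    have x: "w < x" "x \<le> v" "x < w + d" using d False w by (auto simp: x_def min_def)
    have "f x < f w"
    proof (rule DERIV_neg_imp_decreasing_open[OF x(1)])
      fix y assume y: "w < y" "y < x"
      have "f' y < 0" using d(2)[of "y - w"] y x \<open>f' w = 0\<close> by auto
      then show "\<exists>l. (f has_real_derivative l) (at y) \<and> l < 0" using der[of y] y x w by auto
    next
      show "continuous_on {w..x} f" using \<open>continuous_on {u..v} f\<close> by (rule continuous_on_subset) (use w x in auto)
    qed
    then show False using w x by (auto simp: not_less[symmetric])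
  next
    case True
    obtain d where d: "d > 0" "\<And>h. h > 0 \<Longrightarrow> h < d \<Longrightarrow> f' w < f' (w - h)"
      using DERIV_neg_dec_left[OF l(2,1)] by auto
    define x where "x = max (w - d / 2) u"
    have x: "x < w" "u \<le> x" "w - d < x" using d True w \<open>u < v\<close> by (auto simp: x_def max_def)
    have "f x < f w"
    proof (rule DERIV_pos_imp_increasing_open[OF x(1)])
      fix y assume y: "x < y" "y < w"
      have "f' y > 0" using d(2)[of "w - y"] y x \<open>f' w = 0\<close> by auto
      then show "\<exists>l. (f has_real_derivative l) (at y) \<and> l > 0" using der[of y] y x w by auto
    next
      show "continuous_on {x..w} f" using \<open>continuous_on {u..v} f\<close> by (rule continuous_on_subset) (use w x in auto)
    qed
    then show False using w(2)[of x] x w(1) by auto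
  qed
qed

context arc
begin

text \<open>The phase of a given local solution is recovered from its value by \<open>arcsin\<close>, on the branch selected by
the sign of its derivative. Composed with the travel time it has derivative \<open>1\<close> away from critical
points; there is at most one critical point, because \<open>P \<le> 0\<close> forces \<open>\<phi>'' < 0\<close> there. Hence it is time up to
a translation, the solution is part of a translated arch, and maximality makes it the whole arch.\<close>

lemma local_solution_duration:
  assumes "local_solution lam P (kind e) \<phi> a b"
  shows "b - a = duration e"
proof -
  let ?I = "{a<..<b}"
  have ab: "a < b" and sol_on: "positive_solution_on lam P \<phi> ?I"
    and max: "\<And>\<psi> J. positive_solution_on lam P \<psi> J \<Longrightarrow> ?I \<subseteq> J \<Longrightarrow> (\<forall>\<theta>\<in>?I. \<psi> \<theta> = \<phi> \<theta>) \<Longrightarrow> J = ?I"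
    and B: "\<And>\<theta>. \<theta> \<in> ?I \<Longrightarrow> B_quantity lam P \<phi> \<theta> = beta"
    using assms unfolding local_solution_def maximal_positive_solution_on_def by auto
  have sol: "\<And>\<theta>. \<theta> \<in> ?I \<Longrightarrow> 0 < \<phi> \<theta> \<and> solves_ode_at lam P \<phi> \<theta>"
    using sol_on unfolding positive_solution_on_def by blast
  define \<phi>' where "\<phi>' = deriv \<phi>"
  have der: "(\<phi> has_real_derivative \<phi>' \<theta>) (at \<theta>)" if "\<theta> \<in> ?I" for \<theta>
    using sol[OF that] unfolding solves_ode_at_def \<phi>'_def by (meson DERIV_deriv_iff_real_differentiable)
  have der2: "(\<phi>' has_real_derivative deriv \<phi>' \<theta>) (at \<theta>)" if "\<theta> \<in> ?I" for \<theta>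
    using sol[OF that] unfolding solves_ode_at_def \<phi>'_def by (meson DERIV_deriv_iff_real_differentiable)
  have conc: "deriv \<phi>' \<theta> < 0" if th: "\<theta> \<in> ?I" "\<phi>' \<theta> = 0" for \<theta>
  proof -
    have "lam * \<phi> \<theta> * deriv \<phi>' \<theta> = - lam\<^sup>2 * (\<phi> \<theta>)\<^sup>2 + 2 * (lam - 1) * P"
      using sol[OF th(1)] th(2) unfolding solves_ode_at_def \<phi>'_def by simp
    also have "\<dots> < 0"
      using sol[OF th(1)] lam_gt P_le by (intro add_neg_nonpos) (auto intro: mult_nonneg_nonpos)
    finally show ?thesis using sol[OF th(1)] lam_gt by (simp add: mult_less_0_iff)
  qed
  \<comment> \<open>All critical points are strict local maxima, so there is at most one.\<close>
  have crit_unique: "u = v" if "u \<in> ?I" "v \<in> ?I" "\<phi>' u = 0" "\<phi>' v = 0" for u v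
  proof -
    have False if "u < v" "u \<in> ?I" "v \<in> ?I" "\<phi>' u = 0" "\<phi>' v = 0" for u v
    proof (rule two_maxima_impossible[OF that(1) der _ that(4,5)])
      fix x assume "u \<le> x" "x \<le> v"
      then have x: "x \<in> ?I" using that by auto
      then show "x \<in> ?I" .
      assume "\<phi>' x = 0"
      then show "\<exists>l<0. (\<phi>' has_real_derivative l) (at x)" using conc[OF x] der2[OF x] by blast
    qed
    then show ?thesis using that by (metis linorder_cases)
  qed
  have sq: "(\<phi>' \<theta>)\<^sup>2 = energy (\<phi> \<theta>)" if th: "\<theta> \<in> ?I" for \<theta>
  proof -
    have "\<phi> \<theta> powr (2 / lam - 2) * \<phi> \<theta> powr alpha = 1"
      using sol[OF th] by (simp add: powr_add[symmetric] alpha_def)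
    then have "2 * P + (\<phi>' \<theta>)\<^sup>2 + lam\<^sup>2 * (\<phi> \<theta>)\<^sup>2 = B_quantity lam P \<phi> \<theta> * \<phi> \<theta> powr alpha"
      by (simp add: B_quantity_def \<phi>'_def mult.assoc)
    then show ?thesis using B[OF th] by (simp add: energy_def)
  qed
  \<comment> \<open>The normalized variable of the given solution; it is at most \<open>1\<close> since the energy is a square.\<close>
  define y where "y \<theta> = (\<phi> \<theta> / kap) powr (1 / lam)" for \<theta>
  have y_pos: "0 < y \<theta>" if "\<theta> \<in> ?I" for \<theta> using sol[OF that] kap_pos by (simp add: y_def)
  have phi_y: "\<phi> \<theta> = kap * y \<theta> powr lam" if "\<theta> \<in> ?I" for \<theta>
    using sol[OF that] kap_pos lam_gt by (simp add: y_def powr_powr)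
  have sq_y: "(\<phi>' \<theta>)\<^sup>2 = lam\<^sup>2 * kap\<^sup>2 * ((1 - (y \<theta>)\<^sup>2) * (speed e (y \<theta>))\<^sup>2)" if th: "\<theta> \<in> ?I" for \<theta>
    unfolding sq[OF th] using energy_param[of "y \<theta>"] phi_y[OF th] y_pos[OF th] by simp
  have sp: "0 < lam\<^sup>2 * kap\<^sup>2 * (speed e (y \<theta>))\<^sup>2" if th: "\<theta> \<in> ?I" for \<theta>
    using speed_pos[OF e(1), of "y \<theta>"] y_pos[OF th] lam_gt kap_pos by simp
  have y_le: "y \<theta> \<le> 1" if th: "\<theta> \<in> ?I" for \<theta>
  proof -
    have "0 \<le> (1 - (y \<theta>)\<^sup>2) * (lam\<^sup>2 * kap\<^sup>2 * (speed e (y \<theta>))\<^sup>2)"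
      using sq_y[OF th] zero_le_power2[of "\<phi>' \<theta>"] by (simp add: mult_ac)
    then have "(y \<theta>)\<^sup>2 \<le> 1\<^sup>2" using sp[OF th] by (simp add: zero_le_mult_iff)
    then show ?thesis by (rule power2_le_imp_le) simp
  qed
  have y_crit: "\<phi>' \<theta> = 0 \<longleftrightarrow> y \<theta> = 1" if th: "\<theta> \<in> ?I" for \<theta>
  proof -
    have "\<phi>' \<theta> = 0 \<longleftrightarrow> (\<phi>' \<theta>)\<^sup>2 = 0" by simp
    also have "\<dots> \<longleftrightarrow> (y \<theta>)\<^sup>2 = 1" using sq_y[OF th] sp[OF th] by auto
    also have "\<dots> \<longleftrightarrow> y \<theta> = 1" using y_pos[OF th] by (simp add: power2_eq_1_iff)
    finally show ?thesis .
  qed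
  define t where "t \<theta> = (if 0 \<le> \<phi>' \<theta> then arcsin (y \<theta>) else pi - arcsin (y \<theta>))" for \<theta>
  have arcsin_y: "0 < arcsin (y \<theta>)" "arcsin (y \<theta>) \<le> pi / 2" if "\<theta> \<in> ?I" for \<theta>
    using arcsin_less_mono[of 0 "y \<theta>"] arcsin_bounded[of "y \<theta>"] y_pos[OF that] y_le[OF that] by auto
  have t_range: "0 < t \<theta>" "t \<theta> < pi" if "\<theta> \<in> ?I" for \<theta>
    using arcsin_y[OF that] pi_gt_zero by (auto simp: t_def)
  have sin_t: "sin (t \<theta>) = y \<theta>" if "\<theta> \<in> ?I" for \<theta>
    using y_pos[OF that] y_le[OF that] by (auto simp: t_def)
  have y_deriv: "(y has_real_derivative \<phi>' \<theta> / (lam * kap * y \<theta> powr mu)) (at \<theta>)" if th: "\<theta> \<in> ?I" for \<theta>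
  proof -
    have p: "0 < \<phi> \<theta> / kap" using sol[OF th] kap_pos by simp
    have "y \<theta> powr mu = (\<phi> \<theta> / kap) powr (1 - 1 / lam)"
      unfolding y_def powr_powr using lam_gt by (simp add: mu_def field_simps)
    then have "(\<phi> \<theta> / kap) powr (1 / lam - 1) = inverse (y \<theta> powr mu)"
      by (simp add: powr_minus[symmetric])
    then have "((\<lambda>x. (\<phi> x / kap) powr (1 / lam)) has_real_derivative \<phi>' \<theta> / (lam * kap * y \<theta> powr mu)) (at \<theta>)"
      using p kap_pos by (auto intro!: derivative_eq_intros der[OF th] simp: field_simps)
    then show ?thesis by (simp add: y_def[abs_def])
  qed
  have isCont_\<phi>': "isCont \<phi>' \<theta>" if "\<theta> \<in> ?I" for \<theta> using DERIV_isCont[OF der2[OF that]] .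
  have t_deriv: "(t has_real_derivative inverse (kernel e (y \<theta>))) (at \<theta>)" if th: "\<theta> \<in> ?I" and nz: "\<phi>' \<theta> \<noteq> 0" for \<theta>
  proof -
    have y1: "y \<theta> < 1" using y_le[OF th] y_crit[OF th] nz by auto
    have y2: "(y \<theta>)\<^sup>2 < 1" using y1 y_pos[OF th] by (simp add: abs_square_less_1)
    have "\<bar>\<phi>' \<theta>\<bar> = sqrt ((\<phi>' \<theta>)\<^sup>2)" by simp
    also have "\<dots> = lam * kap * (sqrt (1 - (y \<theta>)\<^sup>2) * speed e (y \<theta>))"
      unfolding sq_y[OF th] using lam_gt kap_pos speed_pos[OF e(1), of "y \<theta>"] y_pos[OF th]
      by (simp add: real_sqrt_mult)
    finally have abs: "\<bar>\<phi>' \<theta>\<bar> = lam * kap * (sqrt (1 - (y \<theta>)\<^sup>2) * speed e (y \<theta>))" .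
    have arc: "((\<lambda>x. arcsin (y x)) has_real_derivative inverse (sqrt (1 - (y \<theta>)\<^sup>2)) * (\<phi>' \<theta> / (lam * kap * y \<theta> powr mu))) (at \<theta>)"
      using DERIV_chain2[OF DERIV_arcsin y_deriv[OF th]] y1 y_pos[OF th] by simp
    have ev: "\<forall>\<^sub>F x in nhds \<theta>. sgn (\<phi>' x) = sgn (\<phi>' \<theta>)"
    proof (cases "0 < \<phi>' \<theta>")
      case True
      then have "\<forall>\<^sub>F x in nhds \<theta>. 0 < \<phi>' x"
        using isCont_\<phi>'[OF th, unfolded isCont_def tendsto_at_iff_tendsto_nhds] by (intro order_tendstoD(1))
      then show ?thesis by (rule eventually_mono) (use True in auto)
    next
      case False
      then have "\<phi>' \<theta> < 0" using nz by simp
      then have "\<forall>\<^sub>F x in nhds \<theta>. \<phi>' x < 0"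
        using isCont_\<phi>'[OF th, unfolded isCont_def tendsto_at_iff_tendsto_nhds] by (intro order_tendstoD(2))
      then show ?thesis by (rule eventually_mono) (use \<open>\<phi>' \<theta> < 0\<close> in auto)
    qed
    show ?thesis
    proof (cases "0 < \<phi>' \<theta>")
      case True
      have "\<forall>\<^sub>F x in nhds \<theta>. t x = arcsin (y x)"
        using ev by (rule eventually_mono) (use True in \<open>auto simp: t_def sgn_if split: if_splits\<close>)
      from DERIV_cong_ev[OF refl this refl] show ?thesis
        using arc abs True y2 y_pos[OF th] lam_gt kap_pos by (simp add: kernel_eq field_simps)
    next
      case False
      have "\<forall>\<^sub>F x in nhds \<theta>. t x = pi - arcsin (y x)"
        using ev by (rule eventually_mono) (use False nz in \<open>auto simp: t_def sgn_if split: if_splits\<close>)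
      note cong = DERIV_cong_ev[OF refl this refl]
      have "((\<lambda>x. pi - arcsin (y x)) has_real_derivative - (inverse (sqrt (1 - (y \<theta>)\<^sup>2)) * (\<phi>' \<theta> / (lam * kap * y \<theta> powr mu)))) (at \<theta>)"
        using DERIV_diff[OF DERIV_const arc, of pi] by simp
      moreover have "- \<phi>' \<theta> = lam * kap * (sqrt (1 - (y \<theta>)\<^sup>2) * speed e (y \<theta>))" using abs False by simp
      then have "- (inverse (sqrt (1 - (y \<theta>)\<^sup>2)) * (\<phi>' \<theta> / (lam * kap * y \<theta> powr mu))) = inverse (kernel e (y \<theta>))"
        using y2 y_pos[OF th] lam_gt kap_pos minus_divide_left[of "\<phi>' \<theta>"] by (simp add: kernel_eq field_simps)
      ultimately show ?thesis using cong by simp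
    qed
  qed
  define G where "G \<theta> = travel e (t \<theta>)" for \<theta>
  have G_off: "(G has_real_derivative 1) (at \<theta>)" if th: "\<theta> \<in> ?I" and nz: "\<phi>' \<theta> \<noteq> 0" for \<theta>
  proof -
    have "(G has_real_derivative kernel e (sin (t \<theta>)) * inverse (kernel e (y \<theta>))) (at \<theta>)"
      unfolding G_def[abs_def] by (rule DERIV_chain2[OF travel_deriv t_deriv]) (use th nz t_range in auto)
    then show ?thesis using kernel_pos[OF e(1) y_pos[OF th]] by (simp add: sin_t[OF th])
  qed
  have t_dist: "\<bar>t \<theta> - pi / 2\<bar> = pi / 2 - arcsin (y \<theta>)" if "\<theta> \<in> ?I" for \<theta>
    using arcsin_y[OF that] by (auto simp: t_def)
  have G_deriv: "(G has_real_derivative 1) (at \<theta>)" if th: "\<theta> \<in> ?I" for \<theta>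
  proof (cases "\<phi>' \<theta> = 0")
    case True
    have y1: "y \<theta> = 1" using y_crit[OF th] True by simp
    then have t1: "t \<theta> = pi / 2" using t_dist[OF th] by simp
    have "isCont t \<theta>"
    proof -
      have "(y \<longlongrightarrow> 1) (at \<theta>)" using DERIV_isCont[OF y_deriv[OF th]] y1 by (simp add: isCont_def)
      moreover have inI: "\<forall>\<^sub>F x in at \<theta>. x \<in> ?I"
        using th by (intro eventually_at_in_open') auto
      then have "\<forall>\<^sub>F x in at \<theta>. y x \<in> {-1..1}"
        by (rule eventually_mono) (use y_pos y_le in force)
      ultimately have "((\<lambda>x. arcsin (y x)) \<longlongrightarrow> arcsin 1) (at \<theta>)"
        using continuous_on_tendsto_compose[OF continuous_on_arcsin', of y 1 "at \<theta>"] by simp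
      then have "((\<lambda>x. pi / 2 - arcsin (y x)) \<longlongrightarrow> pi / 2 - arcsin 1) (at \<theta>)"
        by (intro tendsto_intros)
      then have "((\<lambda>x. pi / 2 - arcsin (y x)) \<longlongrightarrow> 0) (at \<theta>)" by simp
      moreover have "\<forall>\<^sub>F x in at \<theta>. pi / 2 - arcsin (y x) = \<bar>t x - pi / 2\<bar>"
        using inI by (rule eventually_mono) (use t_dist in force)
      ultimately have "((\<lambda>x. \<bar>t x - pi / 2\<bar>) \<longlongrightarrow> 0) (at \<theta>)" by (rule Lim_transform_eventually)
      then have "((\<lambda>x. t x - pi / 2) \<longlongrightarrow> 0) (at \<theta>)" by (simp add: tendsto_rabs_zero_iff)
      then have "(t \<longlongrightarrow> pi / 2) (at \<theta>)" by (simp only: LIM_zero_iff)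
      then show ?thesis unfolding isCont_def t1 .
    qed
    moreover have "isCont (travel e) (t \<theta>)" using DERIV_isCont[OF travel_deriv] t_range[OF th] by blast
    ultimately have contG: "isCont G \<theta>" unfolding G_def[abs_def] by (rule isCont_o2)
    have "(G has_real_derivative (\<lambda>_. 1) \<theta>) (at \<theta>)"
    proof (rule has_real_derivative_isolated[where e = "min (\<theta> - a) (b - \<theta>)"])
      show "(G has_real_derivative 1) (at z)" if z: "z \<noteq> \<theta>" "\<bar>z - \<theta>\<bar> < min (\<theta> - a) (b - \<theta>)" for z
      proof -
        have "z \<in> ?I" using z by auto
        then show ?thesis using G_off crit_unique[of z \<theta>] th True z(1) by blast
      qed
    qed (use th contG in auto)
    then show ?thesis by simp
  qed (rule G_off[OF th])
  obtain c where c: "\<And>\<theta>. \<theta> \<in> ?I \<Longrightarrow> G \<theta> - \<theta> = - c"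
  proof -
    have "\<exists>c. \<forall>\<theta>\<in>?I. G \<theta> - \<theta> = c"
    proof (rule has_field_derivative_zero_constant)
      show "((\<lambda>\<theta>. G \<theta> - \<theta>) has_real_derivative 0) (at \<theta> within ?I)" if "\<theta> \<in> ?I" for \<theta>
        using DERIV_diff[OF G_deriv[OF that] DERIV_ident] by (simp add: has_field_derivative_at_within)
    qed simp
    then show thesis using that by (metis minus_minus)
  qed
  have G_range: "0 < G \<theta>" "G \<theta> < duration e" if th: "\<theta> \<in> ?I" for \<theta>
    using travel_strict[of 0 "t \<theta>"] travel_strict[of "t \<theta>" pi] t_range[OF th] travel_0 by (auto simp: G_def duration_def)
  have phi_pos: "\<phi> \<theta> = pos (\<theta> - c)" if th: "\<theta> \<in> ?I" for \<theta>
  proof -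
    have "\<theta> - c = G \<theta>" using c[OF th] by simp
    then have "pos (\<theta> - c) = pos (G \<theta>)" by simp
    also have "\<dots> = kap * sin (tau (G \<theta>)) powr lam" using G_range[OF th] by (simp add: pos_inside)
    also have "tau (G \<theta>) = t \<theta>" using tau_travel t_range[OF th] by (simp add: G_def)
    finally show ?thesis using phi_y[OF th] sin_t[OF th] by simp
  qed
  have "local_solution lam P (kind e) pos 0 (duration e)" using arch_exists unfolding arch_def by blast
  from local_solution_translate[OF this, of c]
  have "positive_solution_on lam P (\<lambda>x. pos (x - c)) {c<..<duration e + c}"
    unfolding local_solution_def maximal_positive_solution_on_def by simp
  then have "{c<..<duration e + c} = ?I"
  proof (rule max)
    show "?I \<subseteq> {c<..<duration e + c}" 
    proof
      fix \<theta> assume th: "\<theta> \<in> ?I"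
      show "\<theta> \<in> {c<..<duration e + c}" using G_range[OF th] c[OF th] by auto
    qed
  qed (use phi_pos in auto)
  then show ?thesis using duration_pos ab by (auto simp: greaterThanLessThan_eq_iff)
qed

lemma lifespan_iff: "lifespan lam P (kind e) T \<longleftrightarrow> T = duration e"
proof
  show "lifespan lam P (kind e) T \<Longrightarrow> T = duration e"
    using local_solution_duration unfolding lifespan_def by blast
  have "local_solution lam P (kind e) pos 0 (duration e)" using arch_exists unfolding arch_def by blast
  then show "T = duration e \<Longrightarrow> lifespan lam P (kind e) T"
    unfolding lifespan_def by (metis diff_zero)
qed

end

section \<open>Lifespans as a decreasing function of one parameter\<close>

context exponent
begin

lemma duration_0: "duration 0 = pi"
  by (simp add: duration_def travel_def kernel_def)

lemma duration_half:
  assumes "0 \<le> e"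
  shows "duration e = 2 * integral {0..pi / 2} (\<lambda>t. kernel e (sin t))"
proof -
  let ?f = "\<lambda>t. kernel e (sin t)"
  have cont: "continuous_on {0..pi} ?f" by (rule continuous_on_kernel[OF assms])
  have "((\<lambda>t. - 1 *\<^sub>R ?f (pi - t)) has_integral (integral {pi - 0..pi - pi / 2} ?f - integral {pi - pi / 2..pi - 0} ?f)) {0..pi / 2}"
    by (rule has_integral_substitution_general[of "{}" _ _ _ 0 pi])
      (auto intro!: cont continuous_intros derivative_eq_intros)
  then have "((\<lambda>t. - ?f t) has_integral - integral {pi / 2..pi} ?f) {0..pi / 2}" by simp
  from has_integral_neg[OF this] have "(?f has_integral integral {pi / 2..pi} ?f) {0..pi / 2}" by simp
  then have "integral {0..pi / 2} ?f = integral {pi / 2..pi} ?f" by (rule integral_unique)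
  moreover have "integral {0..pi / 2} ?f + integral {pi / 2..pi} ?f = integral {0..pi} ?f"
    by (rule Henstock_Kurzweil_Integration.integral_combine) (auto intro!: integrable_continuous_real cont)
  ultimately show ?thesis by (simp add: duration_def travel_def)
qed

text \<open>For \<open>e = 1\<close> the term with \<open>B\<close> drops out of the first-order law and the substitution
\<open>y powr lam = sin s\<close> integrates it.\<close>

lemma duration_1: "duration 1 = pi / lam"
proof -
  let ?F = "\<lambda>t. arcsin (sin t powr lam) / lam"
  have lam: "0 < lam" using lam_gt by simp
  have "((\<lambda>t. kernel 1 (sin t)) has_integral (?F (pi / 2) - ?F 0)) {0..pi / 2}"
  proof (rule fundamental_theorem_of_calculus_interior)
    have "sin t powr lam \<le> 1" if "0 \<le> t" "t \<le> pi / 2" for t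
      using that lam sin_ge_zero[of t] powr_mono2[of lam "sin t" 1] by auto
    then show "continuous_on {0..pi / 2} ?F"
      using lam sin_ge_zero by (intro continuous_intros continuous_on_powr') (auto intro: order_trans[of "-1" 0])
    show "(?F has_vector_derivative kernel 1 (sin t)) (at t)" if "t \<in> {0<..<pi / 2}" for t
    proof -
      let ?y = "sin t"
      have y: "0 < ?y" "?y < 1" "0 < cos t"
        using that sin_gt_zero[of t] cos_gt_zero[of t] sin_monotone_2pi[of t "pi / 2"] by auto
      have yl: "?y powr lam < 1" using powr_less_mono2[of lam ?y 1] y lam by simp
      have "(?y powr lam)\<^sup>2 = ?y powr (lam + lam)" by (simp only: power2_eq_square powr_add)
      also have "lam + lam = 2 * mu + 2" by (simp add: mu_def)
      also have "?y powr (2 * mu + 2) = ?y powr (2 * mu) * ?y\<^sup>2"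
        using y by (simp_all add: powr_add powr_numeral)
      finally have "1 - (?y powr lam)\<^sup>2 = (1 - ?y\<^sup>2) * ?y powr (2 * mu) + (1 - ?y powr (2 * mu))"
        by (simp add: algebra_simps)
      also have "\<dots> = (1 - ?y\<^sup>2) * (?y powr (2 * mu) + chord ?y)"
        using chord_mult[of ?y] y by (simp add: distrib_left)
      also have "\<dots> = (cos t)\<^sup>2 * (speed 1 ?y)\<^sup>2"
        using speed_sq[of 1 ?y] y by (simp add: cos_squared_eq)
      finally have s: "sqrt (1 - (?y powr lam)\<^sup>2) = cos t * speed 1 ?y"
        using y speed_pos[of 1 ?y] by (simp add: real_sqrt_mult)
      have "(?F has_real_derivative inverse (sqrt (1 - (?y powr lam)\<^sup>2)) * (lam * ?y powr (lam - 1) * cos t) / lam) (at t)"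
        using y yl by (auto intro!: derivative_eq_intros intro: order_less_trans[of "-1" 0])
      also have "inverse (sqrt (1 - (?y powr lam)\<^sup>2)) * (lam * ?y powr (lam - 1) * cos t) / lam = kernel 1 ?y"
        unfolding s using y lam by (simp add: kernel_eq mu_def[symmetric] field_simps)
      finally show ?thesis by (simp add: has_real_derivative_iff_has_vector_derivative)
    qed
  qed simp
  then have "integral {0..pi / 2} (\<lambda>t. kernel 1 (sin t)) = ?F (pi / 2) - ?F 0" by (rule integral_unique)
  then show ?thesis using lam by (simp add: duration_half)
qed

lemma kernel_strict_antimono:
  assumes "0 \<le> e" "e < e'" "0 < y"
  shows "kernel e' y < kernel e y"
proof -
  have "speed e y < speed e' y" using assms chord_pos[of y] by (simp add: speed_def)
  moreover have "0 < speed e y" using assms by (intro speed_pos) auto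
  ultimately show ?thesis using assms by (simp add: kernel_eq frac_less2)
qed

lemma duration_strict_antimono:
  assumes "0 \<le> e" "e < e'"
  shows "duration e' < duration e"
proof -
  have ne: "{0<..<pi} \<noteq> {}" using pi_half_gt_zero by (intro ex_in_conv[THEN iffD1] exI[of _ "pi / 2"]) simp
  show ?thesis
    unfolding duration_def travel_def using assms
    by (intro integral_less_real[OF _ _ ne] continuous_on_kernel) (auto intro!: kernel_strict_antimono sin_gt_zero)
qed

lemma duration_bounds:
  shows "0 \<le> e \<Longrightarrow> e < 1 \<Longrightarrow> pi / lam < duration e" "0 \<le> e \<Longrightarrow> duration e \<le> pi" "1 < e \<Longrightarrow> duration e < pi / lam"
proof -
  show "0 \<le> e \<Longrightarrow> e < 1 \<Longrightarrow> pi / lam < duration e" using duration_strict_antimono[of e 1] duration_1 by simp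
  show "0 \<le> e \<Longrightarrow> duration e \<le> pi" using duration_strict_antimono[of 0 e] duration_0 by (cases "e = 0") auto
  show "1 < e \<Longrightarrow> duration e < pi / lam" using duration_strict_antimono[of 1 e] duration_1 by simp
qed

text \<open>Up to a constant factor depending on \<open>lam\<close> this is \<open>- P\<close>, so it decides which \<open>e\<close> below and above \<open>1\<close> share a
pressure.\<close>

definition ratio :: "real \<Rightarrow> real" where
  "ratio e = e * \<bar>1 - e\<bar> powr - lam"

lemma pressure_ratio: "pressure e = - (lam\<^sup>2 * (lam\<^sup>2) powr - lam / 2) * ratio e"
proof -
  have "(kappa e)\<^sup>2 = (lam\<^sup>2 * \<bar>1 - e\<bar>) powr (- lam / 2 + - lam / 2)"
    by (simp only: kappa_def power2_eq_square powr_add)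
  also have "\<dots> = (lam\<^sup>2) powr - lam * \<bar>1 - e\<bar> powr - lam" by (simp add: powr_mult)
  finally show ?thesis by (simp add: pressure_def ratio_def)
qed

lemma pressure_coeff: "0 < lam\<^sup>2 * (lam\<^sup>2) powr - lam / 2"
  using lam_gt by simp

lemma continuous_on_ratio: "1 \<notin> S \<Longrightarrow> continuous_on S ratio"
  unfolding ratio_def[abs_def] by (intro continuous_intros) auto

lemma ratio_pos: "0 < e \<Longrightarrow> e \<noteq> 1 \<Longrightarrow> 0 < ratio e"
  by (simp add: ratio_def)

lemma ratio_surj_below:
  assumes "0 \<le> A"
  obtains e where "0 \<le> e" "e < 1" "ratio e = A" "A = 0 \<longleftrightarrow> e = 0"
proof -
  \<comment> \<open>Here \<open>(1 - b) powr - lam \<ge> 1 / (1 - b) = A + 1\<close>, so \<open>ratio b \<ge> A\<close>.\<close>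
  define b where "b = A / (A + 1)"
  have b: "0 \<le> b" "b < 1" "1 - b = 1 / (A + 1)" using assms by (auto simp: b_def field_simps)
  have "(1 - b) powr - 1 \<le> (1 - b) powr - lam" using b lam_gt assms by (intro powr_mono') auto
  then have "A + 1 \<le> (1 - b) powr - lam" using b assms by (simp add: powr_minus_divide)
  moreover have "ratio b = b * (1 - b) powr - lam" using b(1,2) by (simp add: ratio_def)
  ultimately have "b * (A + 1) \<le> ratio b" using mult_left_mono[OF _ b(1)] by metis
  then have "A \<le> ratio b" using assms by (simp add: b_def)
  moreover have "ratio 0 \<le> A" using assms by (simp add: ratio_def)
  moreover have "continuous_on {0..b} ratio" using b by (intro continuous_on_ratio) auto
  ultimately obtain e where e: "0 \<le> e" "e \<le> b" "ratio e = A" using IVT'[of ratio 0 A b] b by auto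
  have "A = 0 \<longleftrightarrow> e = 0" using e b by (auto simp: ratio_def)
  then show thesis using that[of e] e b by simp
qed

lemma ratio_above: "0 < s \<Longrightarrow> ratio (1 + s) = s powr - lam + s powr - mu"
proof -
  assume s: "0 < s"
  have "s powr - mu = s * s powr - lam" using s powr_add[of s 1 "- lam"] by (simp add: mu_def)
  then show ?thesis using s by (simp add: ratio_def algebra_simps)
qed

lemma ratio_surj_above:
  assumes "0 < A"
  obtains e where "1 < e" "ratio e = A"
proof -
  \<comment> \<open>\<open>ratio (1 + s) \<ge> A \<ge> ratio (1 + r)\<close>, by the two powers in \<open>ratio_above\<close>.\<close>
  define s where "s = min 1 (1 / A)"
  define r where "r = max 1 ((2 / A) powr (1 / mu))"
  have s: "0 < s" "s \<le> 1" and r: "1 \<le> r" using assms by (auto simp: s_def r_def)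
  have "A \<le> 1 / s" using assms s by (simp add: s_def min_def field_simps)
  also have "1 / s = s powr - 1" using s by (simp add: powr_minus_divide)
  also have "\<dots> \<le> s powr - lam" using s lam_gt by (intro powr_mono') auto
  also have "\<dots> \<le> ratio (1 + s)" using s by (simp add: ratio_above)
  finally have 1: "A \<le> ratio (1 + s)" .
  have "ratio (1 + r) \<le> 2 * r powr - mu"
    using r powr_mono[of "- lam" "- mu" r] by (simp add: ratio_above mu_def)
  also have "r powr - mu \<le> ((2 / A) powr (1 / mu)) powr - mu"
    using assms mu(1) by (intro powr_mono2') (auto simp: r_def)
  also have "\<dots> = A / 2" using assms mu(1) by (simp add: powr_powr powr_minus_divide)
  finally have 2: "ratio (1 + r) \<le> A" by simp
  have "continuous_on {1 + s..1 + r} ratio" using s by (intro continuous_on_ratio) auto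
  then obtain e where "1 + s \<le> e" "e \<le> 1 + r" "ratio e = A"
    using IVT2'[of ratio "1 + r" A "1 + s"] 1 2 s r by auto
  then show thesis using that[of e] s by auto
qed

lemma ratio_inj_above: "inj_on ratio {1<..}"
proof (rule linorder_inj_onI)
  have lt: "ratio y < ratio x" if "x < y" "1 < x" for x y
    using that ratio_above[of "x - 1"] ratio_above[of "y - 1"] lam_gt mu(1)
    by (auto intro!: add_strict_mono powr_less_mono2_neg)
  show "ratio x \<noteq> ratio y" if "x < y" "x \<in> {1<..}" "y \<in> {1<..}" for x y
    using lt[of x y] that by auto
qed auto

text \<open>The parameter \<open>x > 1\<close> of \<open>\<psi>\<^sub>-\<close> with the same pressure as the \<open>\<psi>\<^sub>+\<close> with parameter \<open>u < 1\<close>; it depends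
continuously on \<open>u\<close> because an injective continuous function on an interval has a continuous inverse.\<close>

lemma partner:
  obtains w where "continuous_on {0<..<1} w" "\<And>u. 0 < u \<Longrightarrow> u < 1 \<Longrightarrow> 1 < w u \<and> ratio (w u) = ratio u"
proof -
  have "\<exists>g. homeomorphism {1<..} (ratio ` {1<..}) ratio g"
    using injective_into_1d_eq_homeomorphism[of "{1<..}" ratio] ratio_inj_above continuous_on_ratio[of "{1<..}"]
    by (auto simp: is_interval_path_connected_1[symmetric])
  then obtain g where g: "homeomorphism {1<..} (ratio ` {1<..}) ratio g" by blast
  have im: "ratio u \<in> ratio ` {1<..}" if u: "0 < u" "u < 1" for u
  proof -
    obtain e where "1 < e" "ratio e = ratio u" using ratio_surj_above[OF ratio_pos[of u]] u by auto
    then show ?thesis by (auto intro!: image_eqI[of _ _ e])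
  qed
  show thesis
  proof
    have im': "ratio ` {0<..<1} \<subseteq> ratio ` {1<..}" using im by (meson greaterThanLessThan_iff image_subsetI)
    show "continuous_on {0<..<1} (\<lambda>u. g (ratio u))"
      by (rule continuous_on_compose2[OF homeomorphism_cont2[OF g] continuous_on_ratio im']) simp
    show "1 < g (ratio u) \<and> ratio (g (ratio u)) = ratio u" if "0 < u" "u < 1" for u
    proof -
      have "g (ratio u) \<in> {1<..}" using im[OF that] homeomorphism_image2[OF g] by blast
      then show ?thesis using homeomorphism_apply2[OF g im[OF that]] by simp
    qed
  qed
qed

text \<open>Intermediate value theorem for the total lifespan as a function of \<open>u\<close>. For large \<open>- P\<close> both lifespans are
at least almost \<open>pi / lam > pi / 2\<close>, so four or more pieces exceed \<open>2 pi\<close>.\<close>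

lemma balance:
  fixes p q :: nat
  assumes pq: "4 \<le> p + q"
    and low: "0 < u0" "u0 < 1" "1 < x0" "ratio x0 = ratio u0" "p * duration u0 + q * duration x0 < 2 * pi"
  obtains u x where "0 < u" "u < 1" "1 < x" "ratio x = ratio u" "p * duration u + q * duration x = 2 * pi"
proof -
  obtain w where w: "continuous_on {0<..<1} w" "\<And>u. 0 < u \<Longrightarrow> u < 1 \<Longrightarrow> 1 < w u \<and> ratio (w u) = ratio u"
    using partner by blast
  define F where "F u = p * duration u + q * duration (w u)" for u
  have w_eq: "w u = x" if "0 < u" "u < 1" "1 < x" "ratio x = ratio u" for u x
  proof (rule inj_onD[OF ratio_inj_above])
    show "ratio (w u) = ratio x" using w(2)[OF that(1,2)] that(4) by (metis (no_types))
    show "w u \<in> {1<..}" "x \<in> {1<..}" using w(2)[OF that(1,2)] that(3) by (simp_all only: greaterThan_iff)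
  qed
  have cont: "continuous_on {0<..<1} F"
  proof -
    have "w u \<in> {0<..}" if "u \<in> {0<..<1}" for u using w(2)[of u] that by simp
    then have "continuous_on {0<..<1} (\<lambda>u. duration (w u))"
      by (intro continuous_on_compose2[OF continuous_on_duration w(1)]) auto
    moreover have "continuous_on {0<..<1} duration" by (rule continuous_on_subset[OF continuous_on_duration]) auto
    ultimately show ?thesis unfolding F_def[abs_def] by (intro continuous_intros)
  qed
  have "isCont duration 1" using continuous_on_interior[OF continuous_on_duration, of 1] by (simp add: interior_open)
  then have lim: "(duration \<longlongrightarrow> duration 1) (at_right 1)"
    unfolding isCont_def by (rule tendsto_within_subset) simp
  have "2 * pi / (p + q) < duration 1"
  proof -
    have "2 * pi / (p + q) \<le> 2 * pi / 4" using pq by (intro divide_left_mono) auto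
    also have "\<dots> < pi / lam" using lam_lt lam_gt by (simp add: field_simps)
    finally show ?thesis by (simp add: duration_1)
  qed
  then have "\<forall>\<^sub>F x in at_right 1. 2 * pi / (p + q) < duration x"
    by (rule order_tendstoD(1)[OF lim])
  moreover have "\<forall>\<^sub>F x :: real in at_right 1. 1 < x" by (simp add: eventually_at_filter)
  ultimately have "\<exists>x. 2 * pi / (p + q) < duration x \<and> 1 < x"
    by (intro eventually_happens'[of "at_right (1::real)"] eventually_conj) auto
  then obtain x where x: "1 < x" "2 * pi / (p + q) < duration x" by blast
  have rx: "0 < ratio x" using ratio_pos[of x] x by simp
  obtain u1 where u1: "0 \<le> u1" "u1 < 1" "ratio u1 = ratio x" "ratio x = 0 \<longleftrightarrow> u1 = 0"
    using ratio_surj_below[of "ratio x"] rx by auto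
  then have "0 < u1" using rx by auto
  have "2 * pi < (p + q) * duration x" using x(2) pq by (simp add: field_simps)
  also have "\<dots> \<le> F u1"
    using duration_strict_antimono[of u1 x] u1 x w_eq[of u1 x] \<open>0 < u1\<close>
    by (auto simp: F_def distrib_right intro!: mult_left_mono)
  finally have hi: "2 * pi < F u1" .
  have lo: "F u0 < 2 * pi" using low w_eq[of u0 x0] by (simp add: F_def)
  have conn: "connected (F ` {0<..<1})" using cont by (rule connected_continuous_image) simp
  have "F u0 \<in> F ` {0<..<1}" "F u1 \<in> F ` {0<..<1}" using low(1,2) \<open>0 < u1\<close> u1(2) by simp_all
  then have "2 * pi \<in> F ` {0<..<1}"
    by (rule connectedD_interval[OF conn]) (use lo hi in simp_all)
  then obtain u where "0 < u" "u < 1" "F u = 2 * pi" by auto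
  then show thesis using that[of u "w u"] w(2) by (auto simp: F_def)
qed

lemma lifespan_bounds:
  assumes "P \<le> 0"
  shows "lifespan lam P Plus T \<Longrightarrow> pi / lam < T \<and> T \<le> pi" "lifespan lam P Minus T \<Longrightarrow> 0 < T \<and> T < pi / lam"
proof -
  define A where "A = - P / (lam\<^sup>2 * (lam\<^sup>2) powr - lam / 2)"
  have A: "0 \<le> A" using assms unfolding A_def by (intro divide_nonneg_pos[OF _ pressure_coeff]) simp
  have P: "P = pressure e" if "ratio e = A" for e
    using pressure_coeff that lam_gt by (simp add: pressure_ratio A_def)
  {
    assume l: "lifespan lam P Plus T"
    obtain e where er: "0 \<le> e" "e < 1" "ratio e = A" using ratio_surj_below[OF A] by blast
    interpret arc lam e by unfold_locales (use er in auto)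
    have "T = duration e" using l lifespan_iff er P[OF er(3)] by (simp add: kind_def)
    then show "pi / lam < T \<and> T \<le> pi" using duration_bounds er by simp
  }
  {
    assume l: "lifespan lam P Minus T"
    \<comment> \<open>For \<open>P = 0\<close> the quantity \<open>B\<close> cannot be negative.\<close>
    have "A \<noteq> 0"
    proof
      assume "A = 0"
      then have "P = 0" using pressure_coeff lam_gt by (simp add: A_def)
      then obtain \<phi> a b where "local_solution lam 0 Minus \<phi> a b"
        using l unfolding lifespan_def by blast
      then have "B_quantity lam 0 \<phi> ((a + b) / 2) = - 1" unfolding local_solution_def by simp
      moreover have "0 \<le> B_quantity lam 0 \<phi> \<theta>" for \<theta> by (simp add: B_quantity_def)
      ultimately show False by (metis neg_0_le_iff_le not_one_le_zero)
    qed
    then obtain e where er: "1 < e" "ratio e = A" using ratio_surj_above[of A] A by auto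
    interpret arc lam e by unfold_locales (use er in auto)
    have "T = duration e" using l lifespan_iff er P[OF er(2)] by (simp add: kind_def)
    then show "0 < T \<and> T < pi / lam" using duration_bounds duration_pos er by simp
  }
qed

lemma gluing_possible:
  fixes p q :: nat
  assumes even: "even (p + q)"
    and u: "0 < p \<Longrightarrow> 0 \<le> u \<and> u < 1 \<and> P = pressure u"
    and x: "0 < q \<Longrightarrow> 1 < x \<and> P = pressure x"
    and P: "P \<le> 0" and total: "p * duration u + q * duration x = 2 * pi"
  shows "solution_by_gluing_in_any_order lam p q" "combination_possible lam p q"
proof -
  define f where "f s = arc.pos lam (if s = Plus then u else x)" for s
  define f' where "f' s = arc.vel lam (if s = Plus then u else x)" for s
  define T where "T s = (if s = Plus then duration u else duration x)" for s
  have arc_u: "arc lam u" if "0 < p" using u[OF that] by unfold_locales auto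
  have arc_x: "arc lam x" if "0 < q" using x[OF that] by unfold_locales auto
  have arch_u: "arch lam P Plus (f Plus) (f' Plus) (T Plus)" if "0 < p"
    using arc.arch_exists[OF arc_u[OF that]] u[OF that] by (simp add: f_def f'_def T_def kind_def)
  have arch_x: "arch lam P Minus (f Minus) (f' Minus) (T Minus)" if "0 < q"
    using arc.arch_exists[OF arc_x[OF that]] x[OF that] by (simp add: f_def f'_def T_def kind_def)
  show "solution_by_gluing_in_any_order lam p q"
    unfolding solution_by_gluing_in_any_order_def
  proof (intro exI[of _ P] conjI P allI impI)
    fix ss assume ss: "count_list ss Plus = p \<and> count_list ss Minus = q"
    have arch_s: "arch lam P s (f s) (f' s) (T s)" if "s \<in> set ss" for s
    proof -
      have "0 < count_list ss s" using that count_list_0_iff[of ss s] by simp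
      then show ?thesis using ss arch_u arch_x by (cases s) auto
    qed
    interpret arches lam P f f' T ss by unfold_locales (use P arch_s in auto)
    have sums: "length us = count_list us Plus + count_list us Minus \<and>
       (\<Sum>s\<leftarrow>us. T s) = count_list us Plus * duration u + count_list us Minus * duration x" for us
    proof (induction us)
      case (Cons s us)
      then show ?case by (cases s) (auto simp: T_def algebra_simps)
    qed simp
    show "\<exists>\<psi>. glued lam P ss \<psi> \<and> periodic_solution lam P \<psi>"
      using glue sums[of ss] ss even total by simp
  qed
  show "combination_possible lam p q"
    unfolding combination_possible_def
    using even P total u x arc.lifespan_iff[OF arc_u] arc.lifespan_iff[OF arc_x]
    by (intro conjI exI[of _ P] exI[of _ "duration u"] exI[of _ "duration x"]) (auto simp: kind_def)
qed

end

section \<open>An inequality between two integrals\<close>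

lemma continuous_on_x_ln: "continuous_on {0..} (\<lambda>x::real. x * ln x)"
  unfolding continuous_on_eq_continuous_within
proof
  fix x :: real assume x: "x \<in> {0..}"
  show "continuous (at x within {0..}) (\<lambda>x. x * ln x)"
  proof (cases "x = 0")
    case True
    have "((\<lambda>x::real. x * ln x) \<longlongrightarrow> 0) (at_right 0)" by real_asymp
    moreover have "at 0 within {0..} = at_right (0::real)" by (simp add: at_within_Ici_at_right)
    ultimately show ?thesis using True by (simp add: continuous_within)
  next
    case False
    then show ?thesis using x by (intro continuous_intros) auto
  qed
qed

text \<open>An inequality between the integrands that may fail at the end points, where the minorant can be
undefined (here: logarithms).\<close>

lemma integral_gain:
  fixes f g :: "real \<Rightarrow> real"
  assumes "continuous_on {a..b} f" "(g has_integral i) {a..b}" "a < b"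
    "\<And>x. x \<in> {a<..<b} \<Longrightarrow> g x \<le> f x"
  shows "i \<le> integral {a..b} f"
proof -
  have "i \<le> integral {a..b} (\<lambda>x. if x \<in> {a, b} then g x else f x)"
  proof (rule has_integral_le[OF assms(2) integrable_integral])
    show "(\<lambda>x. if x \<in> {a, b} then g x else f x) integrable_on {a..b}"
      using integrable_spike_finite[of "{a,b}" "{a..b}" "\<lambda>x. if x \<in> {a, b} then g x else f x" f] 
        integrable_continuous_real[OF assms(1)] by auto
    show "g x \<le> (if x \<in> {a, b} then g x else f x)" if "x \<in> {a..b}" for x
      using assms(4)[of x] that by auto
  qed
  also have "\<dots> = integral {a..b} f"
    by (rule integral_spike[of "{a, b}"]) auto
  finally show ?thesis .
qed

context exponent
begin

definition nu :: real where "nu = 1 / mu - 1"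

text \<open>If \<open>v = sqrt (1 + W\<^sup>2) - W\<close> then \<open>slope v = W\<close>; this substitution rationalizes \<open>sqrt (1 + W\<^sup>2)\<close>.\<close>

definition slope :: "real \<Rightarrow> real" where "slope v = (1 - v\<^sup>2) / (2 * v)"

lemma nu_pos: "0 < nu" using mu by (simp add: nu_def)

lemma slope_nonneg: "0 < v \<Longrightarrow> v \<le> 1 \<Longrightarrow> 0 \<le> slope v"
  by (simp add: slope_def abs_square_le_1)

lemma continuous_on_slope_powr: "0 < v1 \<Longrightarrow> continuous_on {v1..1} (\<lambda>v. slope v powr nu)"
  unfolding slope_def using nu_pos slope_nonneg[unfolded slope_def]
  by (intro continuous_intros continuous_on_powr') auto

lemma continuous_on_circle_powr: "continuous_on {0..1} (\<lambda>v::real. (1 - v\<^sup>2) powr (nu / 2))"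
  using nu_pos by (intro continuous_intros continuous_on_powr') (auto simp: abs_square_le_1)

text \<open>With \<open>n = nu / 2\<close> one has \<open>slope v powr nu = (1 - v\<^sup>2) powr n * exp (n L)\<close>, and \<open>exp (n L) - 1 \<ge> n L\<close>. The weight
\<open>(1 - v\<^sup>2) powr n\<close> is at least \<open>(4 / 5) powr n\<close> exactly where \<open>L \<ge> 0\<close>, namely for \<open>v\<^sup>2 \<le> 1 / 5\<close>, so it may be
replaced by this constant. For \<open>v \<le> 1 / 4\<close>, where \<open>L \<ge> 1\<close>, the quadratic term of the exponential
gives something extra.\<close>

lemma slope_powr_gain:
  assumes v: "0 < v" "v < 1" and n: "n = nu / 2"
    and L: "L = ln (1 + v) + ln (1 - v) - 2 * ln (2 * v)"
  shows "(4 / 5) powr n * (n * L) \<le> slope v powr nu - (1 - v\<^sup>2) powr n"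
    and "v \<le> 1 / 4 \<Longrightarrow> (4 / 5) powr n * (n * L + n\<^sup>2 / 2) \<le> slope v powr nu - (1 - v\<^sup>2) powr n"
proof -
  have n0: "0 < n" using nu_pos n by simp
  have c: "0 < 1 - v\<^sup>2" using v by (simp add: abs_square_less_1)
  have L': "L = ln ((1 - v\<^sup>2) / (4 * v\<^sup>2))"
  proof -
    have "ln (1 + v) + ln (1 - v) = ln ((1 + v) * (1 - v))" using v by (simp add: ln_mult)
    also have "(1 + v) * (1 - v) = 1 - v\<^sup>2" by (simp add: power2_eq_square algebra_simps)
    finally have "ln (1 + v) + ln (1 - v) = ln (1 - v\<^sup>2)" .
    moreover have "2 * ln (2 * v) = ln ((2 * v)\<^sup>2)" using ln_realpow[of "2 * v" 2] v by simp
    moreover have "(2 * v)\<^sup>2 = 4 * v\<^sup>2" by (simp add: power_mult_distrib)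
    ultimately show ?thesis using v c by (simp add: L ln_div)
  qed
  have "(slope v)\<^sup>2 = (1 - v\<^sup>2) * exp L"
    using v c by (simp add: L' slope_def power2_eq_square field_simps)
  moreover have "slope v powr nu = ((slope v)\<^sup>2) powr n"
    using slope_nonneg[of v] v by (simp add: n powr_powr flip: powr_numeral)
  ultimately have eq: "slope v powr nu = (1 - v\<^sup>2) powr n * exp (n * L)"
    using c by (simp add: powr_mult exp_powr_real mult.commute)
  have sign: "(0 \<le> L \<longrightarrow> 4 / 5 \<le> 1 - v\<^sup>2) \<and> (L \<le> 0 \<longrightarrow> 1 - v\<^sup>2 \<le> 4 / 5)"
    using c v by (auto simp: L' ln_le_zero_iff field_simps)
  have weight: "(4 / 5) powr n * (n * L) \<le> (1 - v\<^sup>2) powr n * (n * L)"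
  proof (cases "0 \<le> L")
    case True
    then show ?thesis using sign n0 by (intro mult_right_mono powr_mono2) auto
  next
    case False
    then have "n * L \<le> 0" using n0 by (simp add: mult_nonneg_nonpos)
    moreover have "(1 - v\<^sup>2) powr n \<le> (4 / 5) powr n" using sign False c n0 by (intro powr_mono2) auto
    ultimately show ?thesis by (intro mult_right_mono_neg) auto
  qed
  have "n * L \<le> exp (n * L) - 1" using exp_ge_add_one_self[of "n * L"] by linarith
  then have "(1 - v\<^sup>2) powr n * (n * L) \<le> (1 - v\<^sup>2) powr n * (exp (n * L) - 1)"
    by (rule mult_left_mono) simp
  then show "(4 / 5) powr n * (n * L) \<le> slope v powr nu - (1 - v\<^sup>2) powr n"
    using weight by (simp add: eq algebra_simps)
  assume small: "v \<le> 1 / 4"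
  have v2: "v\<^sup>2 \<le> 1 / 16" using power_mono[OF small, of 2] v by (simp add: power2_eq_square)
  have "(15 / 16) / (1 / 4) \<le> (1 - v\<^sup>2) / (4 * v\<^sup>2)"
    by (rule frac_le) (use v v2 in auto)
  then have "15 / 4 \<le> (1 - v\<^sup>2) / (4 * v\<^sup>2)" by simp
  then have "exp 1 \<le> (1 - v\<^sup>2) / (4 * v\<^sup>2)" using exp_le by linarith
  then have "1 \<le> L" using v c unfolding L' by (subst ln_ge_iff) auto
  then have nL: "n \<le> n * L" using n0 by simp
  have "n\<^sup>2 \<le> (n * L)\<^sup>2" using nL n0 by (intro power_mono) auto
  then have "n * L + n\<^sup>2 / 2 \<le> exp (n * L) - 1"
    using exp_lower_Taylor_quadratic[of "n * L"] nL n0 by linarith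
  moreover have "(4 / 5) powr n \<le> (1 - v\<^sup>2) powr n" using sign \<open>1 \<le> L\<close> n0 by (intro powr_mono2) auto
  moreover have "0 \<le> n * L + n\<^sup>2 / 2" using nL n0 by (intro add_nonneg_nonneg) auto
  ultimately have "(4 / 5) powr n * (n * L + n\<^sup>2 / 2) \<le> (1 - v\<^sup>2) powr n * (exp (n * L) - 1)"
    by (intro mult_mono) auto
  then show "(4 / 5) powr n * (n * L + n\<^sup>2 / 2) \<le> slope v powr nu - (1 - v\<^sup>2) powr n"
    by (simp add: eq algebra_simps)
qed

text \<open>The lower bound \<open>(4 / 5) powr n * (n * L)\<close> of the difference of the integrands has integral \<open>0\<close> over \<open>[0, 1]\<close>: its
primitive is a combination of \<open>x * ln x\<close> which vanishes at both ends. The quadratic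
gain on \<open>[v1, 1 / 4]\<close> stays bounded away from \<open>0\<close> as \<open>v1\<close> tends to \<open>0\<close>, while cutting off \<open>[0, v1]\<close>
costs an amount tending to \<open>0\<close>.\<close>

lemma slope_integral_gain:
  obtains v1 where "0 < v1" "v1 < 1"
    "integral {0..1} (\<lambda>v. (1 - v\<^sup>2) powr (nu / 2)) < integral {v1..1} (\<lambda>v. slope v powr nu)"
proof -
  define n where "n = nu / 2"
  define c where "c = (4 / 5 :: real) powr n"
  define X :: "real \<Rightarrow> real" where "X x = x * ln x" for x
  \<comment> \<open>A primitive of \<open>L\<close>.\<close>
  define A where "A v = X (1 + v) - X (1 - v) - X (2 * v)" for v
  define L :: "real \<Rightarrow> real" where "L v = ln (1 + v) + ln (1 - v) - 2 * ln (2 * v)" for v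
  have n0: "0 < n" and c0: "0 < c" using nu_pos by (auto simp: n_def c_def)
  have contX: "continuous_on S (\<lambda>x. X (f x))" if "continuous_on S f" "\<And>x. x \<in> S \<Longrightarrow> 0 \<le> f x" for S f
    unfolding X_def using that by (intro continuous_on_compose2[OF continuous_on_x_ln]) auto
  have contA: "continuous_on {0..1} A"
    unfolding A_def[abs_def] by (intro continuous_intros contX) auto
  have A_deriv: "(A has_real_derivative L v) (at v)" if "0 < v" "v < 1" for v
  proof -
    have X': "((\<lambda>v. X (f v)) has_real_derivative (ln (f v) + 1) * d) (at v)"
      if "0 < f v" "(f has_real_derivative d) (at v)" for f d
      unfolding X_def using that by (auto intro!: derivative_eq_intros simp: field_simps)
    have "((\<lambda>v. X (1 + v) - X (1 - v) - X (2 * v)) has_real_derivative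
        (ln (1 + v) + 1) * 1 - (ln (1 - v) + 1) * - 1 - (ln (2 * v) + 1) * 2) (at v)"
      using that by (intro DERIV_diff X') (auto intro!: derivative_eq_intros)
    then show ?thesis by (simp add: A_def[abs_def] L_def algebra_simps)
  qed
  have A_ends: "A 0 = 0" "A 1 = 0" by (auto simp: A_def X_def)
  have L_int: "(L has_integral (A b - A a)) {a..b}" if "0 \<le> a" "a \<le> b" "b \<le> 1" for a b
    using that contA A_deriv
    by (intro fundamental_theorem_of_calculus_interior)
      (auto simp flip: has_real_derivative_iff_has_vector_derivative intro: continuous_on_subset)
  let ?S = "\<lambda>v. slope v powr nu" and ?C = "\<lambda>v::real. (1 - v\<^sup>2) powr n"
  have contC: "continuous_on {0..1} ?C" using continuous_on_circle_powr by (simp add: n_def)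
  have gain: "integral {0..1} ?C + (c * (n\<^sup>2 / 2) * (1 / 4 - v1) - c * n * A v1 - v1) \<le> integral {v1..1} ?S"
    if v1: "0 < v1" "v1 < 1 / 4" for v1
  proof -
    have contS: "continuous_on {v1..1} ?S" using continuous_on_slope_powr v1 by simp
    have contD: "continuous_on T (\<lambda>v. ?S v - ?C v)" if "T \<subseteq> {v1..1}" for T
      using that v1 by (intro continuous_intros continuous_on_subset[OF contS] continuous_on_subset[OF contC]) auto
    have "((\<lambda>v. c * (n * L v + n\<^sup>2 / 2)) has_integral c * (n * (A (1 / 4) - A v1) + (1 / 4 - v1) * (n\<^sup>2 / 2))) {v1..1 / 4}"
      using L_int[of v1 "1 / 4"] has_integral_const_real[of "n\<^sup>2 / 2" v1 "1 / 4"] v1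
      by (intro has_integral_mult_right has_integral_add) auto
    then have 1: "c * (n * (A (1 / 4) - A v1) + (1 / 4 - v1) * (n\<^sup>2 / 2)) \<le> integral {v1..1 / 4} (\<lambda>v. ?S v - ?C v)"
      using v1 slope_powr_gain(2)[OF _ _ n_def L_def]
      by (intro integral_gain[where g = "\<lambda>v. c * (n * L v + n\<^sup>2 / 2)"] contD) (auto simp: c_def)
    have "((\<lambda>v. c * (n * L v)) has_integral c * (n * (A 1 - A (1 / 4)))) {1 / 4..1}"
      using L_int[of "1 / 4" 1] by (intro has_integral_mult_right) auto
    then have 2: "c * (n * (A 1 - A (1 / 4))) \<le> integral {1 / 4..1} (\<lambda>v. ?S v - ?C v)"
      using v1 slope_powr_gain(1)[OF _ _ n_def L_def]
      by (intro integral_gain[where g = "\<lambda>v. c * (n * L v)"] contD) (auto simp: c_def)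
    have "integral {v1..1 / 4} (\<lambda>v. ?S v - ?C v) + integral {1 / 4..1} (\<lambda>v. ?S v - ?C v)
        = integral {v1..1} (\<lambda>v. ?S v - ?C v)"
      using v1 by (intro Henstock_Kurzweil_Integration.integral_combine integrable_continuous_real contD) auto
    also have "\<dots> = integral {v1..1} ?S - integral {v1..1} ?C"
      using v1 contS contC by (intro integral_diff integrable_continuous_real) (auto intro: continuous_on_subset)
    also have "integral {v1..1} ?C = integral {0..1} ?C - integral {0..v1} ?C"
      using v1 Henstock_Kurzweil_Integration.integral_combine[of 0 v1 1 ?C] integrable_continuous_real[OF contC] by simp
    finally have 3: "integral {v1..1 / 4} (\<lambda>v. ?S v - ?C v) + integral {1 / 4..1} (\<lambda>v. ?S v - ?C v)
      = integral {v1..1} ?S - integral {0..1} ?C + integral {0..v1} ?C" by simp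
    have "integral {0..v1} ?C \<le> integral {0..v1} (\<lambda>_. 1)"
    proof (rule integral_le)
      show "?C integrable_on {0..v1}" using v1 contC by (intro integrable_continuous_real) (auto intro: continuous_on_subset)
      show "?C v \<le> 1" if "v \<in> {0..v1}" for v
        using that v1 n0 powr_mono2[of n "1 - v\<^sup>2" 1] by (auto simp: abs_square_le_1)
    qed auto
    then have 4: "integral {0..v1} ?C \<le> v1" using v1 by simp
    show ?thesis using 1 2 3 4 A_ends by (simp add: algebra_simps)
  qed
  have "((\<lambda>v1. c * (n\<^sup>2 / 2) * (1 / 4 - v1) - c * n * A v1 - v1) \<longlongrightarrow> c * (n\<^sup>2 / 2) * (1 / 4 - 0) - c * n * A 0 - 0) (at_right 0)"
  proof -
    have "(A \<longlongrightarrow> A 0) (at_right 0)"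
      using contA at_within_Icc_at_right[of 0 "1::real"] by (simp add: continuous_on_def) (metis atLeastAtMost_iff order_refl zero_le_one)
    then show ?thesis by (intro tendsto_intros)
  qed
  moreover have "0 < c * (n\<^sup>2 / 2) * (1 / 4 - 0) - c * n * A 0 - 0" using n0 c0 A_ends by simp
  ultimately have "\<forall>\<^sub>F v1 in at_right 0. 0 < c * (n\<^sup>2 / 2) * (1 / 4 - v1) - c * n * A v1 - v1"
    by (rule order_tendstoD(1))
  moreover have "\<forall>\<^sub>F v1 in at_right (0::real). 0 < v1 \<and> v1 < 1 / 4"
    by (rule eventually_at_rightI[of 0 "1 / 4"]) auto
  ultimately have "\<forall>\<^sub>F v1 in at_right 0. 0 < c * (n\<^sup>2 / 2) * (1 / 4 - v1) - c * n * A v1 - v1 \<and> 0 < v1 \<and> v1 < 1 / 4"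
    by (rule eventually_conj)
  from eventually_happens'[OF trivial_limit_at_right_real this]
  obtain v1 where "0 < c * (n\<^sup>2 / 2) * (1 / 4 - v1) - c * n * A v1 - v1" "0 < v1" "v1 < 1 / 4" by blast
  then show thesis using gain[of v1] that[of v1] by (simp add: n_def)
qed

text \<open>Near \<open>0\<close> the slope is at least \<open>1 / (4 v)\<close>, whose integral diverges logarithmically, and its power \<open>nu \<ge> 1\<close> is
larger still.\<close>

lemma slope_integral_unbounded:
  assumes "1 \<le> nu"
  obtains v1 where "0 < v1" "v1 < 1" "K < integral {v1..1} (\<lambda>v. slope v powr nu)"
proof -
  \<comment> \<open>The integral of \<open>1 / (4 * v)\<close> from here to \<open>1 / 3\<close> is exactly \<open>\<bar>K\<bar> + 1\<close>.\<close>
  define v1 where "v1 = exp (- 4 * (\<bar>K\<bar> + 1)) / 3"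
  have v1: "0 < v1" "v1 < 1 / 3" by (auto simp: v1_def)
  have cont: "continuous_on {v1..1} (\<lambda>v. slope v powr nu)" using continuous_on_slope_powr v1 by simp
  have "((\<lambda>v. 1 / (4 * v)) has_integral (ln (1 / 3) / 4 - ln v1 / 4)) {v1..1 / 3}"
    using v1 by (intro fundamental_theorem_of_calculus)
      (auto simp flip: has_real_derivative_iff_has_vector_derivative intro!: derivative_eq_intros)
  then have "ln (1 / 3) / 4 - ln v1 / 4 \<le> integral {v1..1 / 3} (\<lambda>v. slope v powr nu)"
  proof (rule integral_gain[rotated])
    fix v assume v: "v \<in> {v1<..<1 / 3}"
    then have v0: "0 < v" "v < 1 / 3" using v1 by auto
    have v2: "v\<^sup>2 \<le> 1 / 9" using power_mono[of v "1 / 3" 2] v0 by (simp add: power2_eq_square)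
    have 1: "1 \<le> slope v" using v0 v2 by (simp add: slope_def field_simps)
    have "1 / (4 * v) \<le> slope v" using v0 v2 by (simp add: slope_def field_simps)
    also have "slope v \<le> slope v powr nu" using powr_mono[of 1 nu "slope v"] 1 assms by simp
    finally show "1 / (4 * v) \<le> slope v powr nu" .
  qed (use v1 in \<open>auto intro: continuous_on_subset[OF cont]\<close>)
  also have "\<dots> \<le> integral {v1..1} (\<lambda>v. slope v powr nu)"
    using v1 by (intro integral_subset_le integrable_continuous_real continuous_on_subset[OF cont]) auto
  finally have "ln (1 / 3) / 4 - ln v1 / 4 \<le> integral {v1..1} (\<lambda>v. slope v powr nu)" .
  moreover have "ln (1 / 3) / 4 - ln v1 / 4 = \<bar>K\<bar> + 1" by (simp add: v1_def ln_div field_simps)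
  ultimately show thesis using that[of v1] v1 by simp
qed

end

section \<open>Lifespans for small pressure\<close>

context exponent
begin

text \<open>Dropping \<open>y powr (2 * mu)\<close> from the square of the speed bounds the kernel by \<open>x powr (- 1 / 2)\<close> times a
fixed function, and the substitution \<open>y powr (2 * mu) = 1 - v\<^sup>2\<close> turns its integral into the one on the right.\<close>

lemma duration_above_bound:
  assumes x: "0 < x"
  shows "duration x \<le> 2 / mu * (x powr (- 1 / 2) * integral {0..1} (\<lambda>v. (1 - v\<^sup>2) powr (nu / 2)))"
proof -
  define m where "m = 1 / (2 * mu)"
  have m: "0 < m" "m * mu = 1 / 2" "m * (2 * mu) = 1" "m - 1 / 2 = nu / 2"
    using mu by (auto simp: m_def nu_def field_simps)
  define f where "f t = sin t powr mu / sqrt (chord (sin t))" for t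
  define g where "g v = arcsin ((1 - v\<^sup>2) powr m)" for v
  have sin_nonneg: "0 \<le> sin t" if "t \<in> {0..pi / 2}" for t using that by (intro sin_ge_zero) auto
  have contf: "continuous_on {0..pi / 2} f"
    unfolding f_def using sin_nonneg mu(1) chord_pos[OF sin_nonneg]
    by (intro continuous_intros continuous_on_chord_compose continuous_on_powr') (auto simp: less_imp_neq[symmetric])
  have y_range: "0 \<le> (1 - v\<^sup>2) powr m \<and> (1 - v\<^sup>2) powr m \<le> 1" if "v \<in> {0..1}" for v :: real
    using that m powr_mono2[of m "1 - v\<^sup>2" 1] by (auto simp: abs_square_le_1)
  have contg: "continuous_on {0..1} g"
    unfolding g_def using m y_range
    by (intro continuous_intros continuous_on_powr') (auto simp: abs_square_le_1 intro: order_trans[of "-1" 0])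
  have g_range: "g ` {0..1} \<subseteq> {0..pi / 2}"
  proof (rule image_subsetI)
    fix v :: real assume "v \<in> {0..1}"
    note range = y_range[OF this]
    then have "- 1 \<le> (1 - v\<^sup>2) powr m" by linarith
    from arcsin_ubound[OF this] show "g v \<in> {0..pi / 2}"
      using range arcsin_nonneg[of "(1 - v\<^sup>2) powr m"] by (simp add: g_def)
  qed
  define g' where "g' v = inverse (sqrt (1 - ((1 - v\<^sup>2) powr m)\<^sup>2)) * (m * (1 - v\<^sup>2) powr (m - 1) * (- 2 * v))" for v
  have y_lt: "0 < (1 - v\<^sup>2) powr m \<and> (1 - v\<^sup>2) powr m < 1" if "0 < v" "v < 1" for v :: real
  proof -
    have "0 < 1 - v\<^sup>2" "1 - v\<^sup>2 < 1" using that by (simp_all add: abs_square_less_1)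
    then show ?thesis using powr_less_mono2[OF m(1) less_imp_le, of "1 - v\<^sup>2" 1] by simp
  qed
  have g_deriv: "(g has_real_derivative g' v) (at v)" if v: "0 < v" "v < 1" for v
  proof -
    have "0 < 1 - v\<^sup>2" using v by (simp add: abs_square_less_1)
    then have "((\<lambda>v. (1 - v\<^sup>2) powr m) has_real_derivative m * (1 - v\<^sup>2) powr (m - 1) * (- 2 * v)) (at v)"
      by (auto intro!: derivative_eq_intros)
    from DERIV_chain2[OF DERIV_arcsin this] y_lt[OF v]
    show ?thesis unfolding g_def[abs_def] g'_def by auto
  qed
  have "((\<lambda>v. g' v *\<^sub>R f (g v)) has_integral (integral {g 0..g 1} f - integral {g 1..g 0} f)) {0..1}"
    using g_deriv
    by (intro has_integral_substitution_general[of "{0, 1}" _ _ _ 0 "pi / 2"] g_range contf contg)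
      (auto intro: has_field_derivative_at_within)
  moreover have "g 0 = pi / 2" "g 1 = 0" by (simp_all add: g_def)
  ultimately have "((\<lambda>v. g' v * f (g v)) has_integral - integral {0..pi / 2} f) {0..1}" by simp
  moreover have "g' v * f (g v) = - (1 / mu) * (1 - v\<^sup>2) powr (nu / 2)" if "v \<in> {0..1} - {0, 1}" for v
  proof -
    have v: "0 < v" "v < 1" using that by auto
    let ?c = "1 - v\<^sup>2" and ?y = "(1 - v\<^sup>2) powr m"
    have c: "0 < ?c" using v by (simp add: abs_square_less_1)
    have y: "0 < ?y" "?y < 1" using y_lt[OF v] by auto
    have y2: "0 < 1 - ?y\<^sup>2" using y by (simp add: abs_square_less_1)
    have "?y powr (2 * mu) = ?c" using c by (simp add: powr_powr m(3))
    then have "chord ?y = v\<^sup>2 / (1 - ?y\<^sup>2)" using y by (simp add: chord_def)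
    then have "sqrt (chord ?y) = v / sqrt (1 - ?y\<^sup>2)" using v by (simp add: real_sqrt_divide)
    moreover have "?y powr mu = ?c powr (1 / 2)" by (simp add: powr_powr m(2))
    moreover have "- 1 \<le> ?y" "?y \<le> 1" using y by linarith+
    then have "sin (g v) = ?y" unfolding g_def by (rule sin_arcsin)
    ultimately have "f (g v) = ?c powr (1 / 2) * sqrt (1 - ?y\<^sup>2) / v" by (simp add: f_def)
    then have "g' v * f (g v) = - (2 * m) * (?c powr (m - 1) * ?c powr (1 / 2))"
      using y2 v by (simp add: g'_def field_simps)
    also have "?c powr (m - 1) * ?c powr (1 / 2) = ?c powr (nu / 2)"
    proof -
      have "m - 1 + 1 / 2 = nu / 2" using m(4) by simp
      then show ?thesis by (metis powr_add)
    qed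
    finally show ?thesis by (simp add: m_def)
  qed
  ultimately have "((\<lambda>v. - (1 / mu) * (1 - v\<^sup>2) powr (nu / 2)) has_integral - integral {0..pi / 2} f) {0..1}"
    using has_integral_spike_finite_eq[of "{0, 1}" "{0..1}" "\<lambda>v. - (1 / mu) * (1 - v\<^sup>2) powr (nu / 2)" "\<lambda>v. g' v * f (g v)"] by simp
  then have "integral {0..1} (\<lambda>v. - (1 / mu) * (1 - v\<^sup>2) powr (nu / 2)) = - integral {0..pi / 2} f"
    by (rule integral_unique)
  then have f_int: "integral {0..pi / 2} f = 1 / mu * integral {0..1} (\<lambda>v. (1 - v\<^sup>2) powr (nu / 2))"
    by simp
  have "integral {0..pi / 2} (\<lambda>t. kernel x (sin t)) \<le> integral {0..pi / 2} (\<lambda>t. x powr (- 1 / 2) * f t)"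
  proof (intro integral_le integrable_continuous_real)
    show "continuous_on {0..pi / 2} (\<lambda>t. kernel x (sin t))"
      using x by (intro continuous_on_subset[OF continuous_on_kernel]) auto
    show "continuous_on {0..pi / 2} (\<lambda>t. x powr (- 1 / 2) * f t)" by (intro continuous_intros contf)
    fix t assume "t \<in> {0..pi / 2}"
    then have y: "0 \<le> sin t" by (rule sin_nonneg)
    have pos: "0 < x * chord (sin t)" using x chord_pos[OF y] by simp
    have "kernel x (sin t) = sin t powr mu / speed x (sin t)" using x by (simp add: kernel_def)
    also have "\<dots> \<le> sin t powr mu / sqrt (x * chord (sin t))"
      using pos by (intro divide_left_mono mult_pos_pos) (auto simp: speed_def add_nonneg_pos)
    also have "\<dots> = x powr (- 1 / 2) * f t"
      using x by (simp add: f_def real_sqrt_mult powr_minus_divide powr_half_sqrt)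
    finally show "kernel x (sin t) \<le> x powr (- 1 / 2) * f t" .
  qed
  then show ?thesis using x by (simp add: duration_half f_int)
qed

text \<open>Only phases with \<open>y \<le> d\<close> are kept. There \<open>chord y \<ge> 1 - d powr (2 * mu)\<close>, so the kernel is at most
\<open>q y = y powr mu / sqrt (y powr (2 * mu) + e')\<close>, and \<open>y powr mu = sqrt e' * slope v\<close> turns the integral of
\<open>1 - q\<close> into a power of \<open>e'\<close> times an integral over \<open>[v1, 1]\<close>; the last hypothesis says that this range of \<open>v\<close>
stays within \<open>y \<le> d\<close>.\<close>

lemma duration_below_bound:
  assumes v1: "0 < v1" "v1 < 1" and d: "0 < d" "d < 1" and e: "0 < e"
    and e': "e' = e * (1 - d powr (2 * mu))"
    and small: "e' powr (1 / (2 * mu)) * slope v1 powr (1 / mu) \<le> d"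
  shows "2 / mu * (e' powr (1 / (2 * mu)) * integral {v1..1} (\<lambda>v. slope v powr nu)) \<le> pi - duration e"
proof -
  define m where "m = 1 / (2 * mu)"
  define E where "E = e' powr m"
  define Y where "Y v = E * slope v powr (1 / mu)" for v
  define q where "q y = y powr mu / sqrt (y powr (2 * mu) + e')" for y
  define f where "f t = (1 - q (sin t)) * cos t" for t
  define g where "g v = arcsin (Y v)" for v
  have "d powr (2 * mu) < 1" using d mu powr_less_mono2[of "2 * mu" d 1] by simp
  then have e'_pos: "0 < e'" using e by (simp add: e')
  then have E: "0 < E" "E powr mu = sqrt e'" "E powr (2 * mu) = e'"
    using mu by (auto simp: E_def m_def powr_powr powr_half_sqrt)
  have sin_nonneg: "0 \<le> sin t" if "t \<in> {0..pi / 2}" for t using that by (intro sin_ge_zero) auto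
  have qpos: "0 < y powr (2 * mu) + e'" for y using e'_pos by (simp add: add_nonneg_pos)
  have q_le: "q y \<le> 1" for y
  proof -
    have "y powr mu = sqrt (y powr (2 * mu))" by (simp flip: powr_mu_sq)
    then show ?thesis using qpos[of y] e'_pos by (simp add: q_def)
  qed
  have contf: "continuous_on {0..pi / 2} f"
    unfolding f_def q_def using sin_nonneg mu(1) qpos
    by (intro continuous_intros continuous_on_powr') (auto simp: less_imp_neq[symmetric])
  have slope_pos: "0 < slope v" if "0 < v" "v < 1" for v using that by (simp add: slope_def abs_square_less_1)
  have slope_anti: "slope v \<le> slope v1" if "v1 \<le> v" "v \<le> 1" for v
    using that v1 by (auto simp: slope_def abs_square_le_1 intro!: frac_le power_mono) 
  have Y_range: "0 \<le> Y v \<and> Y v \<le> d" if v: "v \<in> {v1..1}" for v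
  proof -
    have "slope v powr (1 / mu) \<le> slope v1 powr (1 / mu)"
      using slope_anti v v1 slope_nonneg[of v] mu by (intro powr_mono2) auto
    then have "Y v \<le> Y v1" using E by (simp add: Y_def)
    also have "Y v1 \<le> d" using small by (simp add: Y_def E_def m_def)
    finally show ?thesis using E by (simp add: Y_def)
  qed
  have contY: "continuous_on {v1..1} Y"
    unfolding Y_def slope_def using v1 mu slope_nonneg[unfolded slope_def]
    by (intro continuous_intros continuous_on_powr') auto
  have contg: "continuous_on {v1..1} g"
    unfolding g_def using Y_range d by (intro continuous_on_arcsin contY) force
  have g_range: "g ` {v1..1} \<subseteq> {0..pi / 2}"
  proof (rule image_subsetI)
    fix v assume "v \<in> {v1..1}"
    from Y_range[OF this] show "g v \<in> {0..pi / 2}"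
      using arcsin_nonneg[of "Y v"] arcsin_ubound[of "Y v"] d by (simp add: g_def)
  qed
  define Y' where "Y' v = E * (1 / mu * slope v powr (1 / mu - 1) * (- (1 + v\<^sup>2) / (2 * v\<^sup>2)))" for v
  define g' where "g' v = inverse (sqrt (1 - (Y v)\<^sup>2)) * Y' v" for v
  have g_deriv: "(g has_real_derivative g' v) (at v)" if v: "v1 < v" "v < 1" for v
  proof -
    have v0: "0 < v" using v v1 by simp
    have "(slope has_real_derivative (- (1 + v\<^sup>2) / (2 * v\<^sup>2))) (at v)"
      unfolding slope_def[abs_def] using v0
      by (auto intro!: derivative_eq_intros simp: field_simps power2_eq_square)
    from DERIV_fun_powr[OF this, of "1 / mu"] have "((\<lambda>v. slope v powr (1 / mu)) has_real_derivative
        1 / mu * slope v powr (1 / mu - 1) * (- (1 + v\<^sup>2) / (2 * v\<^sup>2))) (at v)"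
      using slope_pos[OF v0 v(2)] by simp
    then have "(Y has_real_derivative Y' v) (at v)"
      unfolding Y_def[abs_def] Y'_def by (rule DERIV_cmult)
    from DERIV_chain2[OF DERIV_arcsin this] Y_range[of v] v d
    show ?thesis unfolding g_def[abs_def] g'_def by auto
  qed
  have "((\<lambda>v. g' v *\<^sub>R f (g v)) has_integral (integral {g v1..g 1} f - integral {g 1..g v1} f)) {v1..1}"
    using g_deriv v1
    by (intro has_integral_substitution_general[of "{v1, 1}" _ _ _ 0 "pi / 2"] g_range contf contg)
      (auto intro: has_field_derivative_at_within)
  moreover have g1: "g 1 = 0" by (simp add: g_def Y_def slope_def)
  moreover have g_v1: "0 < g v1"
  proof -
    have "0 < Y v1" "Y v1 \<le> 1" using Y_range[of v1] v1 d E slope_pos[of v1] by (auto simp: Y_def)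
    then show ?thesis using arcsin_less_arcsin[of 0 "Y v1"] by (simp add: g_def)
  qed
  ultimately have "((\<lambda>v. g' v * f (g v)) has_integral - integral {0..g v1} f) {v1..1}" by simp
  moreover have "g' v * f (g v) = - (E / mu) * slope v powr nu" if "v \<in> {v1..1} - {v1, 1}" for v
  proof -
    have v: "0 < v" "v < 1" "v \<in> {v1..1}" using that v1 by auto
    have Yv: "0 \<le> Y v" "Y v < 1" using Y_range[OF v(3)] d by auto
    have Y2: "0 < 1 - (Y v)\<^sup>2" using Yv by (simp add: abs_square_less_1)
    have s: "0 < slope v" by (rule slope_pos[OF v(1,2)])
    have "Y v powr mu = sqrt e' * slope v" "Y v powr (2 * mu) = e' * (slope v)\<^sup>2"
      using s mu E by (auto simp: Y_def powr_mult powr_powr powr_numeral)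
    then have "q (Y v) = sqrt e' * slope v / sqrt (e' * (1 + (slope v)\<^sup>2))"
      by (simp add: q_def algebra_simps)
    also have "\<dots> = slope v / sqrt (1 + (slope v)\<^sup>2)" using e'_pos by (simp add: real_sqrt_mult)
    also have "1 + (slope v)\<^sup>2 = ((1 + v\<^sup>2) / (2 * v))\<^sup>2"
      using v by (simp add: slope_def field_simps power2_eq_square)
    also have "sqrt (((1 + v\<^sup>2) / (2 * v))\<^sup>2) = (1 + v\<^sup>2) / (2 * v)" using v by simp
    also have "slope v / ((1 + v\<^sup>2) / (2 * v)) = (1 - v\<^sup>2) / (1 + v\<^sup>2)" using v by (simp add: slope_def)
    also have "\<dots> = 1 - 2 * v\<^sup>2 / (1 + v\<^sup>2)"
      by (simp add: field_simps add_nonneg_eq_0_iff)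
    finally have q: "1 - q (Y v) = 2 * v\<^sup>2 / (1 + v\<^sup>2)" by simp
    have "cos (g v) = sqrt (1 - (Y v)\<^sup>2)" using Yv by (simp add: g_def cos_arcsin)
    then have "g' v * f (g v) = Y' v * (1 - q (Y v))"
      using Y2 Yv by (simp add: g'_def f_def g_def)
    also have "\<dots> = - (E / mu) * slope v powr (1 / mu - 1) * ((1 + v\<^sup>2) / (2 * v\<^sup>2) * (2 * v\<^sup>2 / (1 + v\<^sup>2)))"
      unfolding q Y'_def by (simp only: minus_divide_left[symmetric] mult_minus_left mult_minus_right) (simp add: mult_ac)
    also have "(1 + v\<^sup>2) / (2 * v\<^sup>2) * (2 * v\<^sup>2 / (1 + v\<^sup>2)) = 1"
      using v by (simp add: add_nonneg_eq_0_iff)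
    finally show ?thesis by (simp add: nu_def)
  qed
  ultimately have "((\<lambda>v. - (E / mu) * slope v powr nu) has_integral - integral {0..g v1} f) {v1..1}"
    using has_integral_spike_finite_eq[of "{v1, 1}" "{v1..1}" "\<lambda>v. - (E / mu) * slope v powr nu" "\<lambda>v. g' v * f (g v)"] by simp
  then have "integral {v1..1} (\<lambda>v. - (E / mu) * slope v powr nu) = - integral {0..g v1} f"
    by (rule integral_unique)
  then have f_int: "E / mu * integral {v1..1} (\<lambda>v. slope v powr nu) = integral {0..g v1} f"
    by simp
  have gv: "g v1 \<le> pi / 2" using g_range v1 by (simp add: image_subset_iff)
  let ?k = "\<lambda>t. 1 - kernel e (sin t)"
  have contk: "continuous_on {0..pi / 2} ?k"
    using e by (intro continuous_intros continuous_on_subset[OF continuous_on_kernel]) auto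
  have k_eq: "kernel e y = y powr mu / speed e y" for y using e by (simp add: kernel_def)
  have k_nonneg: "0 \<le> ?k t" if t: "t \<in> {0..pi / 2}" for t
  proof -
    have "sin t powr mu = sqrt (sin t powr (2 * mu))" by (simp flip: powr_mu_sq)
    also have "\<dots> \<le> speed e (sin t)" using e chord_pos[OF sin_nonneg[OF t]] by (simp add: speed_def)
    finally show ?thesis using speed_pos[of e "sin t"] e sin_nonneg[OF t] by (simp add: k_eq)
  qed
  have "integral {0..g v1} f \<le> integral {0..g v1} ?k"
  proof (intro integral_le integrable_continuous_real)
    show "continuous_on {0..g v1} f" "continuous_on {0..g v1} ?k"
      using gv by (auto intro: continuous_on_subset[OF contf] continuous_on_subset[OF contk])
    fix t assume t: "t \<in> {0..g v1}"
    then have t': "t \<in> {0..pi / 2}" using gv by auto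
    let ?y = "sin t"
    have y0: "0 \<le> ?y" by (rule sin_nonneg[OF t'])
    have "?y \<le> sin (g v1)" using t gv by (intro sin_monotone_2pi_le) auto
    also have "\<dots> \<le> d" using Y_range[of v1] v1 d by (simp add: g_def)
    finally have yd: "?y \<le> d" .
    have "1 - d powr (2 * mu) \<le> 1 - ?y powr (2 * mu)" using yd y0 mu by (simp add: powr_mono2)
    also have "\<dots> = (1 - ?y\<^sup>2) * chord ?y" using chord_mult[OF y0] by simp
    also have "\<dots> \<le> chord ?y" using chord_pos[OF y0] by (simp add: mult_left_le_one_le y0 yd d abs_square_le_1)
    finally have "e' \<le> e * chord ?y" using e by (simp add: e')
    then have "sqrt (?y powr (2 * mu) + e') \<le> speed e ?y" by (simp add: speed_def)
    moreover have "0 < sqrt (?y powr (2 * mu) + e')" using qpos by simp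
    ultimately have kq: "kernel e ?y \<le> q ?y"
      unfolding k_eq q_def by (intro divide_left_mono mult_pos_pos order_less_le_trans[of 0 _ "speed e ?y"]) simp_all
    have "f t \<le> 1 - q ?y" unfolding f_def using q_le[of ?y] by (intro mult_left_le) auto
    then show "f t \<le> ?k t" using kq by simp
  qed
  also have "\<dots> \<le> integral {0..pi / 2} ?k"
    using gv k_nonneg by (intro integral_subset_le integrable_continuous_real continuous_on_subset[OF contk]) auto
  also have "\<dots> = integral {0..pi / 2} (\<lambda>_. 1) - integral {0..pi / 2} (\<lambda>t. kernel e (sin t))"
    using e by (intro integral_diff integrable_continuous_real continuous_on_subset[OF continuous_on_kernel]) auto
  finally have "E / mu * integral {v1..1} (\<lambda>v. slope v powr nu) \<le> pi / 2 - duration e / 2"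
    using f_int e duration_half[of e] by simp
  then show ?thesis by (simp add: E_def m_def)
qed

end

section \<open>Realized and excluded combinations\<close>

context exponent
begin

lemma ratio_root_bound:
  assumes "1 < x"
  shows "x powr (- 1 / 2) \<le> ratio x powr (1 / (2 * mu))"
proof -
  have "x powr - mu = x * x powr - lam" using assms powr_add[of x 1 "- lam"] by (simp add: mu_def)
  also have "\<dots> \<le> x * (x - 1) powr - lam" using assms lam_gt by (intro mult_left_mono powr_mono2') auto
  also have "\<dots> = ratio x" using assms by (simp add: ratio_def)
  finally have "(x powr - mu) powr (1 / (2 * mu)) \<le> ratio x powr (1 / (2 * mu))"
    using mu by (intro powr_mono2) auto
  moreover have "- mu * (1 / (2 * mu)) = - 1 / 2" using mu(1) by simp
  ultimately show ?thesis by (metis powr_powr)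
qed

text \<open>\<open>duration x\<close> is bounded from above and \<open>pi - duration u\<close> from below by multiples of \<open>ratio u powr m\<close> with
\<open>m = 1 / (2 * mu)\<close>, whose coefficients are the two integrals. The factor lost in the lower bound is \<open>(c * (1 - u) powr lam) powr m\<close>, which can be brought
as close to \<open>1\<close> as the strict inequality requires.\<close>

lemma low_point:
  assumes v1: "0 < v1" "v1 < 1" and k: "0 \<le> k"
    and gain: "k * integral {0..1} (\<lambda>v. (1 - v\<^sup>2) powr (nu / 2)) < integral {v1..1} (\<lambda>v. slope v powr nu)"
  obtains u x where "0 < u" "u < 1" "1 < x" "ratio x = ratio u" "duration u + k * duration x < pi"
proof -
  define K where "K = integral {0..1} (\<lambda>v::real. (1 - v\<^sup>2) powr (nu / 2))"
  define I where "I = integral {v1..1} (\<lambda>v. slope v powr nu)"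
  define m where "m = 1 / (2 * mu)"
  have m: "0 < m" "2 * mu * m = 1" using mu by (auto simp: m_def)
  have K: "0 \<le> K" unfolding K_def
    by (intro integral_nonneg integrable_continuous_real continuous_on_circle_powr) auto
  have I: "k * K < I" "0 < I" using gain K k mult_nonneg_nonneg[OF k K] unfolding K_def I_def by linarith+
  \<comment> \<open>It suffices that \<open>c * (1 - u) powr lam\<close> exceeds \<open>r powr (2 * mu) = s * s\<close>; each factor is made larger than \<open>s\<close>.\<close>
  define r where "r = k * K / I"
  have r: "0 \<le> r" "r < 1" using I K k by (auto simp: r_def)
  define s where "s = sqrt (r powr (2 * mu))"
  have "r powr (2 * mu) < 1" using r mu powr_less_mono2[of "2 * mu" r 1] by simp
  then have s: "0 \<le> s" "s < 1" "s * s = r powr (2 * mu)" by (auto simp: s_def)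
  \<comment> \<open>Chosen so that \<open>c = (1 + s) / 2\<close>.\<close>
  define d where "d = ((1 - s) / 2) powr m"
  have "(1 - s) / 2 < 1" "0 < (1 - s) / 2" using s by auto
  then have d: "0 < d" "d < 1" "d powr (2 * mu) = (1 - s) / 2"
    using m powr_less_mono2[of m "(1 - s) / 2" 1] by (auto simp: d_def powr_powr mult.commute)
  define c where "c = 1 - d powr (2 * mu)"
  have "c = (1 + s) / 2" unfolding c_def d(3) by (simp add: field_simps)
  then have c: "s < c" "0 < c" using s by auto
  have "((\<lambda>u. (1 - u) powr lam) \<longlongrightarrow> (1 - 0) powr lam) (at_right 0)"
    by (intro tendsto_intros) auto
  then have "\<forall>\<^sub>F u in at_right 0. s < (1 - u) powr lam"
    using s by (intro order_tendstoD(1)) auto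
  moreover have "((\<lambda>u. (u * c) powr m * slope v1 powr (1 / mu)) \<longlongrightarrow> (0 * c) powr m * slope v1 powr (1 / mu)) (at_right 0)"
    using m c by (intro tendsto_intros tendsto_powr') (auto intro!: eventually_at_rightI[of 0 1])
  then have "\<forall>\<^sub>F u in at_right 0. (u * c) powr m * slope v1 powr (1 / mu) < d"
    using d by (intro order_tendstoD(2)) auto
  moreover have "\<forall>\<^sub>F u in at_right (0::real). 0 < u \<and> u < 1"
    by (rule eventually_at_rightI[of 0 1]) auto
  ultimately have "\<forall>\<^sub>F u in at_right 0. s < (1 - u) powr lam \<and>
      (u * c) powr m * slope v1 powr (1 / mu) < d \<and> 0 < u \<and> u < 1"
    by eventually_elim simp
  from eventually_happens'[OF trivial_limit_at_right_real this]
  obtain u where u: "s < (1 - u) powr lam" "(u * c) powr m * slope v1 powr (1 / mu) < d" "0 < u" "u < 1" by blast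
  obtain x where x: "1 < x" "ratio x = ratio u" using ratio_surj_above[OF ratio_pos[of u]] u by auto
  have above: "k * duration x \<le> 2 / mu * (ratio u powr m * (k * K))"
  proof -
    have "duration x \<le> 2 / mu * (x powr (- 1 / 2) * K)" using duration_above_bound[of x] x by (simp add: K_def)
    also have "\<dots> \<le> 2 / mu * (ratio u powr m * K)"
      using ratio_root_bound[OF x(1)] x(2) K mu by (intro mult_left_mono mult_right_mono) (auto simp: m_def)
    finally show ?thesis using mult_left_mono[OF _ k] by (fastforce simp: mult_ac)
  qed
  have below: "2 / mu * ((u * c) powr m * I) \<le> pi - duration u"
    using duration_below_bound[OF v1 d(1,2) u(3) refl] u(2) by (simp add: I_def m_def c_def)
  have "ratio u powr m * (k * K) < (u * c) powr m * I"
  proof -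
    have "s * s < c * (1 - u) powr lam" using c u s by (intro mult_strict_mono') auto
    then have "(s * s) powr m < (c * (1 - u) powr lam) powr m" using s m by (intro powr_less_mono2) auto
    moreover have "(s * s) powr m = r" unfolding s(3) using r m by (simp add: powr_powr)
    ultimately have "r * I < (c * (1 - u) powr lam) powr m * I" using I by simp
    moreover have "r * I = k * K" using I by (simp add: r_def)
    ultimately have "ratio u powr m * (k * K) < ratio u powr m * ((c * (1 - u) powr lam) powr m * I)"
      using ratio_pos[of u] u by (intro mult_strict_left_mono) auto
    also have "\<dots> = (ratio u * (c * (1 - u) powr lam)) powr m * I"
      by (simp add: powr_mult)
    also have "ratio u * (c * (1 - u) powr lam) = u * c"
      using u by (simp add: ratio_def powr_minus field_simps)
    finally show ?thesis .
  qed
  then have "2 / mu * (ratio u powr m * (k * K)) < 2 / mu * ((u * c) powr m * I)"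
    using mu by (intro mult_strict_left_mono) auto
  then have "duration u + k * duration x < pi" using above below by linarith
  then show thesis using that[of u x] u x by auto
qed

lemma small_duration:
  assumes "0 < d"
  obtains u x where "0 < u" "u < 1" "1 < x" "ratio x = ratio u" "duration x < d"
proof -
  let ?K = "integral {0..1} (\<lambda>v::real. (1 - v\<^sup>2) powr (nu / 2))"
  have "((\<lambda>x::real. x powr (- 1 / 2)) \<longlongrightarrow> 0) at_top" by real_asymp
  then have "((\<lambda>x::real. 2 / mu * (x powr (- 1 / 2) * ?K)) \<longlongrightarrow> 2 / mu * (0 * ?K)) at_top"
    by (intro tendsto_intros)
  then have "\<forall>\<^sub>F x::real in at_top. 2 / mu * (x powr (- 1 / 2) * ?K) < d"
    using assms by (intro order_tendstoD(2)) auto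
  then have "\<forall>\<^sub>F x::real in at_top. 2 / mu * (x powr (- 1 / 2) * ?K) < d \<and> 1 < x"
    using eventually_gt_at_top[of 1] by (rule eventually_conj)
  from eventually_happens'[OF trivial_limit_at_top_linorder this]
  obtain x :: real where x: "2 / mu * (x powr (- 1 / 2) * ?K) < d" "1 < x" by blast
  have sx: "duration x < d" using duration_above_bound[of x] x by linarith
  have "0 < ratio x" using ratio_pos[of x] x by simp
  moreover obtain u where "0 \<le> u" "u < 1" "ratio u = ratio x" "ratio x = 0 \<longleftrightarrow> u = 0"
    using ratio_surj_below[of "ratio x"] \<open>0 < ratio x\<close> by auto
  ultimately show thesis using that[of u x] x sx by auto
qed

lemma balanced_gluing:
  fixes p q :: nat
  assumes "4 \<le> p + q" "even (p + q)"
    and "0 < u0" "u0 < 1" "1 < x0" "ratio x0 = ratio u0" "p * duration u0 + q * duration x0 < 2 * pi"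
  shows "solution_by_gluing_in_any_order lam p q \<and> combination_possible lam p q"
proof -
  obtain u x where u: "0 < u" "u < 1" "1 < x" "ratio x = ratio u" "p * duration u + q * duration x = 2 * pi"
    using balance[OF assms(1,3-7)] by blast
  interpret U: arc lam u by unfold_locales (use u in auto)
  have "pressure x = pressure u" using u(4) by (simp add: pressure_ratio)
  then show ?thesis
    using gluing_possible[of p q u "pressure u" x] assms(2) u U.P_le by auto
qed

lemma few_plus_gluing:
  fixes p q :: nat
  assumes "4 \<le> p + q" "even (p + q)" "p \<le> 1"
  shows "solution_by_gluing_in_any_order lam p q \<and> combination_possible lam p q"
proof -
  have q: "0 < q" using assms by linarith
  obtain u x where u: "0 < u" "u < 1" "1 < x" "ratio x = ratio u" "duration x < pi / q"
    using small_duration[of "pi / q"] q by auto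
  have "q * duration x < pi" using u(5) q by (simp add: field_simps)
  moreover have "p * duration u \<le> 1 * pi"
    using duration_bounds(2)[of u] duration_bounds(1)[of u] u assms(3) lam_gt
    by (intro mult_mono) (auto intro: order_trans[of 0 "pi / lam"])
  ultimately show ?thesis using balanced_gluing[OF assms(1,2) u(1-4)] by simp
qed

lemma two_plus_gluing:
  fixes q :: nat
  assumes "0 < q" "even q" and v1: "0 < v1" "v1 < 1"
    and gain: "real q / 2 * integral {0..1} (\<lambda>v. (1 - v\<^sup>2) powr (nu / 2)) < integral {v1..1} (\<lambda>v. slope v powr nu)"
  shows "solution_by_gluing_in_any_order lam 2 q \<and> combination_possible lam 2 q"
proof -
  obtain u x where u: "0 < u" "u < 1" "1 < x" "ratio x = ratio u" "duration u + real q / 2 * duration x < pi"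
    using low_point[OF v1 _ gain] by auto
  have "2 \<le> q" using assms(1,2) by (auto elim: evenE)
  then show ?thesis using balanced_gluing[of 2 q u x] assms(2) u by simp
qed

lemma plus_plus_gluing: "solution_by_gluing_in_any_order lam 2 0 \<and> combination_possible lam 2 0"
  using gluing_possible[of 2 0 0 0 2] by (simp add: duration_0 pressure_def)

lemma plus_plus_minus_minus_gluing: "solution_by_gluing_in_any_order lam 2 2 \<and> combination_possible lam 2 2"
proof -
  obtain v1 where "0 < v1" "v1 < 1"
    "integral {0..1} (\<lambda>v. (1 - v\<^sup>2) powr (nu / 2)) < integral {v1..1} (\<lambda>v. slope v powr nu)"
    using slope_integral_gain by blast
  then show ?thesis using two_plus_gluing[of 2 v1] by simp
qed

lemma two_plus_many_minus_gluing:
  fixes q :: nat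
  assumes "lam \<le> 3 / 2" "0 < q" "even q"
  shows "solution_by_gluing_in_any_order lam 2 q \<and> combination_possible lam 2 q"
proof -
  have "1 \<le> nu" using assms(1) mu(1) by (simp add: nu_def mu_def field_simps)
  then obtain v1 where "0 < v1" "v1 < 1"
    "real q / 2 * integral {0..1} (\<lambda>v. (1 - v\<^sup>2) powr (nu / 2)) < integral {v1..1} (\<lambda>v. slope v powr nu)"
    using slope_integral_unbounded by blast
  then show ?thesis using two_plus_gluing[of q v1] assms by simp
qed

text \<open>For \<open>lam \<le> 3 / 2\<close> three copies of \<open>\<psi>\<^sub>+\<close> already last longer than \<open>3 * pi / lam \<ge> 2 * pi\<close>, and two pieces that are not
both \<open>\<psi>\<^sub>+\<close> last less than \<open>2 * pi\<close>.\<close>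

lemma combination_constraints:
  assumes lam: "lam \<le> 3 / 2" and possible: "combination_possible lam p q"
  shows "p \<le> 2" "p = 0 \<Longrightarrow> 3 \<le> q" "p = 1 \<Longrightarrow> 2 \<le> q"
proof -
  obtain P Tp Tm where P: "P \<le> 0" and Tp: "0 < p \<longrightarrow> lifespan lam P Plus Tp"
    and Tm: "0 < q \<longrightarrow> lifespan lam P Minus Tm" and total: "real p * Tp + real q * Tm = 2 * pi"
    using possible unfolding combination_possible_def by blast
  have bp: "0 < p \<Longrightarrow> pi / lam < Tp \<and> Tp \<le> pi" using lifespan_bounds(1)[OF P] Tp by blast
  have bm: "0 < q \<Longrightarrow> 0 < Tm \<and> Tm < pi / lam" using lifespan_bounds(2)[OF P] Tm by blast
  have "2 * pi / 3 \<le> pi / lam" using lam lam_gt by (simp add: field_simps)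
  moreover have pil: "pi / lam < pi" using lam_gt by (simp add: field_simps)
  moreover have qn: "0 \<le> real q * Tm" using bm by (cases "q = 0") auto
  ultimately show "p \<le> 2"
  proof -
    assume a: "2 * pi / 3 \<le> pi / lam"
    show ?thesis
    proof (rule ccontr)
      assume "\<not> p \<le> 2"
      then have p: "3 \<le> real p" "0 < p" by auto
      have "2 * pi = 3 * (2 * pi / 3)" by simp
      also have "\<dots> < 3 * Tp" using a bp[OF p(2)] by linarith
      also have "3 * Tp \<le> real p * Tp"
      proof (rule mult_right_mono[OF p(1)])
        show "0 \<le> Tp" using a bp[OF p(2)] pi_gt_zero by linarith
      qed
      finally show False using total qn by simp
    qed
  qed
  show "3 \<le> q" if "p = 0"
  proof (rule ccontr)
    assume "\<not> 3 \<le> q"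
    moreover have t: "real q * Tm = 2 * pi" using total that by simp
    then have "0 < q" by (cases "q = 0") auto
    ultimately have "real q * Tm \<le> 2 * Tm" "0 < q" using bm by auto
    then show False using t bm pil by auto
  qed
  show "2 \<le> q" if "p = 1"
  proof (rule ccontr)
    assume "\<not> 2 \<le> q"
    moreover have "odd q" using possible that unfolding combination_possible_def by simp
    ultimately have "q = 1" by (metis One_nat_def less_2_cases not_le odd_pos less_numeral_extra(3))
    then show False using total that bp bm pil by auto
  qed
qed

end

theorem theorem3p3:
  fixes lam :: real
  assumes "1 < lam" and "lam < 2"
  shows "(\<forall>k::nat. 2 \<le> k \<longrightarrow> solution_by_gluing_in_any_order lam 0 (2 * k)) \<and>
    (\<forall>k::nat. 2 \<le> k \<longrightarrow> solution_by_gluing_in_any_order lam 1 (2 * k - 1)) \<and>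
    solution_by_gluing_in_any_order lam 2 0 \<and>
    solution_by_gluing_in_any_order lam 2 2 \<and>
    (lam \<le> 3 / 2 \<longrightarrow>
      (\<forall>k::nat. 2 \<le> k \<longrightarrow> solution_by_gluing_in_any_order lam 2 (2 * k)) \<and>
      (\<forall>p q. combination_possible lam p q \<longleftrightarrow>
         (\<exists>k\<ge>2. p = 0 \<and> q = 2 * k) \<or>
         (\<exists>k\<ge>2. p = 1 \<and> q = 2 * k - 1) \<or>
         p = 2 \<and> q = 0 \<or>
         p = 2 \<and> q = 2 \<or>
         (\<exists>k\<ge>2. p = 2 \<and> q = 2 * k)))"
proof -
  interpret exponent lam by unfold_locales (use assms in auto)
  have i: "solution_by_gluing_in_any_order lam 0 (2 * k) \<and> combination_possible lam 0 (2 * k)" if "2 \<le> k" for k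
    using few_plus_gluing[of 0 "2 * k"] that by simp
  have ii: "solution_by_gluing_in_any_order lam 1 (2 * k - 1) \<and> combination_possible lam 1 (2 * k - 1)" if "2 \<le> k" for k
  proof -
    have "1 + (2 * k - 1) = 2 * k" using that by simp
    then show ?thesis using few_plus_gluing[of 1 "2 * k - 1"] that by simp
  qed
  have v: "solution_by_gluing_in_any_order lam 2 (2 * k) \<and> combination_possible lam 2 (2 * k)"
    if "lam \<le> 3 / 2" "2 \<le> k" for k
    using two_plus_many_minus_gluing[of "2 * k"] that by simp
  have complete: "(\<exists>k\<ge>2. p = 0 \<and> q = 2 * k) \<or> (\<exists>k\<ge>2. p = 1 \<and> q = 2 * k - 1) \<or>
      p = 2 \<and> q = 0 \<or> p = 2 \<and> q = 2 \<or> (\<exists>k\<ge>2. p = 2 \<and> q = 2 * k)"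
    if lam: "lam \<le> 3 / 2" and possible: "combination_possible lam p q" for p q :: nat
  proof -
    note bounds = combination_constraints[OF lam possible]
    have even: "even (p + q)" using possible unfolding combination_possible_def by blast
    consider "p = 0" | "p = 1" | "p = 2" using bounds(1) by linarith
    then show ?thesis
    proof cases
      case 1
      then obtain k where "q = 2 * k" using even by (auto elim: evenE)
      then show ?thesis using 1 bounds(2) by auto
    next
      case 2
      then have "even (q + 1)" using even by simp
      then obtain k where k: "q + 1 = 2 * k" by (rule evenE)
      then have "2 \<le> k" "q = 2 * k - 1" using 2 bounds(3) by auto
      then show ?thesis using 2 by blast
    next
      case 3
      then obtain k where k: "q = 2 * k" using even by (auto elim: evenE)
      then consider "k = 0" | "k = 1" | "2 \<le> k" by linarith
      then show ?thesis using 3 k by cases auto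
    qed
  qed
  show ?thesis
    using i ii v complete plus_plus_gluing plus_plus_minus_minus_gluing by (intro conjI allI impI iffI) blast+
qed

end
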